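(* Let $n\ge1$ be an integer and $q\in\mathbb R$. A map $Z\colon\mathcal S_0^n\to M(S^{n-1})_+$ is a weak$^*$ continuous, locally determined, rotation equivariant, $q$-homogeneous valuation if and only if there is $c\ge0$ such that $Z=c\,\tilde S_q$.
   Context: $S^{n-1}$ is the unit sphere of $\mathbb R^n$; $C(S^{n-1})$ is the space of real continuous functions on $S^{n-1}$ with the supremum norm $\|\cdot\|_\infty$; $C(S^{n-1})_+$ is its subset of non-negative functions. $M(S^{n-1})_+$ is the set of (finite) non-negative Radon measures on $S^{n-1}$, and $\langle\mu,g\rangle=\int_{S^{n-1}}g\,\mathrm d\mu$. $\mathcal H^{n-1}$ is $(n-1)$-dimensional Hausdorff measure. Star bodies: a (non-empty) set $L\subset\mathbb R^n$ is a star set if $\{\lambda x:0\le\lambda\le1\}\subset L$ for every $x\in L$. Its radial function is $\rho_L(s)=\sup\{\lambda\ge0:\lambda s\in L\}$, $s\in S^{n-1}$. $L$ is a star body if $\rho_L$ is a (finite) continuous function on $S^{n-1}$. $\mathcal S_0^n$ is the set of star bodies in $\mathbb R^n$. Star bodies are identified with their radial functions, so that $L\mapsto\rho_L$ is a bijection from $\mathcal S_0^n$ onto $C(S^{n-1})_+$; $L_f$ denotes the star body with radial function $f$. Then $\rho_{K\cup L}=\max\{\rho_K,\rho_L\}$ and $\rho_{K\cap L}=\min\{\rho_K,\rho_L\}$. $\mathcal S_0^n$ carries the radial metric $\delta(K,L)=\|\rho_K-\rho_L\|_\infty$. $Z$ is a valuation if $Z(K\cup L)+Z(K\cap L)=Z(K)+Z(L)$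 for all $K,L\in\mathcal S_0^n$. $Z$ is weak$^*$ continuous if $L\mapsto\langle Z(L),g\rangle$ is continuous on $\mathcal S_0^n$ for every $g\in C(S^{n-1})$. $Z$ is rotation equivariant if $\langle Z(\phi L),\phi g\rangle=\langle Z(L),g\rangle$ for all $L\in\mathcal S_0^n$, $g\in C(S^{n-1})$, $\phi\in\mathrm O(n)$, where $\phi L=\{\phi x:x\in L\}$ and $\phi g=g\circ\phi^{-1}$. $Z$ is $q$-homogeneous if $Z(\lambda L)=\lambda^qZ(L)$ for every $\lambda>0$ and $L\in\mathcal S_0^n$. $Z$ is locally determined if, for every open $B\subset S^{n-1}$ and all $f_1,f_2\in C(S^{n-1})_+$ with $f_1=f_2$ on $B$, one has $Z(L_{f_1})(B)=Z(L_{f_2})(B)$. The $q$-th dual area measure of $L\in\mathcal S_0^n$ is $$\tilde S_q(L)(B)=\frac1n\int_B\rho_L(s)^q\,\mathrm d\mathcal H^{n-1}(s)\qquad (B\subset S^{n-1}\text{ Borel}),$$ with conventions $0^0=1$, $0^q=\infty$ for $q<0$, and $0\cdot\infty=0$ (so for $q<0$ these measures need not be finite, whereas $Z$ takes values in finite measures). *)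

theory Defs
  imports "HOL-Analysis.Analysis"
begin

abbreviation unit_sphere :: "(real^'n) set" where
  "unit_sphere \<equiv> sphere 0 1"

section \<open>Hausdorff measure\<close>

(* Normalised so that the d-dimensional measure on R^d is Lebesgue measure; for d = 0 a nonempty
   set of diameter 0 contributes 0 ^ 0 = 1 and the empty set contributes 0, which yields counting
   measure.  Covering sets are required to be bounded because "diameter" is meaningless otherwise. *)
definition hausdorff_content :: "nat \<Rightarrow> real \<Rightarrow> 'a::metric_space set \<Rightarrow> ennreal" where
  "hausdorff_content d e A =
     (INF U \<in> {U :: nat \<Rightarrow> 'a set. A \<subseteq> (\<Union>i. U i) \<and> (\<forall>i. bounded (U i) \<and> diameter (U i) \<le> e)}.
        (\<Sum>i. if U i = {} then 0 else ennreal (unit_ball_vol (real d) * (diameter (U i) / 2) ^ d)))"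

definition hausdorff_outer :: "nat \<Rightarrow> 'a::metric_space set \<Rightarrow> ennreal" where
  "hausdorff_outer d A = (SUP e \<in> {0<..}. hausdorff_content d e A)"

(* hausdorff_outer is a metric outer measure, hence countably additive on the Borel sets, so
   measure_of does not fall back to the null measure here. *)
definition hausdorff_measure :: "nat \<Rightarrow> 'a::metric_space measure" where
  "hausdorff_measure d = measure_of UNIV (sets borel) (hausdorff_outer d)"

section \<open>Star bodies\<close>

definition star_set :: "(real^'n) set \<Rightarrow> bool" where
  "star_set L \<longleftrightarrow> L \<noteq> {} \<and> (\<forall>x\<in>L. \<forall>l\<in>{0..1}. l *\<^sub>R x \<in> L)"

definition radial :: "(real^'n) set \<Rightarrow> real^'n \<Rightarrow> real" where
  "radial L s = Sup {l. 0 \<le> l \<and> l *\<^sub>R s \<in> L}"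

(* The boundedness condition says that the radial function is finite. *)
definition star_body :: "(real^'n) set \<Rightarrow> bool" where
  "star_body L \<longleftrightarrow> star_set L
     \<and> (\<forall>s\<in>unit_sphere. bdd_above {l. 0 \<le> l \<and> l *\<^sub>R s \<in> L})
     \<and> continuous_on unit_sphere (radial L)"

(* The closed representative among the star bodies with radial function f. *)
definition star_body_of :: "(real^'n \<Rightarrow> real) \<Rightarrow> (real^'n) set" where
  "star_body_of f = {l *\<^sub>R s | l s. s \<in> unit_sphere \<and> 0 \<le> l \<and> l \<le> f s}"

definition radial_dist :: "(real^'n) set \<Rightarrow> (real^'n) set \<Rightarrow> real" where
  "radial_dist K L = (SUP s\<in>unit_sphere. \<bar>radial K s - radial L s\<bar>)"

section \<open>Measures on the sphere\<close>

abbreviation sphere_borel :: "(real^'n) measure" where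
  "sphere_borel \<equiv> restrict_space borel unit_sphere"

(* Finite Borel measures on the (compact metric) sphere are automatically Radon. *)
definition sphere_measures :: "(real^'n) measure set" where
  "sphere_measures = {\<mu>. sets \<mu> = sets sphere_borel \<and> finite_measure \<mu>}"

(* A map on the set of star bodies.  Star bodies are identified with their radial functions, and
   star_body does not require closedness, so a map on star bodies has to agree on sets with equal
   radial functions (e.g. on the open and the closed unit ball). *)
definition star_body_map :: "((real^'n) set \<Rightarrow> (real^'n) measure) \<Rightarrow> bool" where
  "star_body_map Z \<longleftrightarrow> (\<forall>L. star_body L \<longrightarrow> Z L \<in> sphere_measures)
     \<and> (\<forall>K L. star_body K \<and> star_body L \<and> (\<forall>s\<in>unit_sphere. radial K s = radial L s) \<longrightarrow> Z K = Z L)"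

definition valuation :: "((real^'n) set \<Rightarrow> (real^'n) measure) \<Rightarrow> bool" where
  "valuation Z \<longleftrightarrow> (\<forall>K L. star_body K \<longrightarrow> star_body L \<longrightarrow>
     (\<forall>B\<in>sets sphere_borel.
        emeasure (Z (K \<union> L)) B + emeasure (Z (K \<inter> L)) B = emeasure (Z K) B + emeasure (Z L) B))"

definition weak_star_continuous :: "((real^'n) set \<Rightarrow> (real^'n) measure) \<Rightarrow> bool" where
  "weak_star_continuous Z \<longleftrightarrow> (\<forall>g :: real^'n \<Rightarrow> real. continuous_on unit_sphere g \<longrightarrow>
     (\<forall>K. star_body K \<longrightarrow> (\<forall>e>0. \<exists>d>0. \<forall>L. star_body L \<and> radial_dist L K < d \<longrightarrow>
        \<bar>(\<integral>s. g s \<partial>Z L) - (\<integral>s. g s \<partial>Z K)\<bar> < e)))"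

definition rotation_equivariant :: "((real^'n) set \<Rightarrow> (real^'n) measure) \<Rightarrow> bool" where
  "rotation_equivariant Z \<longleftrightarrow> (\<forall>L (g :: real^'n \<Rightarrow> real) \<phi>.
     star_body L \<longrightarrow> continuous_on unit_sphere g \<longrightarrow> orthogonal_transformation \<phi> \<longrightarrow>
     (\<integral>s. (g \<circ> inv \<phi>) s \<partial>Z (\<phi> ` L)) = (\<integral>s. g s \<partial>Z L))"

definition homogeneous :: "real \<Rightarrow> ((real^'n) set \<Rightarrow> (real^'n) measure) \<Rightarrow> bool" where
  "homogeneous q Z \<longleftrightarrow> (\<forall>L l. star_body L \<longrightarrow> 0 < l \<longrightarrow>
     Z ((\<lambda>x. l *\<^sub>R x) ` L) = scale_measure (ennreal (l powr q)) (Z L))"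

definition locally_determined :: "((real^'n) set \<Rightarrow> (real^'n) measure) \<Rightarrow> bool" where
  "locally_determined Z \<longleftrightarrow> (\<forall>B f1 f2.
     openin (top_of_set unit_sphere) B \<longrightarrow>
     continuous_on unit_sphere f1 \<longrightarrow> (\<forall>s\<in>unit_sphere. 0 \<le> f1 s) \<longrightarrow>
     continuous_on unit_sphere f2 \<longrightarrow> (\<forall>s\<in>unit_sphere. 0 \<le> f2 s) \<longrightarrow>
     (\<forall>s\<in>B. f1 s = f2 s) \<longrightarrow>
     emeasure (Z (star_body_of f1)) B = emeasure (Z (star_body_of f2)) B)"

section \<open>Dual area measures\<close>

(* t ^ q for t \<ge> 0 with 0 ^ 0 = 1 and 0 ^ q = \<infinity> for q < 0 (whereas 0 powr q = 0 for all q). *)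
definition ext_powr :: "real \<Rightarrow> real \<Rightarrow> ennreal" where
  "ext_powr t q = (if t = 0 then (if q < 0 then \<infinity> else if q = 0 then 1 else 0) else ennreal (t powr q))"

definition dual_area_measure :: "real \<Rightarrow> (real^'n) set \<Rightarrow> (real^'n) measure" where
  "dual_area_measure q L = scale_measure (ennreal (1 / real CARD('n)))
     (density (restrict_space (hausdorff_measure (CARD('n) - 1)) unit_sphere)
        (\<lambda>s. ext_powr (radial L s) q))"

end

theory Submission
  imports Defs
begin

text \<open>Suppose that \<open>Z\<close> has the five properties. Rotation equivariance makes \<open>Z\<close> of the unit ball a
  rotation invariant measure \<open>\<mu>\<close>, hence a multiple of the Hausdorff measure, which is positive and
  finite on the sphere; homogeneity and continuity at \<open>0\<close> then give \<open>Z (t B) = w t \<mu>\<close> for all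
  \<open>t \<ge> 0\<close>, with \<open>w t = t\<^sup>q\<close> (and \<open>\<mu> = 0\<close> if \<open>q < 0\<close>). Since \<open>Z\<close> is locally determined, this fixes \<open>Z\<close>
  wherever the radial function is locally constant. A given radial function \<open>f\<close> is approximated
  uniformly by continuous staircases \<open>F j\<close>, \<open>j < N\<close>, of step \<open>\<eta>\<close>, whose transition zones \<open>T j\<close> are
  disjoint for different \<open>j\<close>. Gluing the \<open>F j\<close> on their own zones (Tietze) gives one function \<open>h\<close>
  close to \<open>f\<close>, so the masses of the \<open>T j\<close> under \<open>Z (F j)\<close> add up to at most the mass of \<open>Z h\<close>,
  which weak* continuity at \<open>f\<close> bounds independently of \<open>N\<close>. Hence some \<open>F j\<close> has a transition
  zone of small mass, and letting \<open>\<eta> \<rightarrow> 0\<close> yields \<open>Z f = w (f) \<mu>\<close>.\<close>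

section \<open>Metric outer measures and Hausdorff measure\<close>

text \<open>The obstacle is mass hidden where an approximant is not locally constant: nothing known
  a priori makes \<open>Z (star_body_of h)\<close> absolutely continuous with respect to
  \<open>\<mu>\<close>, so a zone that is small for \<open>\<mu>\<close> may be heavy for
  \<open>Z\<close>, and a single staircase proves nothing. Shifting the thresholds by
  \<open>j / N\<close> of a step gives \<open>N\<close> competitors, while the mass bound
  \<open>K\<close> depends only on \<open>f\<close> and its weak* neighbourhood, hence is fixed
  before \<open>N\<close>. The glued function must stay in that neighbourhood; this is why
  differences to \<open>f\<close>, not the staircases themselves, are extended. Invariant measures
  are compared by integrating a kernel of the distance against both and applying Fubini. Finiteness
  of Hausdorff measure on the sphere comes from cells whose number and diameter balance, positivity
  from the volume of cones over covering sets. For \<open>q < 0\<close> the masses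
  \<open>t powr q\<close> times that of \<open>\<mu>\<close> must stay bounded as \<open>t\<close>
  tends to 0, so \<open>\<mu>\<close> vanishes; conversely the dual area measure of the body with
  radial function 0 is infinite, so finite values leave only \<open>c = 0\<close>.\<close>

lemma binary_subadditive:
  fixes m :: "'a set \<Rightarrow> ennreal"
  assumes empty: "m {} = 0"
    and csub: "\<And>A :: nat \<Rightarrow> 'a set. m (\<Union>i. A i) \<le> (\<Sum>i. m (A i))"
  shows "m (A \<union> B) \<le> m A + m B"
proof -
  have "(\<Union>i::nat. if i = 0 then A else if i = 1 then B else {}) = A \<union> B"
    by (auto split: if_splits)
  then have "m (A \<union> B) = m (\<Union>i::nat. if i = 0 then A else if i = 1 then B else {})"
    by simp
  also have "\<dots> \<le> (\<Sum>i::nat. m (if i = 0 then A else if i = 1 then B else {}))"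
    by (rule csub)
  also have "\<dots> = (\<Sum>i\<in>{0, 1::nat}. m (if i = 0 then A else if i = 1 then B else {}))"
    by (rule suminf_finite) (auto simp: empty)
  finally show ?thesis by simp
qed

text \<open>Caratheodory's criterion. \<open>A - F\<close> is exhausted by the sets
  \<open>D k\<close> of points of \<open>A\<close> at distance at least \<open>1 / (k + 1)\<close>
  from \<open>F\<close>, on which \<open>sep\<close> applies; closedness of \<open>F\<close> makes
  the exhaustion complete. What remains is that the rings \<open>R k\<close> beyond a late
  \<open>D N\<close> carry little mass.\<close>

lemma metric_outer_measure_closed:
  fixes m :: "'a::metric_space set \<Rightarrow> ennreal"
  assumes empty: "m {} = 0"
    and mono: "\<And>A B. A \<subseteq> B \<Longrightarrow> m A \<le> m B"
    and csub: "\<And>A :: nat \<Rightarrow> 'a set. m (\<Union>i. A i) \<le> (\<Sum>i. m (A i))"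
    and sep: "\<And>A B d. 0 < d \<Longrightarrow> (\<And>x y. x \<in> A \<Longrightarrow> y \<in> B \<Longrightarrow> d \<le> dist x y) \<Longrightarrow> m A + m B \<le> m (A \<union> B)"
    and F: "closed F"
  shows "m (A \<inter> F) + m (A - F) \<le> m A"
proof (cases "F = {} \<or> m A = top")
  case True
  then show ?thesis by (auto simp: empty)
next
  case False
  then have Fne: "F \<noteq> {}" and fin: "m A < top" by (auto simp: less_top)
  define D where "D k = {x \<in> A. 1 / real (Suc k) \<le> infdist x F}" for k :: nat
  define R where "R k = D (Suc k) - D k" for k
  have DA: "D k \<subseteq> A" for k by (auto simp: D_def)
  have Dmono: "D i \<subseteq> D j" if "i \<le> j" for i j
  proof -
    have "1 / real (Suc j) \<le> 1 / real (Suc i)" using that by (simp add: frac_le)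
    then show ?thesis by (auto simp: D_def)
  qed
  note sub2 = binary_subadditive[OF empty csub]
  have FD: "m (A \<inter> F) + m (D k) \<le> m A" for k
  proof -
    have "m (A \<inter> F) + m (D k) \<le> m (A \<inter> F \<union> D k)"
    proof (rule sep[of "1 / real (Suc k)"])
      fix x y assume "x \<in> A \<inter> F" "y \<in> D k"
      then show "1 / real (Suc k) \<le> dist x y"
        using infdist_le[of x F y] by (auto simp: D_def dist_commute)
    qed simp
    also have "\<dots> \<le> m A" using DA by (intro mono) auto
    finally show ?thesis .
  qed
  have dR: "1 / real (Suc i) - 1 / real (Suc j) \<le> dist x y" if "x \<in> D i" "y \<notin> D j" "y \<in> A" for i j x y
  proof -
    have "infdist x F \<le> infdist y F + dist x y" by (rule infdist_triangle)
    moreover have "1 / real (Suc i) \<le> infdist x F" "infdist y F < 1 / real (Suc j)"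
      using that by (auto simp: D_def)
    ultimately show ?thesis by linarith
  qed
  \<comment> \<open>Consecutive rings may touch, but two rings of the same parity have a full ring
    between them: the earlier ones lie in \<open>D (2 * n + p - 1)\<close>, the new one avoids
    \<open>D (2 * n + p)\<close>, and \<open>dR\<close> turns this into a positive gap. Summing both
    parities bounds the total ring mass by twice \<open>m A\<close>.\<close>
  have par: "(\<Sum>i<n. m (R (2 * i + p))) \<le> m (\<Union>i<n. R (2 * i + p))" for n p
  proof (induction n)
    case (Suc n)
    have "(\<Sum>i<Suc n. m (R (2 * i + p))) \<le> m (\<Union>i<n. R (2 * i + p)) + m (R (2 * n + p))"
      using Suc by (simp add: add_mono)
    also have "\<dots> \<le> m ((\<Union>i<n. R (2 * i + p)) \<union> R (2 * n + p))"
    proof (cases "n = 0")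
      case n: False
      show ?thesis
      proof (rule sep[of "1 / real (Suc (2 * n + p - 1)) - 1 / real (Suc (2 * n + p))"])
        show "0 < 1 / real (Suc (2 * n + p - 1)) - 1 / real (Suc (2 * n + p))"
          using n by (intro diff_gt_0_iff_gt[THEN iffD2] divide_strict_left_mono) auto
      next
        fix x y assume x: "x \<in> (\<Union>i<n. R (2 * i + p))" and y: "y \<in> R (2 * n + p)"
        from x obtain i where "i < n" "x \<in> D (Suc (2 * i + p))" by (auto simp: R_def)
        then have "x \<in> D (2 * n + p - 1)"
          using subsetD[OF Dmono, of "Suc (2 * i + p)" "2 * n + p - 1" x] by simp
        then show "1 / real (Suc (2 * n + p - 1)) - 1 / real (Suc (2 * n + p)) \<le> dist x y"
          using y DA by (intro dR) (auto simp: R_def)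
      qed
    qed (simp add: empty)
    also have "(\<Union>i<n. R (2 * i + p)) \<union> R (2 * n + p) = (\<Union>i<Suc n. R (2 * i + p))"
      by (auto simp: lessThan_Suc)
    finally show ?case .
  qed simp
  have RA: "(\<Union>i\<in>I. R (f i)) \<subseteq> A" for I and f :: "nat \<Rightarrow> nat" using DA by (auto simp: R_def)
  have bnd: "(\<Sum>i<n. m (R i)) \<le> m A + m A" for n
  proof -
    have "(\<Sum>i<n. m (R i)) \<le> (\<Sum>i<2*n. m (R i))"
      by (rule sum_mono2) auto
    also have "\<dots> = (\<Sum>i<n. m (R (2 * i + 0))) + (\<Sum>i<n. m (R (2 * i + 1)))"
      by (induction n) (auto simp: algebra_simps)
    also have "\<dots> \<le> m A + m A"
      by (intro add_mono order_trans[OF par] mono RA)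
    finally show ?thesis .
  qed
  have "(\<Sum>i. m (R i)) \<le> m A + m A"
    by (intro suminf_le_const summableI bnd)
  then have sfin: "(\<Sum>i. m (R i)) \<noteq> top" using fin by (auto simp: top_unique)
  have "m (R i) \<le> m A" for i
    using DA by (intro mono) (auto simp: R_def)
  then have Rfin: "m (R i) \<noteq> top" for i
    using fin by (metis leD)
  define r where "r i = enn2real (m (R i))" for i
  have r: "m (R i) = ennreal (r i)" "0 \<le> r i" for i
    using Rfin[of i] by (auto simp: r_def less_top)
  have sr: "summable r"
    using sfin r by (intro summable_suminf_not_top) auto
  show ?thesis
  proof (rule ennreal_le_epsilon)
    fix e :: real assume e: "0 < e"
    obtain N where N: "\<bar>\<Sum>i. r (i + N)\<bar> < e"
      using suminf_exist_split[OF e sr] by auto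
    have sub: "A - F \<subseteq> D N \<union> (\<Union>i. R (i + N))"
    proof
      fix x assume x: "x \<in> A - F"
      then have "0 < infdist x F"
        using F Fne by (metis DiffD2 in_closed_iff_infdist_zero infdist_nonneg less_eq_real_def)
      then obtain k where "inverse (real (Suc k)) < infdist x F" using reals_Archimedean by blast
      then have k: "x \<in> D k" using x by (auto simp: D_def field_simps)
      \<comment> \<open>The first index that catches \<open>x\<close> places it in the ring
        \<open>R (l - 1)\<close>, unless it already lies in \<open>D N\<close>.\<close>
      define l where "l = (LEAST k. x \<in> D k)"
      have l: "x \<in> D l" using k unfolding l_def by (rule LeastI)
      show "x \<in> D N \<union> (\<Union>i. R (i + N))"
      proof (cases "l \<le> N")
        case True then show ?thesis using l Dmono by auto
      next
        case False
        then have "x \<notin> D (l - 1)" unfolding l_def using not_less_Least[of "l - 1" "\<lambda>k. x \<in> D k"]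
          by (auto simp: l_def)
        then have "x \<in> R (l - 1 - N + N)" using l False by (auto simp: R_def)
        then show ?thesis by blast
      qed
    qed
    have "m (A - F) \<le> m (D N) + m (\<Union>i. R (i + N))"
      using mono[OF sub] sub2 order_trans by blast
    also have "\<dots> \<le> m (D N) + (\<Sum>i. m (R (i + N)))"
      by (intro add_left_mono csub)
    also have "(\<Sum>i. m (R (i + N))) = ennreal (\<Sum>i. r (i + N))"
      unfolding r using sr r by (intro suminf_ennreal2) (auto simp: summable_iff_shift)
    also have "\<dots> \<le> ennreal e" using N by (intro ennreal_leI) auto
    finally have "m (A \<inter> F) + m (A - F) \<le> m (A \<inter> F) + (m (D N) + ennreal e)"
      by (auto intro: add_left_mono)
    also have "\<dots> \<le> m A + ennreal e" using FD[of N] by (metis add.assoc add_right_mono)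
    finally show "m (A \<inter> F) + m (A - F) \<le> m A + ennreal e" .
  qed
qed

text \<open>By the criterion above, closed sets are Caratheodory measurable; they generate the Borel
  sets, and an outer measure is countably additive on its measurable sets.\<close>

lemma metric_outer_measure_space_borel:
  fixes m :: "'a::metric_space set \<Rightarrow> ennreal"
  assumes empty: "m {} = 0"
    and mono: "\<And>A B. A \<subseteq> B \<Longrightarrow> m A \<le> m B"
    and csub: "\<And>A :: nat \<Rightarrow> 'a set. m (\<Union>i. A i) \<le> (\<Sum>i. m (A i))"
    and sep: "\<And>A B d. 0 < d \<Longrightarrow> (\<And>x y. x \<in> A \<Longrightarrow> y \<in> B \<Longrightarrow> d \<le> dist x y) \<Longrightarrow> m A + m B \<le> m (A \<union> B)"
  shows "measure_space UNIV (sets borel) m"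
proof -
  have oms: "outer_measure_space (Pow UNIV) m"
    by (auto simp: outer_measure_space_def positive_def increasing_def countably_subadditive_def
        empty intro: mono csub)
  have ms: "measure_space UNIV (lambda_system UNIV (Pow UNIV) m) m"
    by (rule sigma_algebra.caratheodory_lemma[OF sigma_algebra_Pow oms])
  then have sa: "sigma_algebra UNIV (lambda_system UNIV (Pow UNIV) m)"
    by (simp add: measure_space_def)
  note sub2 = binary_subadditive[OF empty csub]
  have "F \<in> lambda_system UNIV (Pow UNIV) m" if "closed F" for F
    unfolding algebra.lambda_system_eq[OF algebra_Pow]
  proof (safe intro!: antisym)
    fix A
    show "m (A \<inter> F) + m (A - F) \<le> m A"
      by (rule metric_outer_measure_closed[OF empty mono csub sep that])
    show "m A \<le> m (A \<inter> F) + m (A - F)"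
      using sub2[of "A \<inter> F" "A - F"] by (simp add: Int_Diff_Un)
  qed auto
  then have "sigma_sets UNIV {F::'a set. closed F} \<subseteq> lambda_system UNIV (Pow UNIV) m"
    by (intro sigma_algebra.sigma_sets_subset[OF sa]) auto
  then have sub: "sets borel \<subseteq> lambda_system UNIV (Pow UNIV) m"
    by (subst borel_eq_closed) (simp add: sets_measure_of)
  have "sigma_algebra UNIV (sets (borel :: 'a measure))"
    using sets.sigma_algebra_axioms[of "borel :: 'a measure"] by simp
  from measure_down[OF ms this sub] show ?thesis .
qed

section \<open>Hausdorff outer measure as a metric outer measure\<close>

lemma hausdorff_content_empty [simp]: "hausdorff_content d e {} = 0" if "0 \<le> e"
proof -
  have "hausdorff_content d e {} \<le> 0"
    unfolding hausdorff_content_def using that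
    by (intro INF_lower2[of "\<lambda>_. {}"]) auto
  then show ?thesis by simp
qed

lemma hausdorff_content_mono: "A \<subseteq> B \<Longrightarrow> hausdorff_content d e A \<le> hausdorff_content d e B"
  unfolding hausdorff_content_def by (rule INF_superset_mono) (simp_all add: Collect_mono subset_trans)

lemma hausdorff_content_antimono: "e \<le> e' \<Longrightarrow> hausdorff_content d e' A \<le> hausdorff_content d e A"
  unfolding hausdorff_content_def
  by (rule INF_superset_mono) (simp_all add: Collect_mono_iff, meson order_trans)

text \<open>The usual merging of near-optimal covers, with errors \<open>b * (1/2) ^ Suc n\<close>
  that sum to \<open>b\<close>; \<open>prod_decode\<close> lines up the double family as one
  sequence.\<close>

lemma hausdorff_content_UN_le:
  fixes A :: "nat \<Rightarrow> 'a::metric_space set"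
  shows "hausdorff_content d e (\<Union>i. A i) \<le> (\<Sum>i. hausdorff_content d e (A i))"
proof (rule ennreal_le_epsilon)
  let ?t = "\<lambda>V :: 'a set. if V = {} then 0 else ennreal (unit_ball_vol (real d) * (diameter V / 2) ^ d)"
  fix b :: real assume b: "0 < b" and fin: "(\<Sum>n. hausdorff_content d e (A n)) < top"
  then have *: "hausdorff_content d e (A n) < hausdorff_content d e (A n) + b * (1/2)^Suc n" for n
    by (auto simp add: less_top dest!: ennreal_suminf_lessD)
  have "\<forall>n. \<exists>U. A n \<subseteq> (\<Union>i::nat. U i) \<and> (\<forall>i. bounded (U i) \<and> diameter (U i) \<le> e)
      \<and> (\<Sum>i. ?t (U i)) < hausdorff_content d e (A n) + b * (1/2)^Suc n"
    using * unfolding hausdorff_content_def[of d e "A _"] INF_less_iff by auto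
  from choice[OF this] obtain U where
    U: "\<forall>n. A n \<subseteq> (\<Union>i::nat. U n i) \<and> (\<forall>i. bounded (U n i) \<and> diameter (U n i) \<le> e)
      \<and> (\<Sum>i. ?t (U n i)) < hausdorff_content d e (A n) + b * (1/2)^Suc n" ..
  define C where "C = case_prod U o prod_decode"
  have AC: "(\<Union>i. A i) \<subseteq> (\<Union>i. C i)"
  proof
    fix x assume "x \<in> (\<Union>i. A i)"
    then obtain n where "x \<in> A n" by blast
    then obtain i where "x \<in> U n i" using U by blast
    then have "x \<in> C (prod_encode (n, i))" by (simp add: C_def)
    then show "x \<in> (\<Union>i. C i)" by blast
  qed
  have "hausdorff_content d e (\<Union>i. A i) \<le> (\<Sum>i. ?t (C i))"
    unfolding hausdorff_content_def using AC U
    by (intro INF_lower) (simp add: C_def split_beta)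
  also have "\<dots> = (\<Sum>n. \<Sum>i. ?t (U n i))"
    unfolding C_def comp_def
    by (subst suminf_ennreal_2dimen[where f="\<lambda>p. ?t (case_prod U p)", symmetric]) auto
  also have "\<dots> \<le> (\<Sum>n. hausdorff_content d e (A n) + b * (1/2) ^ Suc n)"
    by (intro suminf_le allI less_imp_le) (use U in auto)
  also have "... = (\<Sum>n. hausdorff_content d e (A n)) + (\<Sum>n. ennreal b * ennreal ((1/2) ^ Suc n))"
    using b by (subst suminf_add[symmetric])
      (auto simp del: ennreal_suminf_cmult simp add: ennreal_mult[symmetric])
  also have "\<dots> = (\<Sum>n. hausdorff_content d e (A n)) + b"
    unfolding ennreal_suminf_cmult
    by (subst suminf_ennreal_eq[OF zero_le_power power_half_series]) auto
  finally show "hausdorff_content d e (\<Union>i. A i) \<le> (\<Sum>n. hausdorff_content d e (A n)) + b" .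
qed

text \<open>A covering set of diameter at most \<open>e < \<delta>\<close> cannot meet both
  \<open>A\<close> and \<open>B\<close>, so every cover of the union splits into covers of the two
  parts without counting a set twice.\<close>

lemma hausdorff_content_separated:
  fixes A B :: "'a::metric_space set"
  assumes "e < \<delta>" "0 \<le> e" and sep: "\<And>x y. x \<in> A \<Longrightarrow> y \<in> B \<Longrightarrow> \<delta> \<le> dist x y"
  shows "hausdorff_content d e A + hausdorff_content d e B \<le> hausdorff_content d e (A \<union> B)"
proof -
  let ?t = "\<lambda>V :: 'a set. if V = {} then 0 else ennreal (unit_ball_vol (real d) * (diameter V / 2) ^ d)"
  show ?thesis
    unfolding hausdorff_content_def[of d e "A \<union> B"]
  proof (safe intro!: INF_greatest)
    fix U :: "nat \<Rightarrow> 'a set"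
    assume U: "A \<union> B \<subseteq> (\<Union>i. U i)" "\<forall>i. bounded (U i) \<and> diameter (U i) \<le> e"
    define V where "V C i = (if U i \<inter> C = {} then {} else U i)" for C i
    have cov: "hausdorff_content d e C \<le> (\<Sum>i. ?t (V C i))" if "C \<subseteq> A \<union> B" for C
      unfolding hausdorff_content_def
      using that U assms(2) by (intro INF_lower) (fastforce simp: V_def)
    have "V A i = {} \<or> V B i = {}" for i
    proof (rule ccontr)
      assume "\<not> ?thesis"
      then obtain x y where "x \<in> U i" "x \<in> A" "y \<in> U i" "y \<in> B" by (auto simp: V_def split: if_splits)
      then show False using sep[of x y] diameter_bounded_bound[of "U i" x y] U(2) assms(1)
        by (meson le_less_trans not_less order_trans)
    qed
    then have "?t (V A i) + ?t (V B i) \<le> ?t (U i)" for i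
      by (smt (verit) V_def add.right_neutral add_0 order_refl zero_le)
    then have "(\<Sum>i. ?t (V A i) + ?t (V B i)) \<le> (\<Sum>i. ?t (U i))"
      by (intro suminf_le) auto
    moreover have "(\<Sum>i. ?t (V A i) + ?t (V B i)) = (\<Sum>i. ?t (V A i)) + (\<Sum>i. ?t (V B i))"
      by (rule suminf_add[symmetric]) auto
    ultimately show "hausdorff_content d e A + hausdorff_content d e B \<le> (\<Sum>i. ?t (U i))"
      using add_mono[OF cov[of A] cov[of B]] by auto
  qed
qed

lemma hausdorff_content_le_outer: "0 < e \<Longrightarrow> hausdorff_content d e A \<le> hausdorff_outer d A"
  unfolding hausdorff_outer_def by (rule SUP_upper) auto

lemma hausdorff_outer_separated:
  fixes A B :: "'a::metric_space set"
  assumes "0 < \<delta>" and sep: "\<And>x y. x \<in> A \<Longrightarrow> y \<in> B \<Longrightarrow> \<delta> \<le> dist x y"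
  shows "hausdorff_outer d A + hausdorff_outer d B \<le> hausdorff_outer d (A \<union> B)"
proof -
  \<comment> \<open>Contents grow as the mesh shrinks, so the supremum may be taken over meshes at
    most \<open>\<delta> / 2\<close>, where the contents are superadditive on \<open>A\<close> and
    \<open>B\<close>. The same monotonicity supplies the directedness that lets the supremum pass
    through the sum.\<close>
  have *: "hausdorff_outer d C = (SUP e \<in> {0<..}. hausdorff_content d (min e (\<delta>/2)) C)" for C :: "'a set"
    unfolding hausdorff_outer_def
  proof (intro antisym SUP_mono)
    fix e :: real assume "e \<in> {0<..}"
    then show "\<exists>m\<in>{0<..}. hausdorff_content d e C \<le> hausdorff_content d (min m (\<delta> / 2)) C"
      by (intro bexI[of _ e] hausdorff_content_antimono) auto
  next
    fix e :: real assume "e \<in> {0<..}"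
    then show "\<exists>m\<in>{0<..}. hausdorff_content d (min e (\<delta> / 2)) C \<le> hausdorff_content d m C"
      using assms by (intro bexI[of _ "min e (\<delta>/2)"]) auto
  qed
  have "hausdorff_outer d A + hausdorff_outer d B
      = (SUP e \<in> {0<..}. hausdorff_content d (min e (\<delta>/2)) A + hausdorff_content d (min e (\<delta>/2)) B)"
    unfolding *
  proof (rule SUP_add_directed_ennreal[symmetric])
    fix i j :: real assume "i \<in> {0<..}" "j \<in> {0<..}"
    then show "\<exists>k\<in>{0<..}. hausdorff_content d (min i (\<delta> / 2)) A + hausdorff_content d (min j (\<delta> / 2)) B
        \<le> hausdorff_content d (min k (\<delta> / 2)) A + hausdorff_content d (min k (\<delta> / 2)) B"
      by (intro bexI[of _ "min i j"] add_mono hausdorff_content_antimono) auto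
  qed
  also have "\<dots> \<le> hausdorff_outer d (A \<union> B)"
  proof (rule SUP_least)
    fix e :: real assume "e \<in> {0<..}"
    then show "hausdorff_content d (min e (\<delta> / 2)) A + hausdorff_content d (min e (\<delta> / 2)) B
        \<le> hausdorff_outer d (A \<union> B)"
      using assms
      by (intro order_trans[OF hausdorff_content_separated[where \<delta>=\<delta>] hausdorff_content_le_outer])
        (auto simp: min_less_iff_disj)
  qed
  finally show ?thesis .
qed

lemma measure_space_hausdorff_outer:
  "measure_space UNIV (sets (borel :: 'a::metric_space measure)) (hausdorff_outer d)"
proof (rule metric_outer_measure_space_borel)
  show "hausdorff_outer d ({} :: 'a set) = 0"
    by (simp add: hausdorff_outer_def cong: SUP_cong_simp)
  show "hausdorff_outer d A \<le> hausdorff_outer d B" if "A \<subseteq> B" for A B :: "'a set"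
    unfolding hausdorff_outer_def by (intro SUP_mono') (rule hausdorff_content_mono[OF that])
  show "hausdorff_outer d (\<Union>i. A i) \<le> (\<Sum>i. hausdorff_outer d (A i))" for A :: "nat \<Rightarrow> 'a set"
    unfolding hausdorff_outer_def[of d "\<Union>i. A i"]
    by (intro SUP_least order_trans[OF hausdorff_content_UN_le] suminf_le
        hausdorff_content_le_outer) auto
  show "hausdorff_outer d A + hausdorff_outer d B \<le> hausdorff_outer d (A \<union> B)"
    if "0 < \<delta>" "\<And>x y. x \<in> A \<Longrightarrow> y \<in> B \<Longrightarrow> \<delta> \<le> dist x y" for A B :: "'a set" and \<delta>
    using that by (rule hausdorff_outer_separated)
qed

lemma sets_hausdorff_measure [simp, measurable_cong]: "sets (hausdorff_measure d :: 'a::metric_space measure) = sets borel"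
  unfolding hausdorff_measure_def
  using sets.sigma_sets_eq[of "borel :: 'a measure"] by (simp add: sets_measure_of)

lemma space_hausdorff_measure [simp]: "space (hausdorff_measure d) = UNIV"
  by (simp add: hausdorff_measure_def space_measure_of_conv)

lemma emeasure_hausdorff_measure:
  "A \<in> sets borel \<Longrightarrow> emeasure (hausdorff_measure d) A = hausdorff_outer d A"
  unfolding hausdorff_measure_def
  using measure_space_hausdorff_outer[where 'a='a and d=d]
  by (intro emeasure_measure_of_sigma) (auto simp: measure_space_def)

section \<open>Behaviour of Hausdorff measure under isometries\<close>

lemma diameter_isometry:
  assumes "\<And>x y. dist (f x) (f y) = dist x y"
  shows "diameter (f ` A) = diameter A"
proof -
  have "(\<lambda>(x, y). dist x y) ` (f ` A \<times> f ` A) = (\<lambda>(x, y). dist x y) ` (A \<times> A)"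
    by (auto simp: assms image_iff intro!: bexI)
  then show ?thesis by (auto simp: diameter_def)
qed

lemma hausdorff_content_isometry_le:
  fixes f :: "'a::metric_space \<Rightarrow> 'b::metric_space"
  assumes f: "\<And>x y. dist (f x) (f y) = dist x y"
  shows "hausdorff_content d e (f ` A) \<le> hausdorff_content d e A"
  unfolding hausdorff_content_def[of d e A]
proof (safe intro!: INF_greatest)
  fix U :: "nat \<Rightarrow> 'a set"
  assume U: "A \<subseteq> (\<Union>i. U i)" "\<forall>i. bounded (U i) \<and> diameter (U i) \<le> e"
  have "bounded (f ` U i)" for i
    using U(2) unfolding bounded_def by (metis (no_types, lifting) f imageE)
  moreover have "f ` A \<subseteq> (\<Union>i. f ` U i)" using U(1) by (fastforce simp: image_UN[symmetric])
  ultimately show "hausdorff_content d e (f ` A) \<le> (\<Sum>i. if U i = {} then 0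
      else ennreal (unit_ball_vol (real d) * (diameter (U i) / 2) ^ d))"
    unfolding hausdorff_content_def using U
    by (intro INF_lower2[of "\<lambda>i. f ` U i"]) (auto simp: diameter_isometry[OF f] cong: if_cong)
qed

text \<open>Images of a cover form a cover with the same diameters. One inequality suffices: for a
  rotation the reverse one follows by applying it to the inverse.\<close>

lemma hausdorff_outer_isometry_le:
  fixes f :: "'a::metric_space \<Rightarrow> 'b::metric_space"
  assumes "\<And>x y. dist (f x) (f y) = dist x y"
  shows "hausdorff_outer d (f ` A) \<le> hausdorff_outer d A"
  unfolding hausdorff_outer_def by (intro SUP_mono') (rule hausdorff_content_isometry_le[OF assms])

section \<open>Hausdorff measure of the unit sphere\<close>

lemma hausdorff_content_le_sum:
  assumes "finite I" "A \<subseteq> (\<Union>i\<in>I. P i)" "\<And>i. i \<in> I \<Longrightarrow> bounded (P i)" "\<And>i. i \<in> I \<Longrightarrow> diameter (P i) \<le> e" "0 \<le> e"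
  shows "hausdorff_content d e A \<le> of_nat (card I) * ennreal (unit_ball_vol (real d) * (e / 2) ^ d)"
proof -
  obtain h where h: "bij_betw h {0..<card I} I"
    using ex_bij_betw_nat_finite[OF assms(1)] by blast
  \<comment> \<open>Padding by empty sets costs nothing even for \<open>d = 0\<close>, where any
    other set of diameter 0 would contribute \<open>0 ^ 0 = 1\<close>.\<close>
  define U where "U i = (if i < card I then P (h i) else {})" for i
  have hI: "h i \<in> I" if "i < card I" for i using h that by (auto simp: bij_betw_def)
  have cov: "A \<subseteq> (\<Union>i. U i)"
  proof
    fix x assume "x \<in> A"
    then obtain j where "j \<in> I" "x \<in> P j" using assms by blast
    moreover then obtain i where "i < card I" "h i = j" using h by (force simp: bij_betw_def image_iff)
    ultimately show "x \<in> (\<Union>i. U i)" by (auto simp: U_def intro!: exI[of _ i])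
  qed
  let ?t = "\<lambda>V. if V = {} then 0 else ennreal (unit_ball_vol (real d) * (diameter V / 2) ^ d)"
  have "hausdorff_content d e A \<le> (\<Sum>i. ?t (U i))"
    unfolding hausdorff_content_def
    by (rule INF_lower) (use cov assms hI in \<open>auto simp: U_def\<close>)
  also have "\<dots> = (\<Sum>i<card I. ?t (U i))"
    by (rule suminf_finite) (auto simp: U_def)
  also have "\<dots> \<le> (\<Sum>i<card I. ennreal (unit_ball_vol (real d) * (e / 2) ^ d))"
  proof (rule sum_mono)
    fix i assume "i \<in> {..<card I}"
    then have "bounded (U i)" "diameter (U i) \<le> e" using assms hI by (auto simp: U_def)
    then show "?t (U i) \<le> ennreal (unit_ball_vol (real d) * (e / 2) ^ d)"
      by (auto intro!: ennreal_leI mult_left_mono power_mono divide_right_mono diameter_ge_0)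
  qed
  finally show ?thesis by simp
qed

text \<open>Where the \<open>j\<close>-th coordinate is largest in absolute value and of fixed sign,
  the sphere is a Lipschitz graph over the other \<open>n - 1\<close> coordinates. Cutting those
  into intervals of length \<open>1 / k\<close> gives of the order of \<open>k ^ (n - 1)\<close>
  cells of diameter of the order of \<open>1 / k\<close>, so the covering sums stay bounded as
  \<open>k\<close> grows.\<close>

lemma hausdorff_outer_sphere_finite:
  "hausdorff_outer (CARD('n) - 1) (sphere 0 1 :: (real^'n) set) < top"
proof -
  define n where "n = CARD('n)"
  have n1: "1 \<le> n" by (simp add: n_def Suc_leI)
  \<comment> \<open>There will be \<open>2 * n * (2 * k + 1) ^ (n - 1)\<close> cells of diameter at
    most \<open>n\<^sup>2 / k\<close>; the factor 3 comes from \<open>2 * k + 1 \<le> 3 * k\<close>,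
    which removes \<open>k\<close> from the product.\<close>
  define M where "M = real (2 * n) * (unit_ball_vol (real (n - 1)) * (3 * (real n)\<^sup>2 / 2) ^ (n - 1))"
  have "hausdorff_content (n - 1) e (sphere 0 1 :: (real^'n) set) \<le> ennreal M" if e: "0 < e" for e
  proof -
    obtain k0 :: nat where k0: "(real n)\<^sup>2 / e < real k0" using reals_Archimedean2 by blast
    define k where "k = Suc k0"
    have k: "0 < k" "(real n)\<^sup>2 / real k \<le> e"
      using k0 e by (auto simp: k_def field_simps)
    \<comment> \<open>A cell is indexed by the dominant coordinate \<open>j\<close>, its sign, and
      the integer parts of \<open>k * s$i\<close> for the remaining coordinates.\<close>
    define I where "I = (SIGMA j:(UNIV::'n set). (UNIV::bool set) \<times> ((UNIV - {j}) \<rightarrow>\<^sub>E {- int k..int k}))"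
    define P where "P = (\<lambda>(j::'n, b::bool, g). {s::real^'n. norm s = 1 \<and> (\<forall>i. \<bar>s$i\<bar> \<le> \<bar>s$j\<bar>)
        \<and> (0 < s$j \<longleftrightarrow> b) \<and> (\<forall>i. i \<noteq> j \<longrightarrow> \<lfloor>real k * s$i\<rfloor> = g i)})"
    have fI: "finite I" by (auto simp: I_def intro!: finite_SigmaI finite_PiE)
    have cI: "card I = 2 * n * (2 * k + 1) ^ (n - 1)"
      by (simp add: I_def card_SigmaI finite_PiE card_cartesian_product card_PiE n_def nat_add_distrib
          nat_mult_distrib algebra_simps)
    have cov: "sphere 0 1 \<subseteq> (\<Union>p\<in>I. P p)"
    proof
      fix s :: "real^'n" assume s: "s \<in> sphere 0 1"
      obtain j where j: "\<And>i. \<bar>s$i\<bar> \<le> \<bar>s$j\<bar>"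
      proof -
        have "Max (range (\<lambda>i. \<bar>s$i\<bar>)) \<in> range (\<lambda>i. \<bar>s$i\<bar>)" by (rule Max_in) auto
        then obtain j where "Max (range (\<lambda>i. \<bar>s$i\<bar>)) = \<bar>s$j\<bar>" by blast
        then have "\<bar>s$i\<bar> \<le> \<bar>s$j\<bar>" for i by (metis Max_ge finite finite_imageI rangeI)
        then show thesis by (rule that)
      qed
      define g where "g = restrict (\<lambda>i. \<lfloor>real k * s$i\<rfloor>) (UNIV - {j})"
      have "\<lfloor>real k * s$i\<rfloor> \<in> {- int k..int k}" for i
      proof -
        have "\<bar>s$i\<bar> \<le> 1" using s component_le_norm_cart[of s i] by simp
        then have "- real k \<le> real k * s$i" "real k * s$i \<le> real k"
          using mult_left_mono[of "-1" "s$i" "real k"] mult_left_mono[of "s$i" 1 "real k"] by auto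
        then show ?thesis by (auto simp: le_floor_iff floor_le_iff)
      qed
      then have "(j, 0 < s$j, g) \<in> I" by (auto simp: I_def g_def)
      moreover have "s \<in> P (j, 0 < s$j, g)" using s j by (auto simp: P_def g_def)
      ultimately show "s \<in> (\<Union>p\<in>I. P p)" by blast
    qed
    have near: "norm (s - t) \<le> (real n)\<^sup>2 / real k" if "s \<in> P p" "t \<in> P p" for s t p
    proof -
      obtain j b g where p: "p = (j, b, g)" by (cases p)
      have ns: "norm s = 1" "norm t = 1"
        and mx: "\<And>i. \<bar>s$i\<bar> \<le> \<bar>s$j\<bar>" "\<And>i. \<bar>t$i\<bar> \<le> \<bar>t$j\<bar>"
        and sg: "0 < s$j \<longleftrightarrow> 0 < t$j"
        and fl: "\<And>i. i \<noteq> j \<Longrightarrow> \<lfloor>real k * s$i\<rfloor> = \<lfloor>real k * t$i\<rfloor>"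
        using that by (auto simp: P_def p)
      have d: "\<bar>s$i - t$i\<bar> \<le> 1 / real k" if "i \<noteq> j" for i
      proof -
        have "\<bar>real k * s$i - real k * t$i\<bar> \<le> 1" using fl[OF that] by linarith
        then have "real k * \<bar>s$i - t$i\<bar> \<le> 1"
          by (simp add: abs_mult[symmetric] right_diff_distrib[symmetric] flip: abs_mult)
        then show ?thesis using k by (simp add: field_simps)
      qed
      have lo: "1 / real n \<le> \<bar>x$j\<bar>" if "norm x = 1" "\<And>i. \<bar>x$i\<bar> \<le> \<bar>x$j\<bar>" for x :: "real^'n"
      proof -
        have "1 \<le> (\<Sum>i\<in>UNIV. \<bar>x$i\<bar>)" using norm_le_l1_cart[of x] that by simp
        also have "\<dots> \<le> (\<Sum>i\<in>(UNIV::'n set). \<bar>x$j\<bar>)" by (intro sum_mono that)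
        finally show ?thesis using n1 by (simp add: n_def field_simps)
      qed
      have sj: "1 / real n \<le> \<bar>s$j\<bar>" "1 / real n \<le> \<bar>t$j\<bar>" using lo ns mx by auto
      \<comment> \<open>Equal signs prevent cancellation. With this lower bound,
        \<open>(s$j)\<^sup>2 - (t$j)\<^sup>2\<close>, which the unit norm expresses through the
        other coordinates, controls the difference of the dominant coordinates.\<close>
      then have sum2: "2 / real n \<le> \<bar>s$j + t$j\<bar>" using sg n1
        by (cases "0 < s$j") (auto simp: abs_if split: if_splits)
      have sq: "(\<Sum>i\<in>UNIV. (x$i)\<^sup>2) = 1" if "norm x = 1" for x :: "real^'n"
        using that by (simp add: norm_vec_def L2_set_def)
      have "(s$j)\<^sup>2 - (t$j)\<^sup>2 = (\<Sum>i\<in>UNIV - {j}. (t$i)\<^sup>2 - (s$i)\<^sup>2)"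
        using sq[OF ns(1)] sq[OF ns(2)]
        by (simp add: sum_subtractf sum.remove[of UNIV j])
      also have "\<bar>\<dots>\<bar> \<le> (\<Sum>i\<in>UNIV - {j}. 2 / real k)"
      proof (intro order_trans[OF sum_abs] sum_mono)
        fix i assume i: "i \<in> UNIV - {j}"
        have "\<bar>s$i\<bar> \<le> 1" "\<bar>t$i\<bar> \<le> 1"
          using ns component_le_norm_cart[of s i] component_le_norm_cart[of t i] by auto
        then have "\<bar>t$i + s$i\<bar> \<le> 2" by linarith
        moreover have "\<bar>t$i - s$i\<bar> \<le> 1 / real k" using d[of i] i by (simp add: abs_minus_commute)
        ultimately have "\<bar>t$i - s$i\<bar> * \<bar>t$i + s$i\<bar> \<le> 1 / real k * 2" by (intro mult_mono) auto
        then show "\<bar>(t$i)\<^sup>2 - (s$i)\<^sup>2\<bar> \<le> 2 / real k"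
          by (simp add: abs_mult[symmetric] power2_eq_square square_diff_square_factored mult.commute)
      qed
      also have "\<dots> = real (n - 1) * 2 / real k" by (simp add: n_def)
      finally have "\<bar>s$j - t$j\<bar> * \<bar>s$j + t$j\<bar> \<le> real (n - 1) * 2 / real k"
        by (simp add: abs_mult[symmetric] power2_eq_square square_diff_square_factored mult.commute)
      moreover have "\<bar>s$j - t$j\<bar> * (2 / real n) \<le> \<bar>s$j - t$j\<bar> * \<bar>s$j + t$j\<bar>"
        by (intro mult_left_mono sum2) auto
      ultimately have dj: "\<bar>s$j - t$j\<bar> \<le> real n * real (n - 1) / real k"
      proof -
        assume "\<bar>s$j - t$j\<bar> * \<bar>s$j + t$j\<bar> \<le> real (n - 1) * 2 / real k"
          and "\<bar>s$j - t$j\<bar> * (2 / real n) \<le> \<bar>s$j - t$j\<bar> * \<bar>s$j + t$j\<bar>"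
        then have "\<bar>s$j - t$j\<bar> * (2 / real n) * (real n / 2) \<le> real (n - 1) * 2 / real k * (real n / 2)"
          by (intro mult_right_mono) auto
        also have "real (n - 1) * 2 / real k * (real n / 2) = real n * real (n - 1) / real k"
          by (simp add: mult.commute)
        also have "\<bar>s$j - t$j\<bar> * (2 / real n) * (real n / 2) = \<bar>s$j - t$j\<bar>" using n1 by simp
        finally show ?thesis .
      qed
      have "norm (s - t) \<le> (\<Sum>i\<in>UNIV. \<bar>(s - t)$i\<bar>)" by (rule norm_le_l1_cart)
      also have "\<dots> = \<bar>s$j - t$j\<bar> + (\<Sum>i\<in>UNIV - {j}. \<bar>s$i - t$i\<bar>)"
        by (simp add: sum.remove[of UNIV j])
      also have "\<dots> \<le> real n * real (n - 1) / real k + (\<Sum>i\<in>UNIV - {j}. 1 / real k)"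
        using d by (intro add_mono dj sum_mono) auto
      also have "\<dots> = (real n + 1) * real (n - 1) / real k"
        by (simp add: n_def add_divide_distrib[symmetric] algebra_simps)
      also have "\<dots> \<le> (real n)\<^sup>2 / real k"
        using n1 by (intro divide_right_mono) (auto simp: of_nat_diff power2_eq_square algebra_simps)
      finally show ?thesis .
    qed
    have "hausdorff_content (n - 1) e (sphere 0 1 :: (real^'n) set)
        \<le> hausdorff_content (n - 1) ((real n)\<^sup>2 / real k) (sphere 0 1 :: (real^'n) set)"
      by (rule hausdorff_content_antimono[OF k(2)])
    also have "\<dots> \<le> of_nat (card I) * ennreal (unit_ball_vol (real (n - 1)) * ((real n)\<^sup>2 / real k / 2) ^ (n - 1))"
    proof (rule hausdorff_content_le_sum[OF fI cov])
      show "bounded (P p)" for p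
        by (rule boundedI[of _ 1]) (auto simp: P_def)
      show "diameter (P p) \<le> (real n)\<^sup>2 / real k" for p
        by (rule diameter_le) (auto intro: near)
    qed auto
    also have "\<dots> = ennreal (real (card I) * (unit_ball_vol (real (n - 1)) * ((real n)\<^sup>2 / real k / 2) ^ (n - 1)))"
      by (subst ennreal_mult) (auto simp: ennreal_of_nat_eq_real_of_nat)
    also have "\<dots> \<le> ennreal M"
    proof (rule ennreal_leI)
      have "real (2 * k + 1) * ((real n)\<^sup>2 / real k / 2) \<le> real (3 * k) * ((real n)\<^sup>2 / real k / 2)"
        using k by (intro mult_right_mono) auto
      also have "\<dots> = 3 * (real n)\<^sup>2 / 2" using k by (simp add: field_simps)
      finally have "(real (2 * k + 1) * ((real n)\<^sup>2 / real k / 2)) ^ (n - 1) \<le> (3 * (real n)\<^sup>2 / 2) ^ (n - 1)"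
        by (intro power_mono) auto
      then have "real (2 * n) * (unit_ball_vol (real (n - 1)) * (real (2 * k + 1) * ((real n)\<^sup>2 / real k / 2)) ^ (n - 1)) \<le> M"
        unfolding M_def by (intro mult_left_mono) auto
      then show "real (card I) * (unit_ball_vol (real (n - 1)) * ((real n)\<^sup>2 / real k / 2) ^ (n - 1)) \<le> M"
        unfolding cI of_nat_mult of_nat_power power_mult_distrib by (simp add: ac_simps)
    qed
    finally show ?thesis .
  qed
  then have "hausdorff_outer (n - 1) (sphere 0 1 :: (real^'n) set) \<le> ennreal M"
    unfolding hausdorff_outer_def by (intro SUP_least) auto
  then show ?thesis unfolding n_def by (metis ennreal_less_top le_less_trans)
qed

text \<open>A cone over a set of diameter at most \<open>r\<close> stays within \<open>2 * r\<close>
  of a radial segment, hence is covered by about \<open>1 / r\<close> balls of radius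
  \<open>2 * r\<close>; their total volume is of order \<open>r ^ (n - 1)\<close>, the order of the
  Hausdorff summand. The closure is taken to have a measurable set.\<close>

lemma emeasure_cone_le:
  fixes V :: "(real^'n) set"
  assumes V: "V \<subseteq> sphere 0 1" "V \<noteq> {}" and d: "diameter V \<le> 1"
  shows "emeasure lborel (closure {t *\<^sub>R u | t u. t \<in> {0..1} \<and> u \<in> V})
    \<le> ennreal (2 ^ (CARD('n) + 1) * unit_ball_vol (real CARD('n)) * diameter V ^ (CARD('n) - 1))"
proof -
  define n where "n = CARD('n)"
  have n1: "1 \<le> n" by (simp add: n_def Suc_leI)
  define C where "C = 2 ^ (n + 1) * unit_ball_vol (real n)"
  have C: "0 < C" by (simp add: C_def)
  define K where "K = closure {t *\<^sub>R u | t u. t \<in> {0..1} \<and> u \<in> V}"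
  obtain u0 where u0: "u0 \<in> V" using V by auto
  have bV: "bounded V" using V bounded_subset bounded_sphere by blast
  have r: "emeasure lborel K \<le> ennreal (C * r ^ (n - 1))" if r: "0 < r" "r \<le> 1" "diameter V \<le> r" for r
  proof -
    define N where "N = nat \<lfloor>1 / r\<rfloor>"
    have "{t *\<^sub>R u | t u. t \<in> {0..1} \<and> u \<in> V} \<subseteq> (\<Union>k\<in>{..N}. cball ((real k * r) *\<^sub>R u0) (2 * r))"
    proof clarsimp
      fix t :: real and u :: "real^'n" assume t: "0 \<le> t" "t \<le> 1" and u: "u \<in> V"
      define k where "k = nat \<lfloor>t / r\<rfloor>"
      have tr: "0 \<le> t / r" using t r by simp
      have k: "real k \<le> t / r" "t / r < real k + 1"
        using tr unfolding k_def by (auto simp: of_nat_nat)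
      have kN: "k \<le> N" unfolding k_def N_def using t r
        by (intro nat_mono floor_mono divide_right_mono) auto
      have kr: "real k * r \<le> t" "t \<le> real k * r + r" using k r by (auto simp: field_simps)
      have "dist ((real k * r) *\<^sub>R u0) (t *\<^sub>R u) = norm ((real k * r) *\<^sub>R (u0 - u) + (real k * r - t) *\<^sub>R u)"
        by (simp add: dist_norm algebra_simps)
      also have "\<dots> \<le> norm ((real k * r) *\<^sub>R (u0 - u)) + norm ((real k * r - t) *\<^sub>R u)"
        by (rule norm_triangle_ineq)
      also have "\<dots> \<le> 1 * r + r"
      proof (rule add_mono)
        have "dist u0 u \<le> diameter V" by (rule diameter_bounded_bound[OF bV u0 u])
        then have "norm (u0 - u) \<le> r" using r by (simp add: dist_norm)
        moreover have "\<bar>real k * r\<bar> \<le> 1" using kr t r by simp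
        ultimately show "norm ((real k * r) *\<^sub>R (u0 - u)) \<le> 1 * r"
          unfolding norm_scaleR by (intro mult_mono) auto
        have "norm u = 1" using u V by auto
        then show "norm ((real k * r - t) *\<^sub>R u) \<le> r" using kr by simp
      qed
      finally show "\<exists>k\<in>{..N}. dist ((real k * r) *\<^sub>R u0) (t *\<^sub>R u) \<le> 2 * r"
        using kN by (intro bexI[of _ k]) auto
    qed
    then have "K \<subseteq> (\<Union>k\<in>{..N}. cball ((real k * r) *\<^sub>R u0) (2 * r))"
      unfolding K_def by (rule closure_minimal) auto
    then have "emeasure lborel K \<le> emeasure lborel (\<Union>k\<in>{..N}. cball ((real k * r) *\<^sub>R u0) (2 * r))"
      by (intro emeasure_mono) auto
    also have "\<dots> \<le> (\<Sum>k\<in>{..N}. emeasure lborel (cball ((real k * r) *\<^sub>R u0) (2 * r)))"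
      by (rule emeasure_subadditive_finite) auto
    also have "\<dots> = of_nat (N + 1) * ennreal (unit_ball_vol (real n) * (2 * r) ^ n)"
      using r by (simp add: emeasure_cball n_def)
    also have "\<dots> = ennreal (real (N + 1) * (unit_ball_vol (real n) * (2 * r) ^ n))"
      using r by (subst ennreal_mult) (auto simp: ennreal_of_nat_eq_real_of_nat)
    also have "\<dots> \<le> ennreal (C * r ^ (n - 1))"
    proof (rule ennreal_leI)
      have "real N \<le> 1 / r" unfolding N_def using r by (simp add: of_nat_nat)
      then have "real (N + 1) * r \<le> 2" using r by (simp add: field_simps)
      then have "(real (N + 1) * r) * (unit_ball_vol (real n) * 2 ^ n * r ^ (n - 1))
          \<le> 2 * (unit_ball_vol (real n) * 2 ^ n * r ^ (n - 1))"
        using r by (intro mult_right_mono) auto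
      moreover have "r ^ n = r * r ^ (n - 1)" using n1 by (cases n) auto
      ultimately show "real (N + 1) * (unit_ball_vol (real n) * (2 * r) ^ n) \<le> C * r ^ (n - 1)"
        by (simp add: C_def power_mult_distrib ac_simps)
    qed
    finally show ?thesis .
  qed
  have "emeasure lborel K \<le> ennreal (C * diameter V ^ (n - 1))"
  proof (cases "0 < diameter V")
    case True then show ?thesis using r[of "diameter V"] d by simp
  next
    case False
    then have D0: "diameter V = 0" using diameter_ge_0[OF bV] by simp
    show ?thesis
    \<comment> \<open>The ball covering needs a positive radius. With diameter 0 the bound reads
      \<open>C * 0 ^ (n - 1)\<close>: for \<open>n = 1\<close> this is \<open>C\<close>, reached
      with \<open>r = 1\<close>; for larger \<open>n\<close> it is 0 and follows by letting the
      radius shrink.\<close>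
    proof (cases "n = 1")
      case True then show ?thesis using r[of 1] D0 by simp
    next
      case n2: False
      show ?thesis
      proof (rule ennreal_le_epsilon)
        fix e :: real assume e: "0 < e"
        define \<rho> where "\<rho> = min 1 (e / C)"
        have \<rho>: "0 < \<rho>" "\<rho> \<le> 1" "\<rho> \<le> e / C" using e C by (auto simp: \<rho>_def)
        have "\<rho> ^ (n - 1) \<le> \<rho> ^ 1" using n1 n2 \<rho> by (intro power_decreasing) auto
        also have "\<dots> \<le> e / C" using \<rho> by simp
        finally have "C * \<rho> ^ (n - 1) \<le> e" using C by (simp add: field_simps)
        then have "emeasure lborel K \<le> ennreal e"
          using r[of \<rho>] \<rho> D0 by (intro order_trans[OF r[of \<rho>] ennreal_leI]) auto
        then show "emeasure lborel K \<le> ennreal (C * diameter V ^ (n - 1)) + ennreal e"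
          by (simp add: add_increasing)
      qed
    qed
  qed
  then show ?thesis by (simp add: K_def C_def n_def)
qed

text \<open>Cones over the members of a cover of the sphere cover the unit ball, so the covering sum
  is bounded below by a multiple of the ball's volume. Covers of mesh 1 are enough, since contents
  lie below the outer measure.\<close>

lemma hausdorff_outer_sphere_pos:
  "0 < hausdorff_outer (CARD('n) - 1) (sphere 0 1 :: (real^'n) set)"
proof -
  define n where "n = CARD('n)"
  \<comment> \<open>The constant of the cone estimate divided by the normalisation
    \<open>unit_ball_vol (real (n - 1)) / 2 ^ (n - 1)\<close> of a Hausdorff summand.\<close>
  define C where "C = 2 ^ (n + 1) * unit_ball_vol (real n) * 2 ^ (n - 1) / unit_ball_vol (real (n - 1))"
  have C: "0 < C" by (simp add: C_def)
  let ?t = "\<lambda>V. if V = {} then 0 else ennreal (unit_ball_vol (real (n - 1)) * (diameter V / 2) ^ (n - 1))"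
  have "ennreal (unit_ball_vol (real n) / C) \<le> hausdorff_content (n - 1) 1 (sphere 0 1 :: (real^'n) set)"
    unfolding hausdorff_content_def
  proof (safe intro!: INF_greatest)
    fix U :: "nat \<Rightarrow> (real^'n) set"
    assume U: "sphere 0 1 \<subseteq> (\<Union>i. U i)" "\<forall>i. bounded (U i) \<and> diameter (U i) \<le> 1"
    define V where "V i = U i \<inter> sphere 0 1" for i
    define K where "K i = closure {t *\<^sub>R u | t u. t \<in> {0..1} \<and> u \<in> V i}" for i
    have Kle: "emeasure lborel (K i) \<le> ennreal C * ?t (U i)" for i
    proof (cases "V i = {}")
      case False
      have dV: "diameter (V i) \<le> diameter (U i)" "0 \<le> diameter (V i)"
        using U by (auto simp: V_def intro!: diameter_subset diameter_ge_0)
      have "diameter (V i) \<le> 1" using dV(1) U(2) order_trans by blast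
      then have "emeasure lborel (K i) \<le> ennreal (2 ^ (n + 1) * unit_ball_vol (real n) * diameter (V i) ^ (n - 1))"
        unfolding K_def n_def using False
        by (intro emeasure_cone_le) (auto simp: V_def)
      also have "\<dots> \<le> ennreal (2 ^ (n + 1) * unit_ball_vol (real n) * diameter (U i) ^ (n - 1))"
        using dV by (intro ennreal_leI mult_left_mono power_mono) auto
      also have "\<dots> = ennreal (C * (unit_ball_vol (real (n - 1)) * (diameter (U i) / 2) ^ (n - 1)))"
        by (simp add: C_def power_divide less_imp_neq[OF unit_ball_vol_pos, symmetric] mult.assoc)
      also have "\<dots> = ennreal C * ennreal (unit_ball_vol (real (n - 1)) * (diameter (U i) / 2) ^ (n - 1))"
        using C dV by (intro ennreal_mult) auto
      finally show ?thesis using False by (auto simp: V_def)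
    qed (simp add: K_def)
    have "cball 0 1 \<subseteq> (\<Union>i. K i)"
    proof
      fix x :: "real^'n" assume x: "x \<in> cball 0 1"
      have "\<exists>u\<in>sphere 0 1. x = norm x *\<^sub>R u"
      proof (cases "x = 0")
        case True then show ?thesis by (auto intro!: exI[of _ "axis undefined 1"])
      next
        case False then show ?thesis by (intro bexI[of _ "x /\<^sub>R norm x"]) auto
      qed
      then obtain u where u: "u \<in> sphere 0 1" "x = norm x *\<^sub>R u" by blast
      then obtain i where "u \<in> V i" using U(1) by (auto simp: V_def)
      then have "x \<in> {t *\<^sub>R u | t u. t \<in> {0..1} \<and> u \<in> V i}" using u x by force
      then have "x \<in> K i" unfolding K_def by (rule subsetD[OF closure_subset])
      then show "x \<in> (\<Union>i. K i)" by blast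
    qed
    then have "emeasure lborel (cball 0 1 :: (real^'n) set) \<le> emeasure lborel (\<Union>i. K i)"
      by (intro emeasure_mono) (auto simp: K_def)
    also have "\<dots> \<le> (\<Sum>i. emeasure lborel (K i))"
      by (rule emeasure_subadditive_countably) (auto simp: K_def)
    also have "\<dots> \<le> (\<Sum>i. ennreal C * ?t (U i))"
      by (intro suminf_le Kle) auto
    also have "\<dots> = ennreal C * (\<Sum>i. ?t (U i))" by (rule ennreal_suminf_cmult)
    finally have *: "ennreal (unit_ball_vol (real n)) \<le> ennreal C * (\<Sum>i. ?t (U i))"
      by (simp add: emeasure_cball n_def)
    have "ennreal (unit_ball_vol (real n) / C) = ennreal (1 / C) * ennreal (unit_ball_vol (real n))"
      using C by (simp add: ennreal_mult[symmetric])
    also have "\<dots> \<le> ennreal (1 / C) * (ennreal C * (\<Sum>i. ?t (U i)))"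
      by (rule mult_left_mono[OF *]) simp
    also have "\<dots> = (\<Sum>i. ?t (U i))"
      using C by (simp add: mult.assoc[symmetric] ennreal_mult[symmetric])
    finally show "ennreal (unit_ball_vol (real n) / C) \<le> (\<Sum>i. ?t (U i))" .
  qed
  also have "\<dots> \<le> hausdorff_outer (n - 1) (sphere 0 1 :: (real^'n) set)"
    by (rule hausdorff_content_le_outer) simp
  finally have "ennreal (unit_ball_vol (real n) / C) \<le> hausdorff_outer (n - 1) (sphere 0 1 :: (real^'n) set)" .
  moreover have "0 < ennreal (unit_ball_vol (real n) / C)" using C by simp
  ultimately show ?thesis unfolding n_def[symmetric] by (rule less_le_trans[rotated])
qed

section \<open>Measures on the sphere and their uniqueness under rotations\<close>

lemma sphere_measuresD:
  assumes "\<mu> \<in> sphere_measures"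
  shows "finite_measure \<mu>" "sets \<mu> = sets sphere_borel" "space \<mu> = unit_sphere"
  using assms sets_eq_imp_space_eq[of \<mu> sphere_borel] by (auto simp: sphere_measures_def space_restrict_space)

lemma sphere_measurable_continuous:
  fixes \<mu> :: "(real^'n) measure" and g :: "real^'n \<Rightarrow> real"
  assumes "\<mu> \<in> sphere_measures" "continuous_on unit_sphere g"
  shows "g \<in> borel_measurable \<mu>"
  using borel_measurable_continuous_on_restrict[OF assms(2)] sphere_measuresD(2)[OF assms(1)]
  by (simp cong: measurable_cong_sets)

lemma sphere_integrable_bounded:
  fixes \<mu> :: "(real^'n) measure" and g :: "real^'n \<Rightarrow> real"
  assumes "\<mu> \<in> sphere_measures" "g \<in> borel_measurable \<mu>" "\<And>x. x \<in> unit_sphere \<Longrightarrow> \<bar>g x\<bar> \<le> B"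
  shows "integrable \<mu> g"
proof -
  interpret finite_measure \<mu> using assms sphere_measuresD by blast
  show ?thesis
    using assms sphere_measuresD(3)[OF assms(1)]
    by (intro integrable_const_bound[of _ B]) auto
qed

lemma sphere_continuous_bounded:
  fixes g :: "real^'n \<Rightarrow> real"
  assumes "continuous_on unit_sphere g"
  obtains B where "0 < B" "\<And>x. x \<in> unit_sphere \<Longrightarrow> \<bar>g x\<bar> \<le> B"
proof -
  have "bounded (g ` unit_sphere)"
    by (intro compact_imp_bounded compact_continuous_image assms) auto
  then show thesis using that by (auto simp: bounded_pos)
qed

lemma sphere_integrable_continuous:
  fixes \<mu> :: "(real^'n) measure" and g :: "real^'n \<Rightarrow> real"
  assumes "\<mu> \<in> sphere_measures" "continuous_on unit_sphere g"
  shows "integrable \<mu> g"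
  using assms sphere_continuous_bounded[OF assms(2)]
  by (metis sphere_integrable_bounded sphere_measurable_continuous)

lemma sets_sphere_borel:
  "sets (sphere_borel :: (real^'n) measure) = sigma_sets unit_sphere ((\<inter>) unit_sphere ` Collect open)"
proof -
  have b: "sets (borel :: (real^'n) measure) = sigma_sets UNIV (Collect open)"
    by (simp add: borel_def Collect_mem_eq)
  have "(unit_sphere :: (real^'n) set) \<in> sets borel" by simp
  then show ?thesis
    unfolding sets_restrict_space b by (intro sigma_sets_Int) auto
qed

lemma openin_sphere_sets:
  fixes \<mu> :: "(real^'n) measure"
  assumes "\<mu> \<in> sphere_measures" "openin (top_of_set unit_sphere) U"
  shows "U \<in> sets \<mu>"
  using assms by (auto simp: sphere_measuresD(2) sets_restrict_space openin_open)

lemma sphere_measure_eqI_open: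
  fixes M N :: "(real^'n) measure"
  assumes M: "M \<in> sphere_measures" and N: "N \<in> sphere_measures"
    and eq: "\<And>U. openin (top_of_set unit_sphere) U \<Longrightarrow> emeasure M U = emeasure N U"
  shows "M = N"
proof (rule measure_eqI_generator_eq[where \<Omega>=unit_sphere and E="(\<inter>) unit_sphere ` Collect open"
      and A="\<lambda>_. unit_sphere"])
  show "Int_stable ((\<inter>) (unit_sphere :: (real^'n) set) ` Collect open)"
    by (rule Int_stableI_image) (metis Int_assoc Int_left_absorb Int_left_commute mem_Collect_eq open_Int)
  show "emeasure M (unit_sphere) \<noteq> \<infinity>" for i :: nat
    using finite_measure.emeasure_finite[OF sphere_measuresD(1)[OF M]] by simp
qed (use M N eq sphere_measuresD(2)[OF M] sphere_measuresD(2)[OF N] in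
    \<open>auto simp: sets_sphere_borel openin_open intro!: image_eqI[of _ _ UNIV]\<close>)

lemma sphere_measure_eqI_integral:
  fixes M N :: "(real^'n) measure"
  assumes M: "M \<in> sphere_measures" and N: "N \<in> sphere_measures"
    and eq: "\<And>g :: real^'n \<Rightarrow> real. continuous_on unit_sphere g \<Longrightarrow> (\<integral>x. g x \<partial>M) = (\<integral>x. g x \<partial>N)"
  shows "M = N"
proof (rule sphere_measure_eqI_open[OF M N])
  fix V :: "(real^'n) set" assume "openin (top_of_set unit_sphere) V"
  then obtain U where U: "open U" "V = unit_sphere \<inter> U" by (auto simp: openin_open)
  \<comment> \<open>Continuous functions increasing to the indicator of \<open>U\<close>. The whole
    space is separate because \<open>infdist\<close> to the empty set is 0, not infinite.\<close>
  define f where "f k x = (if U = UNIV then 1 else min 1 (real k * infdist x (- U)))" for k :: nat and x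
  have cf: "continuous_on unit_sphere (f k)" for k
    unfolding f_def by (cases "U = UNIV") (auto intro!: continuous_intros)
  have lim: "(\<lambda>k. f k x) \<longlonglongrightarrow> indicator U x" for x
  proof (cases "U = UNIV")
    case False
    show ?thesis
    proof (cases "x \<in> U")
      case True
      then have pos: "0 < infdist x (- U)"
        using False U(1) by (metis Compl_eq_Compl_iff Compl_UNIV_eq ComplD closed_Compl double_complement
            in_closed_iff_infdist_zero infdist_nonneg order_less_le)
      then obtain n :: nat where n: "1 / infdist x (- U) < real n" using reals_Archimedean2 by blast
      have "f k x = 1" if "k \<ge> n" for k
      proof -
        have "1 \<le> real n * infdist x (- U)" using n pos by (simp add: field_simps)
        also have "\<dots> \<le> real k * infdist x (- U)" using that pos by (intro mult_right_mono) auto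
        finally show ?thesis by (simp add: f_def)
      qed
      then show ?thesis using True by (intro tendsto_eventually) (auto simp: eventually_sequentially)
    qed (simp add: f_def False)
  qed (simp add: f_def)
  have conv: "(\<lambda>k. \<integral>x. f k x \<partial>P) \<longlonglongrightarrow> measure P V" if P: "P \<in> sphere_measures" for P :: "(real^'n) measure"
  proof -
    interpret finite_measure P using P sphere_measuresD by blast
    have Vs: "V \<in> sets P" using U by (intro openin_sphere_sets[OF P]) (auto simp: openin_open)
    have "(\<lambda>k. \<integral>x. f k x \<partial>P) \<longlonglongrightarrow> (\<integral>x. indicator V x \<partial>P)"
    proof (rule integral_dominated_convergence[where w="\<lambda>_. 1"])
      show "f k \<in> borel_measurable P" for k by (rule sphere_measurable_continuous[OF P cf])
      show "AE x in P. (\<lambda>k. f k x) \<longlonglongrightarrow> indicator V x"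
        using lim by (intro AE_I2) (auto simp: U(2) sphere_measuresD(3)[OF P] indicator_def)
      show "AE x in P. norm (f k x) \<le> 1" for k
        by (intro AE_I2) (auto simp: f_def infdist_nonneg)
    qed (use Vs in auto)
    then show ?thesis using Vs by simp
  qed
  have "measure M V = measure N V"
    using LIMSEQ_unique[OF conv[OF M]] conv[OF N] by (simp add: eq cf)
  then show "emeasure M V = emeasure N V"
    using finite_measure.emeasure_eq_measure sphere_measuresD(1) M N by metis
qed

lemma scale_measure_eq_density: "scale_measure r M = density M (\<lambda>_. r)"
  by (rule measure_eqI) (auto simp: emeasure_density nn_integral_cmult)

text \<open>Let \<open>k r x y\<close> be supported on pairs at distance less than \<open>r\<close>.
  Transitivity of rotations on the sphere makes its integrals \<open>G r\<close> (against
  \<open>\<mu>\<close>) and \<open>H r\<close> (against \<open>\<sigma>\<close>) independent of the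
  other variable. Integrating \<open>k r x y * g y\<close> against both measures gives
  \<open>G r * (\<integral>y. g y \<partial>\<sigma>)\<close> in one order and nearly
  \<open>H r * (\<integral>x. g x \<partial>\<mu>)\<close> in the other, by uniform continuity of
  \<open>g\<close>. Dividing by \<open>H r\<close> and letting the error go to 0 leaves
  proportionality.\<close>

lemma rotation_invariant_measure_unique:
  fixes \<mu> \<sigma> :: "(real^'n) measure"
  assumes \<mu>: "\<mu> \<in> sphere_measures" and \<sigma>: "\<sigma> \<in> sphere_measures"
    and inv\<mu>: "\<And>\<phi> (g :: real^'n \<Rightarrow> real). orthogonal_transformation \<phi> \<Longrightarrow> continuous_on unit_sphere g \<Longrightarrow>
        (\<integral>x. g (\<phi> x) \<partial>\<mu>) = (\<integral>x. g x \<partial>\<mu>)"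
    and inv\<sigma>: "\<And>\<phi> (g :: real^'n \<Rightarrow> real). orthogonal_transformation \<phi> \<Longrightarrow> continuous_on unit_sphere g \<Longrightarrow>
        (\<integral>x. g (\<phi> x) \<partial>\<sigma>) = (\<integral>x. g x \<partial>\<sigma>)"
    and pos: "0 < measure \<sigma> unit_sphere"
  shows "\<mu> = scale_measure (ennreal (measure \<mu> unit_sphere / measure \<sigma> unit_sphere)) \<sigma>"
proof -
  interpret M: finite_measure \<mu> using \<mu> sphere_measuresD by blast
  interpret S: finite_measure \<sigma> using \<sigma> sphere_measuresD by blast
  interpret pair_sigma_finite \<mu> \<sigma> ..
  note sp = sphere_measuresD(3)[OF \<mu>] sphere_measuresD(3)[OF \<sigma>]
  define mM mS where "mM = measure \<mu> unit_sphere" and "mS = measure \<sigma> unit_sphere"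
  \<comment> \<open>Continuous rather than an indicator of a ball, because invariance is only
    assumed for integrals of continuous functions.\<close>
  define k where "k r x y = max 0 (r - dist x y)" for r and x y :: "real^'n"
  have k_comm: "k r x y = k r y x" for r x y by (simp add: k_def dist_commute)
  have k0: "0 \<le> k r x y" for r x y by (simp add: k_def)
  have kle: "k r x y \<le> \<bar>r\<bar>" for r x y using zero_le_dist[of x y] unfolding k_def by linarith
  have ck: "continuous_on A (\<lambda>x. k r x y)" "continuous_on A (k r y)" for A r y
    unfolding k_def by (intro continuous_intros)+
  define e :: "real^'n" where "e = axis undefined 1"
  have e: "norm e = 1" by (simp add: e_def)
  define G H where "G r = (\<integral>x. k r x e \<partial>\<mu>)" and "H r = (\<integral>x. k r x e \<partial>\<sigma>)" for r
  have const: "(\<integral>x. k r x y \<partial>P) = (\<integral>x. k r x e \<partial>P)"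
    if y: "norm y = 1" and inv: "\<And>\<phi> (g :: real^'n \<Rightarrow> real). orthogonal_transformation \<phi> \<Longrightarrow> continuous_on unit_sphere g \<Longrightarrow>
        (\<integral>x. g (\<phi> x) \<partial>P) = (\<integral>x. g x \<partial>P)" for P y r
  proof -
    obtain \<phi> where \<phi>: "orthogonal_transformation \<phi>" "\<phi> e = y"
      using orthogonal_transformation_exists[of e y] e y by auto
    have "(\<integral>x. k r x y \<partial>P) = (\<integral>x. k r (\<phi> x) (\<phi> e) \<partial>P)"
      using inv[OF \<phi>(1) ck(1)[of _ r y]] \<phi>(2) by simp
    also have "\<dots> = (\<integral>x. k r x e \<partial>P)"
      using \<phi>(1) by (simp add: k_def orthogonal_transformation_isometry)
    finally show ?thesis .
  qed
  note G = const[OF _ inv\<mu>, folded G_def] and H = const[OF _ inv\<sigma>, folded H_def]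
  have H': "(\<integral>y. k r x y \<partial>\<sigma>) = H r" if "norm x = 1" for r x
    using H[OF that] by (simp add: k_comm[of r x])
  have meas[measurable]: "(\<lambda>x. x) \<in> \<mu> \<rightarrow>\<^sub>M borel" "(\<lambda>x. x) \<in> \<sigma> \<rightarrow>\<^sub>M borel"
    using \<mu> \<sigma> by (auto simp: sphere_measuresD(2) measurable_restrict_space1 cong: measurable_cong_sets)
  have mk[measurable]: "(\<lambda>p. k r (fst p) (snd p)) \<in> borel_measurable (\<mu> \<Otimes>\<^sub>M \<sigma>)" for r
  proof -
    have "(\<lambda>p. fst p) \<in> \<mu> \<Otimes>\<^sub>M \<sigma> \<rightarrow>\<^sub>M borel" "(\<lambda>p. snd p) \<in> \<mu> \<Otimes>\<^sub>M \<sigma> \<rightarrow>\<^sub>M borel"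
      using measurable_compose[OF measurable_fst meas(1)] measurable_compose[OF measurable_snd meas(2)] by auto
    then show ?thesis unfolding k_def by measurable
  qed
  \<comment> \<open>If \<open>H r\<close> were 0, every \<open>r\<close>-ball centred on the sphere
    would be null for \<open>\<sigma>\<close>; finitely many of them cover the sphere, contradicting
    \<open>pos\<close>.\<close>
  have Hpos: "0 < H r" if r: "0 < r" for r
  proof (rule ccontr)
    assume "\<not> 0 < H r"
    moreover have "0 \<le> H r" unfolding H_def by (intro integral_nonneg_AE) (auto simp: k0)
    ultimately have H0: "H r = 0" by simp
    have "compact (unit_sphere :: (real^'n) set)" by simp
    then obtain T :: "(real^'n) set" where T: "T \<subseteq> unit_sphere" "finite T" "unit_sphere \<subseteq> (\<Union>y\<in>T. ball y r)"
      by (rule compactE_image[of _ unit_sphere "\<lambda>y. ball y r"]) (use r in auto)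
    have "AE x in \<sigma>. k r x y = 0" if "y \<in> T" for y
    proof -
      have "(\<integral>x. k r x y \<partial>\<sigma>) = 0" using H[of y] T that H0 by auto
      then show ?thesis
        using integral_nonneg_eq_0_iff_AE[of \<sigma> "\<lambda>x. k r x y"] k0
          sphere_integrable_continuous[OF \<sigma> ck(1)] by simp
    qed
    then have "AE x in \<sigma>. \<forall>y\<in>T. k r x y = 0" using T by (simp add: AE_finite_all)
    then have "AE x in \<sigma>. False"
    proof (rule AE_mp, intro AE_I2 impI)
      fix x assume x: "x \<in> space \<sigma>" "\<forall>y\<in>T. k r x y = 0"
      then obtain y where "y \<in> T" "dist y x < r" using T(3) by (auto simp: sp)
      then show False using x(2) by (force simp: k_def dist_commute)
    qed
    then have "emeasure \<sigma> (space \<sigma>) = 0"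
      by (subst (asm) AE_iff_measurable[of "space \<sigma>"]) auto
    then have "emeasure \<sigma> unit_sphere = 0" by (simp add: sp)
    then show False using pos by (simp add: measure_def)
  qed
  have main: "\<bar>G r * (\<integral>x. g x \<partial>\<sigma>) - H r * (\<integral>x. g x \<partial>\<mu>)\<bar> \<le> \<epsilon> * H r * mM"
    if g: "continuous_on unit_sphere (g :: real^'n \<Rightarrow> real)" and
      near: "\<And>x y. norm x = 1 \<Longrightarrow> norm y = 1 \<Longrightarrow> dist x y < r \<Longrightarrow> \<bar>g y - g x\<bar> \<le> \<epsilon>" for g r \<epsilon>
  proof -
    obtain B where B: "0 < B" "\<And>x. x \<in> unit_sphere \<Longrightarrow> \<bar>g x\<bar> \<le> B"
      using sphere_continuous_bounded[OF g] by blast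
    have mg: "g \<in> borel_measurable \<sigma>" using sphere_measurable_continuous[OF \<sigma> g] .
    interpret P: finite_measure "\<mu> \<Otimes>\<^sub>M \<sigma>"
      by (rule finite_measure_pair_measure) unfold_locales
    have int: "integrable (\<mu> \<Otimes>\<^sub>M \<sigma>) (\<lambda>(x, y). k r x y * g y)"
    proof (rule P.integrable_const_bound[of _ "\<bar>r\<bar> * B"])
      show "AE p in \<mu> \<Otimes>\<^sub>M \<sigma>. norm (case p of (x, y) \<Rightarrow> k r x y * g y) \<le> \<bar>r\<bar> * B"
      proof (rule AE_I2)
        fix p assume "p \<in> space (\<mu> \<Otimes>\<^sub>M \<sigma>)"
        then have "snd p \<in> unit_sphere" by (auto simp: space_pair_measure sp)
        then have "\<bar>k r (fst p) (snd p)\<bar> * \<bar>g (snd p)\<bar> \<le> \<bar>r\<bar> * B"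
          using k0 kle B by (intro mult_mono) auto
        then show "norm (case p of (x, y) \<Rightarrow> k r x y * g y) \<le> \<bar>r\<bar> * B"
          by (simp add: split_beta abs_mult)
      qed
      show "(\<lambda>(x, y). k r x y * g y) \<in> borel_measurable (\<mu> \<Otimes>\<^sub>M \<sigma>)"
        using borel_measurable_times[OF mk[of r] measurable_compose[OF measurable_snd mg]]
        by (simp add: split_beta')
    qed
    have ik: "integrable \<sigma> (k r x)" for x by (rule sphere_integrable_continuous[OF \<sigma> ck(2)])
    have ikg: "integrable \<sigma> (\<lambda>y. k r x y * g y)" for x
      by (rule sphere_integrable_continuous[OF \<sigma>]) (intro continuous_intros ck g)
    have "G r * (\<integral>y. g y \<partial>\<sigma>) = (\<integral>y. G r * g y \<partial>\<sigma>)" by simp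
    also have "\<dots> = (\<integral>y. (\<integral>x. k r x y * g y \<partial>\<mu>) \<partial>\<sigma>)"
      by (rule Bochner_Integration.integral_cong) (use G in \<open>auto simp: sp\<close>)
    also have "\<dots> = (\<integral>x. (\<integral>y. k r x y * g y \<partial>\<sigma>) \<partial>\<mu>)"
      by (rule Fubini_integral[OF int])
    finally have 1: "G r * (\<integral>y. g y \<partial>\<sigma>) = (\<integral>x. (\<integral>y. k r x y * g y \<partial>\<sigma>) \<partial>\<mu>)" .
    have 2: "H r * (\<integral>x. g x \<partial>\<mu>) = (\<integral>x. H r * g x \<partial>\<mu>)" by simp
    have i1: "integrable \<mu> (\<lambda>x. \<integral>y. k r x y * g y \<partial>\<sigma>)"
      using integrable_fst'[OF int] by simp
    have i2: "integrable \<mu> (\<lambda>x. H r * g x)"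
      using sphere_integrable_continuous[OF \<mu> g] by simp
    have pw: "\<bar>(\<integral>y. k r x y * g y \<partial>\<sigma>) - H r * g x\<bar> \<le> \<epsilon> * H r" if x: "norm x = 1" for x
    proof -
      have "(\<integral>y. k r x y * g y \<partial>\<sigma>) - H r * g x = (\<integral>y. k r x y * g y - k r x y * g x \<partial>\<sigma>)"
        using ik[of x] ikg[of x] H'[OF x] by (subst Bochner_Integration.integral_diff) auto
      also have "\<bar>\<dots>\<bar> \<le> (\<integral>y. \<bar>k r x y * g y - k r x y * g x\<bar> \<partial>\<sigma>)" by (rule integral_abs_bound)
      also have "\<dots> \<le> (\<integral>y. \<epsilon> * k r x y \<partial>\<sigma>)"
      proof (rule integral_mono)
        fix y assume "y \<in> space \<sigma>"
        then have y: "norm y = 1" by (simp add: sp)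
        show "\<bar>k r x y * g y - k r x y * g x\<bar> \<le> \<epsilon> * k r x y"
        proof (cases "dist x y < r")
          case True
          have "k r x y * \<bar>g y - g x\<bar> \<le> k r x y * \<epsilon>" by (intro mult_left_mono near x y True k0)
          moreover have "k r x y * g y - k r x y * g x = k r x y * (g y - g x)"
            by (simp add: right_diff_distrib)
          ultimately show ?thesis using k0[of r x y] by (simp add: abs_mult mult.commute)
        qed (simp add: k_def)
      qed (use ik ikg in auto)
      finally show ?thesis using H'[OF x] by simp
    qed
    have "G r * (\<integral>x. g x \<partial>\<sigma>) - H r * (\<integral>x. g x \<partial>\<mu>) = (\<integral>x. (\<integral>y. k r x y * g y \<partial>\<sigma>) - H r * g x \<partial>\<mu>)"
      unfolding 1 2 by (rule Bochner_Integration.integral_diff[OF i1 i2, symmetric])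
    also have "\<bar>\<dots>\<bar> \<le> (\<integral>x. \<bar>(\<integral>y. k r x y * g y \<partial>\<sigma>) - H r * g x\<bar> \<partial>\<mu>)" by (rule integral_abs_bound)
    also have "\<dots> \<le> (\<integral>x. \<epsilon> * H r \<partial>\<mu>)"
      by (rule integral_mono) (use i1 i2 pw in \<open>auto simp: sp\<close>)
    also have "\<dots> = \<epsilon> * H r * mM" by (simp add: mM_def sp)
    finally show ?thesis .
  qed
  \<comment> \<open>A constant function has no oscillation, so \<open>main\<close> with error 0 is
    an exact identity; it makes the ratio of \<open>G r\<close> to \<open>H r\<close> independent of
    \<open>r\<close>.\<close>
  have GH: "G r * mS = H r * mM" for r
    using main[of "\<lambda>_. 1" r 0] by (simp add: mM_def mS_def sp)
  define c where "c = mM / mS"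
  have c0: "0 \<le> c" using pos by (simp add: c_def mM_def mS_def)
  have Gc: "G r = c * H r" for r using GH[of r] pos by (simp add: c_def mS_def field_simps)
  have fin: "scale_measure (ennreal c) \<sigma> \<in> sphere_measures"
    using sphere_measuresD[OF \<sigma>] S.emeasure_finite[of "space \<sigma>"]
    by (auto simp: sphere_measures_def space_scale_measure ennreal_mult_eq_top_iff intro!: finite_measureI)
  have "\<mu> = scale_measure (ennreal c) \<sigma>"
  proof (rule sphere_measure_eqI_integral[OF \<mu> fin])
    fix g :: "real^'n \<Rightarrow> real" assume g: "continuous_on unit_sphere g"
    have "\<bar>c * (\<integral>x. g x \<partial>\<sigma>) - (\<integral>x. g x \<partial>\<mu>)\<bar> \<le> \<epsilon> * mM" if \<epsilon>: "0 < \<epsilon>" for \<epsilon>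
    proof -
      have "uniformly_continuous_on unit_sphere g" by (rule compact_uniformly_continuous[OF g]) simp
      then obtain r where r: "0 < r" "\<And>x y. x \<in> unit_sphere \<Longrightarrow> y \<in> unit_sphere \<Longrightarrow> dist y x < r \<Longrightarrow> dist (g y) (g x) < \<epsilon>"
        using \<epsilon> unfolding uniformly_continuous_on_def by metis
      have "\<bar>G r * (\<integral>x. g x \<partial>\<sigma>) - H r * (\<integral>x. g x \<partial>\<mu>)\<bar> \<le> \<epsilon> * H r * mM"
        by (rule main[OF g]) (use r in \<open>force simp: dist_real_def dist_commute\<close>)
      moreover have "G r * (\<integral>x. g x \<partial>\<sigma>) - H r * (\<integral>x. g x \<partial>\<mu>)
          = H r * (c * (\<integral>x. g x \<partial>\<sigma>) - (\<integral>x. g x \<partial>\<mu>))"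
        by (simp add: Gc algebra_simps)
      ultimately have "H r * \<bar>c * (\<integral>x. g x \<partial>\<sigma>) - (\<integral>x. g x \<partial>\<mu>)\<bar> \<le> H r * (\<epsilon> * mM)"
        using Hpos[OF r(1)] by (simp add: abs_mult ac_simps)
      then show ?thesis using Hpos[OF r(1)] by simp
    qed
    note bound = this
    have mM0: "0 \<le> mM" by (simp add: mM_def)
    have "\<bar>c * (\<integral>x. g x \<partial>\<sigma>) - (\<integral>x. g x \<partial>\<mu>)\<bar> \<le> 0 + \<epsilon>" if "0 < \<epsilon>" for \<epsilon>
    proof -
      \<comment> \<open>The denominator \<open>mM + 1\<close> also covers the case that
        \<open>\<mu>\<close> has mass 0.\<close>
      have "\<bar>c * (\<integral>x. g x \<partial>\<sigma>) - (\<integral>x. g x \<partial>\<mu>)\<bar> \<le> \<epsilon> / (mM + 1) * mM"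
        using that mM0 by (intro bound divide_pos_pos) auto
      also have "\<dots> \<le> \<epsilon>" using that mM0 by (subst times_divide_eq_left, subst pos_divide_le_eq) (auto simp: algebra_simps)
      finally show ?thesis by simp
    qed
    then have "c * (\<integral>x. g x \<partial>\<sigma>) = (\<integral>x. g x \<partial>\<mu>)"
      using field_le_epsilon[of "\<bar>c * (\<integral>x. g x \<partial>\<sigma>) - (\<integral>x. g x \<partial>\<mu>)\<bar>" 0] by simp
    moreover have "(\<integral>x. g x \<partial>scale_measure (ennreal c) \<sigma>) = c * (\<integral>x. g x \<partial>\<sigma>)"
      using c0 sphere_measurable_continuous[OF \<sigma> g] by (simp add: scale_measure_eq_density integral_density)
    ultimately show "(\<integral>x. g x \<partial>\<mu>) = (\<integral>x. g x \<partial>scale_measure (ennreal c) \<sigma>)" by simp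
  qed
  then show ?thesis by (simp add: c_def mM_def mS_def)
qed

section \<open>Radial functions of star bodies\<close>

lemma zero_mem_star_set: "star_set L \<Longrightarrow> 0 \<in> L"
  unfolding star_set_def by (metis all_not_in_conv atLeastAtMost_iff order_refl scale_zero_left zero_le_one)

lemma star_set_scale_le:
  assumes "star_set L" "b *\<^sub>R s \<in> L" "0 \<le> a" "a \<le> b"
  shows "a *\<^sub>R s \<in> L"
proof (cases "b = 0")
  case True then show ?thesis using assms zero_mem_star_set by auto
next
  case False
  then have "(a / b) *\<^sub>R (b *\<^sub>R s) \<in> L"
    using assms unfolding star_set_def by (metis atLeastAtMost_iff divide_le_eq_1 divide_nonneg_nonneg
        less_eq_real_def order.trans)
  then show ?thesis using False by simp
qed

lemma
  fixes f :: "real^'n \<Rightarrow> real"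
  assumes f: "\<And>s. s \<in> unit_sphere \<Longrightarrow> 0 \<le> f s"
  shows radial_star_body_of: "s \<in> unit_sphere \<Longrightarrow> radial (star_body_of f) s = f s"
    and star_body_star_body_of: "continuous_on unit_sphere f \<Longrightarrow> star_body (star_body_of f)"
proof -
  have mem: "l *\<^sub>R s \<in> star_body_of f \<longleftrightarrow> l \<le> f s" if s: "s \<in> unit_sphere" "0 \<le> l" for s l
  proof
    assume "l *\<^sub>R s \<in> star_body_of f"
    then obtain l' s' where l': "l *\<^sub>R s = l' *\<^sub>R s'" "s' \<in> unit_sphere" "0 \<le> l'" "l' \<le> f s'"
      by (auto simp: star_body_of_def)
    have "norm (l *\<^sub>R s) = norm (l' *\<^sub>R s')" by (simp only: l'(1))
    then have "l = l'" using s l'(2,3) by simp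
    \<comment> \<open>For positive \<open>l\<close> the direction is determined, so
      \<open>s' = s\<close>; for \<open>l = 0\<close> it is not, and nonnegativity of
      \<open>f\<close> takes over.\<close>
    then show "l \<le> f s" using l' s f[OF s(1)] by (cases "l = 0") auto
  qed (use s in \<open>auto simp: star_body_of_def\<close>)
  have ray: "{l. 0 \<le> l \<and> l *\<^sub>R s \<in> star_body_of f} = {0..f s}" if "s \<in> unit_sphere" for s
    using mem[OF that] by auto
  have rad: "radial (star_body_of f) s = f s" if "s \<in> unit_sphere" for s
    using ray[OF that] f[OF that] by (simp add: radial_def)
  show "s \<in> unit_sphere \<Longrightarrow> radial (star_body_of f) s = f s" by (rule rad)
  assume c: "continuous_on unit_sphere f"
  show "star_body (star_body_of f)"
    unfolding star_body_def
  proof (intro conjI ballI)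
    have "axis undefined 1 \<in> (unit_sphere :: (real^'n) set)" by simp
    then have "0 \<in> star_body_of f" using mem[of "axis undefined 1" 0] f by auto
    then show "star_set (star_body_of f)"
      unfolding star_set_def
    proof (intro conjI ballI)
      fix x l assume x: "x \<in> star_body_of f" and l: "l \<in> {0..1::real}"
      then obtain m s where m: "x = m *\<^sub>R s" "s \<in> unit_sphere" "0 \<le> m" "m \<le> f s"
        by (auto simp: star_body_of_def)
      then have "l * m \<le> f s" using l by (meson atLeastAtMost_iff mult_left_le_one_le order_trans)
      then show "l *\<^sub>R x \<in> star_body_of f"
        using m l mem[of s "l * m"] by simp
    qed auto
    show "bdd_above {l. 0 \<le> l \<and> l *\<^sub>R s \<in> star_body_of f}" if "s \<in> unit_sphere" for s
      unfolding ray[OF that] by simp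
    show "continuous_on unit_sphere (radial (star_body_of f))"
      using c by (rule continuous_on_eq) (simp add: rad)
  qed
qed

lemma star_bodyD:
  assumes "star_body L"
  shows "star_set L" "s \<in> unit_sphere \<Longrightarrow> bdd_above {l. 0 \<le> l \<and> l *\<^sub>R s \<in> L}"
    "continuous_on unit_sphere (radial L)"
  using assms by (auto simp: star_body_def)

lemma radial_nonneg:
  assumes "star_body L" "s \<in> unit_sphere"
  shows "0 \<le> radial L s"
  unfolding radial_def
  by (rule cSup_upper) (use assms zero_mem_star_set star_bodyD in auto)

text \<open>Along a fixed direction a star body cuts out an initial interval of the half line, open
  or closed at its end. Two such intervals are nested, which settles the intersection even if the
  suprema are not attained.\<close>

lemma radial_Un_Int:
  assumes K: "star_body K" and L: "star_body L" and s: "s \<in> unit_sphere"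
  shows "radial (K \<union> L) s = max (radial K s) (radial L s)"
    and "radial (K \<inter> L) s = min (radial K s) (radial L s)"
proof -
  define R where "R M = {l. 0 \<le> l \<and> l *\<^sub>R s \<in> M}" for M
  have R: "R M \<noteq> {}" "bdd_above (R M)" if "star_body M" for M
    using zero_mem_star_set[OF star_bodyD(1)[OF that]] star_bodyD(2)[OF that s]
    by (auto simp: R_def intro: exI[of _ 0])
  have rd: "radial M s = Sup (R M)" for M by (simp add: radial_def R_def)
  have "R (K \<union> L) = R K \<union> R L" by (auto simp: R_def)
  then show "radial (K \<union> L) s = max (radial K s) (radial L s)"
    using R[OF K] R[OF L] by (simp add: rd cSup_union_distrib sup_max)
  have I: "R (K \<inter> L) = R K \<inter> R L" by (auto simp: R_def)
  have "R K \<subseteq> R L \<or> R L \<subseteq> R K"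
  proof (rule ccontr)
    assume "\<not> ?thesis"
    then obtain a b where "a \<in> R K" "a \<notin> R L" "b \<in> R L" "b \<notin> R K" by blast
    then show False
      using linear[of a b] star_set_scale_le[of K a s b] star_set_scale_le[of L b s a] star_bodyD(1)[OF K] star_bodyD(1)[OF L]
      by (auto simp: R_def)
  qed
  then show "radial (K \<inter> L) s = min (radial K s) (radial L s)"
  proof
    assume *: "R K \<subseteq> R L"
    then have "Sup (R K) \<le> Sup (R L)" using R[OF K] R[OF L] by (intro cSup_subset_mono) auto
    then show ?thesis using I * by (simp add: rd Int_absorb2)
  next
    assume *: "R L \<subseteq> R K"
    then have "Sup (R L) \<le> Sup (R K)" using R[OF K] R[OF L] by (intro cSup_subset_mono) auto
    then show ?thesis using I * by (simp add: rd Int_absorb1)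
  qed
qed

lemma star_body_Un_Int:
  assumes K: "star_body K" and L: "star_body L"
  shows "star_body (K \<union> L)" "star_body (K \<inter> L)"
proof -
  note b = star_bodyD[OF K] star_bodyD[OF L]
  show "star_body (K \<union> L)"
    unfolding star_body_def
  proof (intro conjI ballI)
    show "star_set (K \<union> L)" using b(1,4) by (auto simp: star_set_def)
    fix s assume s: "s \<in> (unit_sphere :: (real^'a) set)"
    have "{l. 0 \<le> l \<and> l *\<^sub>R s \<in> K \<union> L} = {l. 0 \<le> l \<and> l *\<^sub>R s \<in> K} \<union> {l. 0 \<le> l \<and> l *\<^sub>R s \<in> L}" by auto
    then show "bdd_above {l. 0 \<le> l \<and> l *\<^sub>R s \<in> K \<union> L}" using b s by simp
  next
    have "continuous_on unit_sphere (\<lambda>s. max (radial K s) (radial L s))" by (intro continuous_intros b)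
    then show "continuous_on unit_sphere (radial (K \<union> L))"
      by (rule continuous_on_eq) (simp add: radial_Un_Int[OF K L])
  qed
  show "star_body (K \<inter> L)"
    unfolding star_body_def
  proof (intro conjI ballI)
    show "star_set (K \<inter> L)" using b(1,4) zero_mem_star_set[OF b(1)] zero_mem_star_set[OF b(4)]
      by (auto simp: star_set_def)
    fix s assume s: "s \<in> (unit_sphere :: (real^'a) set)"
    show "bdd_above {l. 0 \<le> l \<and> l *\<^sub>R s \<in> K \<inter> L}"
      by (rule bdd_above_mono[OF b(2)[OF s]]) auto
  next
    have "continuous_on unit_sphere (\<lambda>s. min (radial K s) (radial L s))" by (intro continuous_intros b)
    then show "continuous_on unit_sphere (radial (K \<inter> L))"
      by (rule continuous_on_eq) (simp add: radial_Un_Int[OF K L])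
  qed
qed

lemma
  assumes L: "star_body L" and l: "0 < (l::real)"
  shows radial_scale: "s \<in> unit_sphere \<Longrightarrow> radial ((*\<^sub>R) l ` L) s = l * radial L s"
    and star_body_scale: "star_body ((*\<^sub>R) l ` L)"
proof -
  note b = star_bodyD[OF L]
  define R where "R M s = {l. 0 \<le> l \<and> l *\<^sub>R s \<in> M}" for M and s :: "real^'a"
  have R: "R L s \<noteq> {}" "bdd_above (R L s)" if "s \<in> unit_sphere" for s
    using zero_mem_star_set[OF b(1)] b(2)[OF that] by (auto simp: R_def intro: exI[of _ 0])
  have im: "R ((*\<^sub>R) l ` L) s = (*) l ` R L s" for s
  proof (intro set_eqI iffI)
    fix m assume "m \<in> R ((*\<^sub>R) l ` L) s"
    then obtain x where x: "0 \<le> m" "m *\<^sub>R s = l *\<^sub>R x" "x \<in> L" by (auto simp: R_def)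
    have "(m / l) *\<^sub>R s = (1 / l) *\<^sub>R (m *\<^sub>R s)" by simp
    also have "\<dots> = x" unfolding x(2) using l by simp
    finally have "m / l \<in> R L s" using x l by (auto simp: R_def)
    then show "m \<in> (*) l ` R L s" using l by (auto intro!: image_eqI[of _ _ "m / l"])
  qed (use l in \<open>auto simp: R_def image_iff simp flip: scaleR_scaleR\<close>)
  have bdd: "bdd_above ((*) l ` R L s)" if "s \<in> unit_sphere" for s
    using R(2)[OF that] l by (intro bdd_above_image_mono) (auto intro: monoI)
  have rad: "radial ((*\<^sub>R) l ` L) s = l * radial L s" if s: "s \<in> unit_sphere" for s
  proof -
    have "Sup ((*) l ` R L s) = l * Sup (R L s)"
    proof (rule cSup_eq_non_empty)
      show "x \<le> l * Sup (R L s)" if "x \<in> (*) l ` R L s" for x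
        using that R(2)[OF s] l by (auto intro!: mult_left_mono cSup_upper)
      fix y assume y: "\<And>x. x \<in> (*) l ` R L s \<Longrightarrow> x \<le> y"
      have "Sup (R L s) \<le> y / l"
        by (rule cSup_least[OF R(1)[OF s]]) (use y l in \<open>auto simp: field_simps\<close>)
      then show "l * Sup (R L s) \<le> y" using l by (simp add: field_simps)
    qed (use R[OF s] in auto)
    moreover have "radial M s = Sup (R M s)" for M by (simp add: radial_def R_def)
    ultimately show ?thesis by (simp add: im)
  qed
  show "s \<in> unit_sphere \<Longrightarrow> radial ((*\<^sub>R) l ` L) s = l * radial L s" by (rule rad)
  show "star_body ((*\<^sub>R) l ` L)"
    unfolding star_body_def
  proof (intro conjI ballI)
    show "star_set ((*\<^sub>R) l ` L)"
      unfolding star_set_def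
    proof (intro conjI ballI)
      fix y m assume "y \<in> (*\<^sub>R) l ` L" and m: "m \<in> {0..1::real}"
      then obtain x where x: "y = l *\<^sub>R x" "x \<in> L" by blast
      then have "m *\<^sub>R x \<in> L" using b(1) m by (simp add: star_set_def)
      then show "m *\<^sub>R y \<in> (*\<^sub>R) l ` L"
        using x by (auto intro!: image_eqI[of _ _ "m *\<^sub>R x"])
    qed (use b(1) in \<open>auto simp: star_set_def\<close>)
    show "bdd_above {m. 0 \<le> m \<and> m *\<^sub>R s \<in> (*\<^sub>R) l ` L}" if "s \<in> unit_sphere" for s
      using bdd[OF that] im[of s] by (simp add: R_def)
    have "continuous_on unit_sphere (\<lambda>s. l * radial L s)" by (intro continuous_intros b)
    then show "continuous_on unit_sphere (radial ((*\<^sub>R) l ` L))"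
      by (rule continuous_on_eq) (simp add: rad)
  qed
qed

section \<open>Rotations of star bodies\<close>

lemma orthogonal_inv:
  fixes \<phi> :: "real^'n \<Rightarrow> real^'n"
  assumes "orthogonal_transformation \<phi>"
  shows "orthogonal_transformation (inv \<phi>)" "\<phi> (inv \<phi> x) = x" "inv \<phi> (\<phi> x) = x"
    "norm (inv \<phi> x) = norm x" "continuous_on A (inv \<phi>)" "continuous_on A \<phi>"
proof -
  show o: "orthogonal_transformation (inv \<phi>)" using assms by (rule orthogonal_transformation_inv)
  have bij: "bij \<phi>" using assms by (rule orthogonal_transformation_bij)
  show "\<phi> (inv \<phi> x) = x" "inv \<phi> (\<phi> x) = x"
    using bij by (simp_all add: bij_is_surj surj_f_inv_f bij_is_inj)
  show "norm (inv \<phi> x) = norm x" using o by (rule orthogonal_transformation_norm)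
  show "continuous_on A (inv \<phi>)" "continuous_on A \<phi>"
    using o assms by (auto simp: orthogonal_transformation_def intro!: linear_continuous_on linear_conv_bounded_linear[THEN iffD1])
qed

lemma
  fixes L :: "(real^'n) set"
  assumes \<phi>: "orthogonal_transformation (\<phi> :: real^'n \<Rightarrow> real^'n)"
  shows radial_orthogonal: "radial (\<phi> ` L) s = radial L (inv \<phi> s)"
    and star_body_orthogonal: "star_body L \<Longrightarrow> star_body (\<phi> ` L)"
proof -
  have lin: "\<phi> (a *\<^sub>R x) = a *\<^sub>R \<phi> x" "inv \<phi> (a *\<^sub>R x) = a *\<^sub>R inv \<phi> x" for a x
    using \<phi> orthogonal_inv(1)[OF \<phi>] by (auto simp: orthogonal_transformation_def linear_cmul)
  have mem: "x \<in> \<phi> ` L \<longleftrightarrow> inv \<phi> x \<in> L" for x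
    using orthogonal_inv[OF \<phi>] by (metis imageE imageI)
  show rad: "radial (\<phi> ` L) s = radial L (inv \<phi> s)" for s
    by (simp add: radial_def mem lin)
  assume L: "star_body L"
  note b = star_bodyD[OF L]
  show "star_body (\<phi> ` L)"
    unfolding star_body_def
  proof (intro conjI ballI)
    show "star_set (\<phi> ` L)" using b(1) by (auto simp: star_set_def simp flip: lin)
    show "bdd_above {l. 0 \<le> l \<and> l *\<^sub>R s \<in> \<phi> ` L}" if "s \<in> unit_sphere" for s
      using b(2)[of "inv \<phi> s"] that by (simp add: mem lin orthogonal_inv[OF \<phi>])
    have "continuous_on unit_sphere (\<lambda>s. radial L (inv \<phi> s))"
      by (rule continuous_on_compose2[OF b(3)]) (auto simp: orthogonal_inv[OF \<phi>])
    then show "continuous_on unit_sphere (radial (\<phi> ` L))" by (simp add: rad cong: continuous_on_cong)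
  qed
qed

section \<open>The radial metric and pointwise distance of radial functions\<close>

lemma radial_dist_star_body_of_le:
  fixes f h :: "real^'n \<Rightarrow> real"
  assumes "\<And>s. s \<in> unit_sphere \<Longrightarrow> 0 \<le> f s" "\<And>s. s \<in> unit_sphere \<Longrightarrow> 0 \<le> h s"
    "\<And>s. s \<in> unit_sphere \<Longrightarrow> \<bar>h s - f s\<bar> \<le> \<eta>"
  shows "radial_dist (star_body_of h) (star_body_of f) \<le> \<eta>"
  unfolding radial_dist_def
proof (rule cSUP_least)
  show "(unit_sphere :: (real^'n) set) \<noteq> {}" by (simp add: sphere_eq_empty)
qed (use assms radial_star_body_of[of f] radial_star_body_of[of h] in simp)

lemma radial_diff_le_radial_dist:
  assumes "star_body K" "star_body L" "s \<in> unit_sphere"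
  shows "\<bar>radial K s - radial L s\<bar> \<le> radial_dist K L"
  unfolding radial_dist_def
proof (rule cSUP_upper)
  have "compact ((\<lambda>s. \<bar>radial K s - radial L s\<bar>) ` unit_sphere)"
    by (intro compact_continuous_image continuous_intros star_bodyD(3) assms) simp
  then show "bdd_above ((\<lambda>s. \<bar>radial K s - radial L s\<bar>) ` unit_sphere)"
    by (intro bounded_imp_bdd_above compact_imp_bounded)
qed (use assms in auto)

section \<open>Staircase approximation\<close>

lemma sphere_measures_density:
  fixes \<mu> :: "(real^'n) measure" and f :: "real^'n \<Rightarrow> real"
  assumes \<mu>: "\<mu> \<in> sphere_measures" and f: "continuous_on unit_sphere f" "\<And>s. s \<in> unit_sphere \<Longrightarrow> 0 \<le> f s"
  shows "density \<mu> (\<lambda>s. ennreal (f s)) \<in> sphere_measures"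
proof -
  interpret finite_measure \<mu> using \<mu> sphere_measuresD by blast
  have "integrable \<mu> f" using \<mu> f(1) by (rule sphere_integrable_continuous)
  then have "(\<integral>\<^sup>+s. ennreal (f s) \<partial>\<mu>) < top"
    using f(2) sphere_measuresD(3)[OF \<mu>] by (subst nn_integral_eq_integral) (auto intro!: AE_I2)
  moreover have "emeasure (density \<mu> (\<lambda>s. ennreal (f s))) (space \<mu>) = (\<integral>\<^sup>+s. ennreal (f s) \<partial>\<mu>)"
    using sphere_measurable_continuous[OF \<mu> f(1)]
    by (subst emeasure_density) (auto intro!: nn_integral_cong)
  ultimately show ?thesis
    using sphere_measuresD(2)[OF \<mu>] by (auto simp: sphere_measures_def intro!: finite_measureI)
qed

text \<open>Cutting both measures down to \<open>P\<close> by an indicator density gives finite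
  measures that agree on all relatively open sets, hence on all Borel sets. This carries local
  determination, which speaks of open sets only, over to Borel subsets of \<open>P\<close>.\<close>

lemma sphere_measure_restrict_eq:
  fixes M N :: "(real^'n) measure"
  assumes M: "M \<in> sphere_measures" and N: "N \<in> sphere_measures"
    and P: "openin (top_of_set unit_sphere) P"
    and eq: "\<And>U. openin (top_of_set unit_sphere) U \<Longrightarrow> U \<subseteq> P \<Longrightarrow> emeasure M U = emeasure N U"
    and A: "A \<in> sets sphere_borel" "A \<subseteq> P"
  shows "emeasure M A = emeasure N A"
proof -
  have d: "density Q (indicator P) \<in> sphere_measures"
    "\<And>B. B \<in> sets sphere_borel \<Longrightarrow> emeasure (density Q (indicator P)) B = emeasure Q (P \<inter> B)"
    if Q: "Q \<in> sphere_measures" for Q :: "(real^'n) measure"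
  proof -
    have PQ: "P \<in> sets Q" using openin_sphere_sets[OF Q P] .
    show e: "emeasure (density Q (indicator P)) B = emeasure Q (P \<inter> B)" if "B \<in> sets sphere_borel" for B
      using PQ that sphere_measuresD(2)[OF Q]
      by (subst emeasure_density) (auto simp: indicator_inter_arith[symmetric])
    show "density Q (indicator P) \<in> sphere_measures"
      using sphere_measuresD[OF Q] e[of unit_sphere] finite_measure.emeasure_finite[OF sphere_measuresD(1)[OF Q]]
      by (auto simp: sphere_measures_def intro!: finite_measureI)
         (metis sets.top)
  qed
  have "density M (indicator P) = density N (indicator P)"
  proof (rule sphere_measure_eqI_open[OF d(1)[OF M] d(1)[OF N]])
    fix U :: "(real^'n) set" assume U: "openin (top_of_set unit_sphere) U"
    then have "U \<in> sets sphere_borel" using openin_sphere_sets[OF M U] sphere_measuresD(2)[OF M] by simp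
    then show "emeasure (density M (indicator P)) U = emeasure (density N (indicator P)) U"
      using eq[of "P \<inter> U"] P U by (simp add: d M N openin_Int)
  qed
  then have "emeasure M (P \<inter> A) = emeasure N (P \<inter> A)"
    using d(2)[OF M A(1)] d(2)[OF N A(1)] by simp
  then show ?thesis using A by (simp add: Int_absorb1)
qed

text \<open>Distance to the integers. Being 1-Lipschitz, unlike the floor function, it cuts out the
  jump zones of a staircase as relatively open or closed preimages.\<close>

definition grid_dist :: "real \<Rightarrow> real" where
  "grid_dist t = \<bar>t - of_int (round t)\<bar>"

lemma grid_dist_le: "grid_dist t \<le> \<bar>t - of_int k\<bar>"
  unfolding grid_dist_def by (rule round_diff_minimal)

lemma grid_dist_triangle: "grid_dist x \<le> grid_dist y + \<bar>x - y\<bar>"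
  using grid_dist_le[of x "round y"] unfolding grid_dist_def by linarith

lemma continuous_on_grid_dist [continuous_intros]:
  assumes "continuous_on A f" shows "continuous_on A (\<lambda>x. grid_dist (f x))"
proof -
  have "continuous_on UNIV grid_dist"
    by (rule continuous_on_iff[THEN iffD2], intro ballI allI impI, rule exI, rule conjI, assumption)
      (smt (verit) dist_real_def grid_dist_triangle)
  then show ?thesis using continuous_on_compose2[OF _ assms] by blast
qed

text \<open>The zones where the staircase approximations of step \<open>\<eta>\<close> change their value: for
  different \<open>j < N\<close> they stay apart, since the grids \<open>j / N + \<int>\<close> are \<open>1 / N\<close>-separated.\<close>

lemma grid_dist_zones_disjoint:
  fixes i j N :: nat
  assumes "i < N" "j < N" "i \<noteq> j" "grid_dist (y - real i / real N) \<le> 1 / (4 * real N)"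
    "grid_dist (y - real j / real N) \<le> 1 / (4 * real N)"
  shows False
proof -
  define a b where "a = round (y - real i / real N)" and "b = round (y - real j / real N)"
  have N: "0 < real N" using assms by simp
  have "\<bar>(real i / real N - real j / real N) + (of_int a - of_int b)\<bar> \<le> 1 / (2 * real N)"
    using assms(4,5) unfolding grid_dist_def a_def[symmetric] b_def[symmetric] by (simp add: field_simps)
  then have "\<bar>(real i / real N - real j / real N) + (of_int a - of_int b)\<bar> * real N \<le> 1 / (2 * real N) * real N"
    using N by (intro mult_right_mono) auto
  also have "\<bar>(real i / real N - real j / real N) + (of_int a - of_int b)\<bar> * real N
      = \<bar>((real i / real N - real j / real N) + (of_int a - of_int b)) * real N\<bar>"
    using N by (simp add: abs_mult)
  also have "((real i / real N - real j / real N) + (of_int a - of_int b)) * real N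
      = of_int (int i - int j + (a - b) * int N)"
    using N by (simp add: algebra_simps)
  also have "1 / (2 * real N) * real N = 1 / 2" using N by simp
  \<comment> \<open>An integer of absolute value at most 1/2 vanishes. So \<open>N\<close> divides
    \<open>i - j\<close>, which is impossible for distinct indices below \<open>N\<close>.\<close>
  finally have "int i - int j + (a - b) * int N = 0" by linarith
  then have "int N dvd int i - int j"
    by (metis add.commute add_eq_0_iff dvd_minus_iff dvd_triv_right)
  then show False
    using dvd_imp_le_int[of "int i - int j" "int N"] assms(1,2,3) by auto
qed


text \<open>Off \<open>T\<close> the two measures are the same, so their integrals of
  \<open>g\<close> can differ only by what each of them sees on \<open>T\<close>, at most
  \<open>B\<close> times the mass there.\<close>

lemma integral_diff_le_of_agree:
  fixes M N :: "(real^'n) measure" and g :: "real^'n \<Rightarrow> real"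
  assumes M: "M \<in> sphere_measures" and N: "N \<in> sphere_measures"
    and T: "T \<in> sets sphere_borel"
    and eq: "\<And>A. A \<in> sets sphere_borel \<Longrightarrow> A \<subseteq> unit_sphere - T \<Longrightarrow> emeasure M A = emeasure N A"
    and g: "continuous_on unit_sphere g" and B: "\<And>x. x \<in> unit_sphere \<Longrightarrow> \<bar>g x\<bar> \<le> B"
  shows "\<bar>(\<integral>x. g x \<partial>M) - (\<integral>x. g x \<partial>N)\<bar> \<le> B * (measure M T + measure N T)"
proof -
  let ?i = "indicator (unit_sphere - T) :: real^'n \<Rightarrow> real" and ?t = "indicator T :: real^'n \<Rightarrow> real"
  have UT: "unit_sphere - T \<in> sets sphere_borel"
    using sets.compl_sets[OF T] by (simp add: space_restrict_space)
  have B0: "0 \<le> B" using B[of "axis undefined 1"] by simp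
  have dens: "density M (\<lambda>x. ennreal (?i x)) = density N (\<lambda>x. ennreal (?i x))"
  proof (rule measure_eqI)
    show "sets (density M (\<lambda>x. ennreal (?i x))) = sets (density N (\<lambda>x. ennreal (?i x)))"
      by (simp add: sphere_measuresD(2)[OF M] sphere_measuresD(2)[OF N])
    fix A assume "A \<in> sets (density M (\<lambda>x. ennreal (?i x)))"
    then have A: "A \<in> sets sphere_borel" by (simp add: sphere_measuresD(2)[OF M])
    have *: "emeasure (density Q (\<lambda>x. ennreal (?i x))) A = emeasure Q ((unit_sphere - T) \<inter> A)"
      if Q: "Q \<in> sphere_measures" for Q
      using A UT sphere_measuresD(2)[OF Q]
      by (subst emeasure_density) (auto simp: ennreal_indicator indicator_inter_arith[symmetric])
    show "emeasure (density M (\<lambda>x. ennreal (?i x))) A = emeasure (density N (\<lambda>x. ennreal (?i x))) A"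
      unfolding *[OF M] *[OF N] using A UT by (intro eq) auto
  qed
  have split: "\<bar>(\<integral>x. g x \<partial>Q) - (\<integral>x. g x \<partial>density Q (\<lambda>x. ennreal (?i x)))\<bar> \<le> B * measure Q T"
    if Q: "Q \<in> sphere_measures" for Q
  proof -
    interpret finite_measure Q using Q sphere_measuresD by blast
    note sp = sphere_measuresD(2,3)[OF Q]
    have mg: "g \<in> borel_measurable Q" by (rule sphere_measurable_continuous[OF Q g])
    have mi: "?i \<in> borel_measurable Q" "?t \<in> borel_measurable Q" using UT T sp by auto
    have i1: "integrable Q g" by (rule sphere_integrable_continuous[OF Q g])
    have i2: "integrable Q (\<lambda>x. ?i x * g x)"
      by (rule sphere_integrable_bounded[OF Q borel_measurable_times[OF mi(1) mg], of B])
        (use B B0 in \<open>auto simp: indicator_def\<close>)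
    have i3: "integrable Q (\<lambda>x. B * ?t x)"
      using T sp by (intro integrable_mult_right integrable_real_indicator) (auto simp: less_top[symmetric])
    have "(\<integral>x. g x \<partial>density Q (\<lambda>x. ennreal (?i x))) = (\<integral>x. ?i x * g x \<partial>Q)"
      using mg mi by (subst integral_real_density) auto
    then have "(\<integral>x. g x \<partial>Q) - (\<integral>x. g x \<partial>density Q (\<lambda>x. ennreal (?i x))) = (\<integral>x. g x - ?i x * g x \<partial>Q)"
      using i1 i2 by simp
    also have "\<bar>\<dots>\<bar> \<le> (\<integral>x. \<bar>g x - ?i x * g x\<bar> \<partial>Q)" by (rule integral_abs_bound)
    also have "\<dots> \<le> (\<integral>x. B * ?t x \<partial>Q)"
      by (rule integral_mono) (use i1 i2 i3 B B0 sp in \<open>auto simp: indicator_def\<close>)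
    also have "\<dots> = B * measure Q T"
      using T sp sets.sets_into_space[of T Q] by (simp add: Int_absorb2)
    finally show ?thesis .
  qed
  show ?thesis using split[OF M] split[OF N] unfolding dens by (simp add: distrib_left)
qed

lemma density_integral_diff_le:
  fixes \<mu> :: "(real^'n) measure" and g u v :: "real^'n \<Rightarrow> real"
  assumes \<mu>: "\<mu> \<in> sphere_measures" and g: "continuous_on unit_sphere g" and B: "\<And>x. x \<in> unit_sphere \<Longrightarrow> \<bar>g x\<bar> \<le> B"
    and u: "continuous_on unit_sphere u" "\<And>x. x \<in> unit_sphere \<Longrightarrow> 0 \<le> u x"
    and v: "continuous_on unit_sphere v" "\<And>x. x \<in> unit_sphere \<Longrightarrow> 0 \<le> v x"
    and uv: "\<And>x. x \<in> unit_sphere \<Longrightarrow> \<bar>u x - v x\<bar> \<le> e"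
  shows "\<bar>(\<integral>x. g x \<partial>density \<mu> (\<lambda>x. ennreal (u x))) - (\<integral>x. g x \<partial>density \<mu> (\<lambda>x. ennreal (v x)))\<bar>
    \<le> B * e * measure \<mu> unit_sphere"
proof -
  note sp = sphere_measuresD(2,3)[OF \<mu>]
  note m = sphere_measurable_continuous[OF \<mu>]
  have B0: "0 \<le> B" using B[of "axis undefined 1"] by simp
  have d: "(\<integral>x. g x \<partial>density \<mu> (\<lambda>x. ennreal (u x))) = (\<integral>x. u x * g x \<partial>\<mu>)"
    if "continuous_on unit_sphere u" "\<And>x. x \<in> unit_sphere \<Longrightarrow> 0 \<le> u x" for u
    using that m[OF g] m[OF that(1)] by (subst integral_real_density) (auto intro!: AE_I2 simp: sp)
  have i: "integrable \<mu> (\<lambda>x. u x * g x)" if "continuous_on unit_sphere u" for u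
    by (intro sphere_integrable_continuous[OF \<mu>] continuous_intros g that)
  have "\<bar>(\<integral>x. u x * g x \<partial>\<mu>) - (\<integral>x. v x * g x \<partial>\<mu>)\<bar> = \<bar>\<integral>x. u x * g x - v x * g x \<partial>\<mu>\<bar>"
    using i[OF u(1)] i[OF v(1)] by simp
  also have "\<dots> \<le> (\<integral>x. \<bar>u x * g x - v x * g x\<bar> \<partial>\<mu>)" by (rule integral_abs_bound)
  also have "\<dots> \<le> (\<integral>x. B * e \<partial>\<mu>)"
  proof (rule integral_mono)
    fix x assume "x \<in> space \<mu>"
    then have x: "x \<in> unit_sphere" by (simp add: sp)
    have "\<bar>g x\<bar> * \<bar>u x - v x\<bar> \<le> B * e" using B[OF x] uv[OF x] B0 by (intro mult_mono) auto
    moreover have "u x * g x - v x * g x = g x * (u x - v x)" by (simp add: algebra_simps)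
    ultimately show "\<bar>u x * g x - v x * g x\<bar> \<le> B * e" by (simp add: abs_mult)
  next
    interpret finite_measure \<mu> using \<mu> sphere_measuresD by blast
    show "integrable \<mu> (\<lambda>x. B * e)" by simp
  qed (use i[OF u(1)] i[OF v(1)] in auto)
  also have "\<dots> = B * e * measure \<mu> unit_sphere" by (simp add: sp)
  finally show ?thesis using d[OF u] d[OF v] by simp
qed

lemma locally_determined_restrict:
  fixes Z :: "(real^'n) set \<Rightarrow> (real^'n) measure"
  assumes Z: "star_body_map Z" "locally_determined Z"
    and h: "continuous_on unit_sphere h" "\<And>x. x \<in> unit_sphere \<Longrightarrow> 0 \<le> h x"
    and k: "continuous_on unit_sphere k" "\<And>x. x \<in> unit_sphere \<Longrightarrow> 0 \<le> k x"
    and P: "openin (top_of_set unit_sphere) P" "\<And>x. x \<in> P \<Longrightarrow> h x = k x"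
    and A: "A \<in> sets sphere_borel" "A \<subseteq> P"
  shows "emeasure (Z (star_body_of h)) A = emeasure (Z (star_body_of k)) A"
proof (rule sphere_measure_restrict_eq[OF _ _ P(1) _ A])
  show "Z (star_body_of h) \<in> sphere_measures" "Z (star_body_of k) \<in> sphere_measures"
    using Z(1) star_body_star_body_of[of h] star_body_star_body_of[of k] h k
    by (auto simp: star_body_map_def)
  show "emeasure (Z (star_body_of h)) U = emeasure (Z (star_body_of k)) U"
    if "openin (top_of_set unit_sphere) U" "U \<subseteq> P" for U
    using Z(2)[unfolded locally_determined_def, rule_format, of U h k] that h k P(2) by auto
qed

text \<open>Over \<open>P\<close> the function \<open>h\<close> has only the discrete values
  \<open>\<eta> * k\<close>, so \<open>P\<close> falls into countably many relatively open pieces on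
  which \<open>h\<close> is constant. On each piece local determination replaces \<open>h\<close> by
  a constant, where \<open>Z\<close> is known; countable additivity reassembles
  \<open>A\<close>.\<close>

lemma staircase_representation:
  fixes Z :: "(real^'n) set \<Rightarrow> (real^'n) measure"
  assumes Z: "star_body_map Z" "locally_determined Z"
    and \<mu>: "\<mu> \<in> sphere_measures"
    and w: "continuous_on {0..} w" "\<And>t. 0 \<le> t \<Longrightarrow> 0 \<le> w t"
    and const: "\<And>t. 0 \<le> t \<Longrightarrow> Z (star_body_of (\<lambda>_. t)) = scale_measure (ennreal (w t)) \<mu>"
    and h: "continuous_on unit_sphere h" "\<And>x. x \<in> unit_sphere \<Longrightarrow> 0 \<le> h x"
    and P: "openin (top_of_set unit_sphere) P" and \<eta>: "0 < \<eta>"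
    and step: "\<And>x. x \<in> P \<Longrightarrow> \<exists>k::nat. h x = \<eta> * real k"
    and A: "A \<in> sets sphere_borel" "A \<subseteq> P"
  shows "emeasure (Z (star_body_of h)) A = emeasure (density \<mu> (\<lambda>x. ennreal (w (h x)))) A"
proof -
  note sm = sphere_measuresD(2)[OF \<mu>]
  have \<zeta>: "Z (star_body_of h) \<in> sphere_measures"
    using Z(1) star_body_star_body_of[of h] h by (auto simp: star_body_map_def)
  have wh: "continuous_on unit_sphere (\<lambda>x. w (h x))"
    by (rule continuous_on_compose2[OF w(1) h(1)]) (use h in auto)
  \<comment> \<open>An open window of half-width \<open>\<eta> / 2\<close> around
    \<open>\<eta> * k\<close> contains no other value of the grid. It exhibits the level set of
    \<open>h\<close> inside \<open>P\<close> as relatively open.\<close>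
  define Q where "Q k = P \<inter> (unit_sphere \<inter> h -` {\<eta> * (real k - 1/2)<..<\<eta> * (real k + 1/2)})" for k :: nat
  have Qop: "openin (top_of_set unit_sphere) (Q k)" for k
    unfolding Q_def by (intro openin_Int P continuous_openin_preimage_gen[OF h(1)]) auto
  have hQ: "h x = \<eta> * real k" if "x \<in> Q k" for x k
  proof -
    from that obtain m :: nat where m: "h x = \<eta> * real m" using step by (auto simp: Q_def)
    then have "real k - 1/2 < real m" "real m < real k + 1/2"
      using that \<eta> by (auto simp: Q_def)
    then have "m = k" by linarith
    then show ?thesis using m by simp
  qed
  have disj: "disjoint_family (\<lambda>k. A \<inter> Q k)"
    unfolding disjoint_family_on_def
  proof (intro ballI impI)
    fix i j :: nat assume "i \<noteq> j"
    then show "(A \<inter> Q i) \<inter> (A \<inter> Q j) = {}" using hQ[of _ i] hQ[of _ j] \<eta> by fastforce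
  qed
  have PU: "P \<subseteq> unit_sphere" using P by (rule openin_imp_subset)
  have "A \<subseteq> (\<Union>k. Q k)"
  proof
    fix x assume "x \<in> A"
    then have x: "x \<in> P" "x \<in> unit_sphere" using A PU by auto
    then obtain k :: nat where "h x = \<eta> * real k" using step by blast
    then have "x \<in> Q k" using x \<eta> by (auto simp: Q_def)
    then show "x \<in> (\<Union>k. Q k)" by blast
  qed
  then have un: "A \<inter> (\<Union>k. Q k) = A" by blast
  have AQ: "A \<inter> Q k \<in> sets sphere_borel" for k
    using A openin_sphere_sets[OF \<mu> Qop] sm by auto
  have piece: "emeasure (Z (star_body_of h)) (A \<inter> Q k)
      = emeasure (density \<mu> (\<lambda>x. ennreal (w (h x)))) (A \<inter> Q k)" for k
  proof -
    have t: "0 \<le> \<eta> * real k" using \<eta> by simp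
    have "emeasure (Z (star_body_of h)) (A \<inter> Q k) = emeasure (Z (star_body_of (\<lambda>_. \<eta> * real k))) (A \<inter> Q k)"
      by (rule locally_determined_restrict[OF Z h _ _ Qop _ AQ]) (use t hQ in auto)
    also have "\<dots> = ennreal (w (\<eta> * real k)) * emeasure \<mu> (A \<inter> Q k)"
      by (simp add: const[OF t])
    also have "\<dots> = (\<integral>\<^sup>+x. ennreal (w (\<eta> * real k)) * indicator (A \<inter> Q k) x \<partial>\<mu>)"
      using AQ sm by (simp add: nn_integral_cmult_indicator)
    also have "\<dots> = (\<integral>\<^sup>+x. ennreal (w (h x)) * indicator (A \<inter> Q k) x \<partial>\<mu>)"
      by (rule nn_integral_cong) (auto simp: indicator_def hQ)
    also have "\<dots> = emeasure (density \<mu> (\<lambda>x. ennreal (w (h x)))) (A \<inter> Q k)"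
      using AQ sm sphere_measurable_continuous[OF \<mu> wh] by (subst emeasure_density) auto
    finally show ?thesis .
  qed
  have "emeasure (Z (star_body_of h)) A = (\<Sum>k. emeasure (Z (star_body_of h)) (A \<inter> Q k))"
    using AQ disj by (subst suminf_emeasure) (auto simp: un sphere_measuresD(2)[OF \<zeta>])
  also have "\<dots> = (\<Sum>k. emeasure (density \<mu> (\<lambda>x. ennreal (w (h x)))) (A \<inter> Q k))"
    by (simp add: piece)
  also have "\<dots> = emeasure (density \<mu> (\<lambda>x. ennreal (w (h x)))) A"
    using AQ disj by (subst suminf_emeasure) (auto simp: un sm)
  finally show ?thesis .
qed

text \<open>Pigeonhole over \<open>N\<close> shifted staircases. Each \<open>F j\<close> alone
  determines \<open>Z\<close> on its zone \<open>T j\<close>, but one function \<open>h\<close>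
  agrees with all of them on their respective zones. So the masses add up inside
  \<open>Z (star_body_of h)\<close>, and some zone has mass at most \<open>K' / N\<close>.\<close>

lemma small_transition_staircase:
  fixes Z :: "(real^'n) set \<Rightarrow> (real^'n) measure"
  assumes Z: "star_body_map Z" "locally_determined Z"
    and \<mu>: "\<mu> \<in> sphere_measures"
    and f: "continuous_on unit_sphere f" "\<And>x. x \<in> unit_sphere \<Longrightarrow> 0 \<le> f x"
    and \<eta>: "0 < \<eta>" and \<epsilon>: "0 < \<epsilon>"
    and K: "\<And>h. continuous_on unit_sphere h \<Longrightarrow> (\<And>x. x \<in> unit_sphere \<Longrightarrow> 0 \<le> h x) \<Longrightarrow>
      (\<And>x. x \<in> unit_sphere \<Longrightarrow> \<bar>h x - f x\<bar> \<le> \<eta>) \<Longrightarrow> measure (Z (star_body_of h)) unit_sphere \<le> K"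
  shows "\<exists>h T P. continuous_on unit_sphere h \<and> (\<forall>x\<in>unit_sphere. 0 \<le> h x) \<and>
      (\<forall>x\<in>unit_sphere. \<bar>h x - f x\<bar> \<le> \<eta>) \<and> openin (top_of_set unit_sphere) P \<and>
      T \<in> sets sphere_borel \<and> unit_sphere - T \<subseteq> P \<and> (\<forall>x\<in>P. \<exists>k::nat. h x = \<eta> * real k) \<and>
      measure (Z (star_body_of h)) T + measure \<mu> T \<le> \<epsilon>"
proof -
  note sm = sphere_measuresD(2,3)[OF \<mu>]
  have \<zeta>: "Z (star_body_of h) \<in> sphere_measures"
    if "continuous_on unit_sphere h" "\<And>x. x \<in> unit_sphere \<Longrightarrow> 0 \<le> h x" for h
    using Z(1) star_body_star_body_of[of h] that by (auto simp: star_body_map_def)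
  define K' where "K' = K + measure \<mu> unit_sphere"
  obtain N0 :: nat where N0: "K' / \<epsilon> < real N0" using reals_Archimedean2 by blast
  define N where "N = Suc N0"
  have N: "0 < real N" "K' \<le> \<epsilon> * real N" using N0 \<epsilon> by (auto simp: N_def field_simps)
  define y where "y j x = f x / \<eta> - real j / real N" for j :: nat and x
  have cy: "continuous_on unit_sphere (y j)" for j
    unfolding y_def by (intro continuous_intros f) (use \<eta> in auto)
  have cg: "continuous_on unit_sphere (\<lambda>x. grid_dist (y j x))" for j
    by (intro continuous_intros cy)
  \<comment> \<open>Two thresholds leave room for open and closed sets on both sides:
    \<open>unit_sphere - T j\<close> lies in the open \<open>P j\<close>, which lies in the closed
    \<open>C j\<close> where the staircase is prescribed; the open \<open>T j\<close> lies in the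
    closed \<open>D j\<close>, and the \<open>D j\<close> with \<open>j < N\<close> are disjoint.
    Tietze needs the closed sets, local determination the open ones.\<close>
  define C where "C j = unit_sphere \<inter> (\<lambda>x. grid_dist (y j x)) -` {1 / (8 * real N)..}" for j
  define P where "P j = unit_sphere \<inter> (\<lambda>x. grid_dist (y j x)) -` {1 / (8 * real N)<..}" for j
  define D where "D j = unit_sphere \<inter> (\<lambda>x. grid_dist (y j x)) -` {..1 / (4 * real N)}" for j
  define T where "T j = unit_sphere \<inter> (\<lambda>x. grid_dist (y j x)) -` {..<1 / (4 * real N)}" for j
  have C: "closedin (top_of_set unit_sphere) (C j)" and P: "openin (top_of_set unit_sphere) (P j)"
    and Dcl: "closedin (top_of_set unit_sphere) (D j)" and T: "openin (top_of_set unit_sphere) (T j)" for j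
    unfolding C_def P_def D_def T_def
    by (intro continuous_closedin_preimage[OF cg] continuous_openin_preimage_gen[OF cg]; simp)+
  have D: "closed (D j)" for j by (rule closedin_closed_trans[OF Dcl]) simp
  have Dd: "i = j" if "x \<in> D i" "x \<in> D j" "i < N" "j < N" for x i j
    using grid_dist_zones_disjoint[of i N j "f x / \<eta>"] that by (auto simp: D_def y_def)
  \<comment> \<open>The \<open>+ 1\<close> keeps the staircase nonnegative, since
    \<open>y j x > -1\<close>. It also cancels against the shift:
    \<open>\<lfloor>y\<rfloor> + 1 - y\<close> lies between 0 and 1 and so does
    \<open>j / N\<close>, so their difference has absolute value at most 1.\<close>
  define v where "v j x = \<eta> * (of_int \<lfloor>y j x\<rfloor> + 1)" for j x
  have v: "0 \<le> v j x" "\<bar>v j x - f x\<bar> \<le> \<eta>" "\<exists>k::nat. v j x = \<eta> * real k"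
    if "j < N" "x \<in> unit_sphere" for j x
  proof -
    have yx: "real j / real N < 1" "0 \<le> real j / real N" "0 \<le> f x / \<eta>"
      using that f \<eta> by (auto simp: field_simps)
    then have fl: "0 \<le> \<lfloor>y j x\<rfloor> + 1" unfolding y_def by linarith
    then show "0 \<le> v j x" using \<eta> unfolding v_def by (intro mult_nonneg_nonneg) auto
    have "v j x - f x = \<eta> * (of_int \<lfloor>y j x\<rfloor> + 1 - f x / \<eta>)"
      using \<eta> by (simp add: v_def field_simps)
    moreover have "\<bar>of_int \<lfloor>y j x\<rfloor> + 1 - f x / \<eta>\<bar> \<le> 1"
      using yx of_int_floor_le[of "y j x"] floor_correct[of "y j x"] unfolding y_def by linarith
    ultimately show "\<bar>v j x - f x\<bar> \<le> \<eta>" using \<eta> by (simp add: abs_mult mult_left_le)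
    have "v j x = \<eta> * real (nat (\<lfloor>y j x\<rfloor> + 1))" using fl by (simp add: v_def)
    then show "\<exists>k::nat. v j x = \<eta> * real k" by blast
  qed
  have cv: "continuous_on (C j) (v j)" for j
  proof -
    \<comment> \<open>The floor function is continuous off the integers, and \<open>C j\<close>
      keeps \<open>y j\<close> at distance at least \<open>1 / (8 * N)\<close> from them.\<close>
    have "y j ` C j \<subseteq> UNIV - \<int>"
    proof clarsimp
      fix x assume x: "x \<in> C j" "y j x \<in> \<int>"
      then obtain m where "y j x = of_int m" by (auto elim: Ints_cases)
      then have "grid_dist (y j x) = 0" by (simp add: grid_dist_def)
      moreover have "1 / (8 * real N) \<le> grid_dist (y j x)" using x by (simp add: C_def)
      ultimately show False using N by (simp add: field_simps)
    qed
    then have "continuous_on (C j) (\<lambda>x. of_int \<lfloor>y j x\<rfloor> :: real)"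
      by (intro continuous_on_compose2[OF continuous_on_of_int_floor] continuous_on_subset[OF cy]) (auto simp: C_def)
    then show ?thesis
      unfolding v_def by (intro continuous_on_mult_left continuous_on_add continuous_on_const)
  qed
  have "\<exists>h. continuous_on unit_sphere h \<and> (\<forall>x\<in>unit_sphere. 0 \<le> h x \<and> \<bar>h x - f x\<bar> \<le> \<eta>) \<and>
      (\<forall>x\<in>C j. h x = v j x)" if j: "j < N" for j
  proof -
    have "continuous_on (C j) (\<lambda>x. v j x - f x)"
      by (intro continuous_intros cv continuous_on_subset[OF f(1)]) (auto simp: C_def)
    then obtain e where e: "continuous_on unit_sphere e" "\<And>x. x \<in> C j \<Longrightarrow> e x = v j x - f x"
      "\<And>x. x \<in> unit_sphere \<Longrightarrow> norm (e x) \<le> \<eta>"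
      by (rule Tietze[OF _ C, where B=\<eta>]) (use \<eta> v(2)[OF j] in \<open>auto simp: C_def\<close>)
    \<comment> \<open>Truncation at 0 restores nonnegativity and, as \<open>f\<close> is
      nonnegative, does not move the function further from \<open>f\<close>.\<close>
    have "\<bar>max 0 (f x + e x) - f x\<bar> \<le> \<eta>" if "x \<in> unit_sphere" for x
      using e(3)[OF that] f(2)[OF that] by (auto simp: max_def)
    then show ?thesis
      using e v(1)[OF j] by (intro exI[of _ "\<lambda>x. max 0 (f x + e x)"])
        (auto simp: C_def intro!: continuous_intros f)
  qed
  then have "\<forall>j. \<exists>h. j < N \<longrightarrow> continuous_on unit_sphere h \<and>
      (\<forall>x\<in>unit_sphere. 0 \<le> h x \<and> \<bar>h x - f x\<bar> \<le> \<eta>) \<and> (\<forall>x\<in>C j. h x = v j x)" by blast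
  from choice[OF this] obtain F where F': "\<forall>j<N. continuous_on unit_sphere (F j) \<and>
      (\<forall>x\<in>unit_sphere. 0 \<le> F j x \<and> \<bar>F j x - f x\<bar> \<le> \<eta>) \<and> (\<forall>x\<in>C j. F j x = v j x)" ..
  have F: "continuous_on unit_sphere (F j)" "x \<in> unit_sphere \<Longrightarrow> 0 \<le> F j x"
      "x \<in> unit_sphere \<Longrightarrow> \<bar>F j x - f x\<bar> \<le> \<eta>" "x \<in> C j \<Longrightarrow> F j x = v j x" if "j < N" for j x
    using F' that by auto
  \<comment> \<open>Disjointness of the zones makes the index unique. On a finite union of closed
    sets, continuity on each of them suffices.\<close>
  define u where "u x = F (THE j. j < N \<and> x \<in> D j) x - f x" for x
  have u: "u x = F j x - f x" if "j < N" "x \<in> D j" for j x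
  proof -
    have "(THE j. j < N \<and> x \<in> D j) = j" using that Dd by (intro the_equality) auto
    then show ?thesis by (simp add: u_def)
  qed
  have "continuous_on (\<Union>j\<in>{..<N}. D j) u"
  proof (rule continuous_on_closed_Union)
    fix j assume j: "j \<in> {..<N}"
    have "continuous_on (D j) (\<lambda>x. F j x - f x)"
      using j by (intro continuous_intros continuous_on_subset[OF f(1)] continuous_on_subset[OF F(1)]) (auto simp: D_def)
    then show "continuous_on (D j) u" by (rule continuous_on_eq) (use j u in auto)
  qed (use D in auto)
  moreover have "closedin (top_of_set unit_sphere) (\<Union>j\<in>{..<N}. D j)"
    using Dcl by (intro closedin_Union) auto
  ultimately obtain e where e: "continuous_on unit_sphere e" "\<And>x. x \<in> (\<Union>j\<in>{..<N}. D j) \<Longrightarrow> e x = u x"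
      "\<And>x. x \<in> unit_sphere \<Longrightarrow> norm (e x) \<le> \<eta>"
    by (rule Tietze[where B=\<eta>]) (use \<eta> u F(3) in \<open>auto simp: D_def\<close>)
  define h where "h x = max 0 (f x + e x)" for x
  have h: "continuous_on unit_sphere h" "\<And>x. x \<in> unit_sphere \<Longrightarrow> 0 \<le> h x"
      "\<And>x. x \<in> unit_sphere \<Longrightarrow> \<bar>h x - f x\<bar> \<le> \<eta>"
  proof -
    show "continuous_on unit_sphere h" unfolding h_def by (intro continuous_intros f e)
    show "\<bar>h x - f x\<bar> \<le> \<eta>" if "x \<in> unit_sphere" for x
      using e(3)[OF that] f(2)[OF that] by (auto simp: h_def max_def)
  qed (simp add: h_def)
  have hF: "h x = F j x" if "j < N" "x \<in> T j" for j x
  proof -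
    have "x \<in> D j" "x \<in> unit_sphere" using that(2) by (auto simp: T_def D_def)
    moreover from this have "e x = u x" using that(1) by (intro e(2)) blast
    ultimately show ?thesis using u[of j x] F(2)[of j x] that(1) by (simp add: h_def)
  qed
  have Ts: "T j \<in> sets sphere_borel" for j
    using openin_sphere_sets[OF \<mu> T] sm by simp
  have disj: "disjoint_family_on T {..<N}"
    using Dd unfolding disjoint_family_on_def by (force simp: T_def D_def)
  have sum_le: "(\<Sum>j<N. measure M (T j)) \<le> measure M unit_sphere" if M: "M \<in> sphere_measures" for M
  proof -
    interpret finite_measure M using M sphere_measuresD by blast
    have "(\<Sum>j<N. measure M (T j)) = measure M (\<Union>j<N. T j)"
      using Ts disj sphere_measuresD(2)[OF M] by (intro finite_measure_finite_Union[symmetric]) auto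
    also have "\<dots> \<le> measure M (space M)" by (rule bounded_measure)
    finally show ?thesis by (simp add: sphere_measuresD(3)[OF M])
  qed
  \<comment> \<open>Local determination on the open zone transfers the mass of each
    \<open>F j\<close> to the single measure of \<open>h\<close>, whose total mass is bounded by
    \<open>K\<close> whatever \<open>N\<close> is.\<close>
  have loc: "measure (Z (star_body_of (F j))) (T j) = measure (Z (star_body_of h)) (T j)" if j: "j < N" for j
    using locally_determined_restrict[OF Z F(1,2)[OF j] h(1,2) T _ Ts order_refl] hF[OF j]
    by (simp add: measure_def)
  have "(\<Sum>j<N. measure (Z (star_body_of (F j))) (T j) + measure \<mu> (T j)) \<le> K'"
    using sum_le[OF \<mu>] sum_le[OF \<zeta>[OF h(1,2)]] K[OF h] by (simp add: sum.distrib loc K'_def)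
  also have "\<dots> \<le> (\<Sum>j<N. \<epsilon>)" using N by (simp add: mult.commute)
  finally have "\<exists>j<N. measure (Z (star_body_of (F j))) (T j) + measure \<mu> (T j) \<le> \<epsilon>"
    using sum_strict_mono[of "{..<N}" "\<lambda>_. \<epsilon>" "\<lambda>j. measure (Z (star_body_of (F j))) (T j) + measure \<mu> (T j)"] N
    by (force simp: not_le)
  then obtain j where j: "j < N" "measure (Z (star_body_of (F j))) (T j) + measure \<mu> (T j) \<le> \<epsilon>" by blast
  show ?thesis
  proof (rule exI[of _ "F j"], rule exI[of _ "T j"], rule exI[of _ "P j"], intro conjI ballI)
    show "unit_sphere - T j \<subseteq> P j"
    proof
      fix x assume x: "x \<in> unit_sphere - T j"
      have "1 / (8 * real N) < 1 / (4 * real N)" using N by (simp add: field_simps)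
      then show "x \<in> P j" using x by (auto simp: T_def P_def)
    qed
    show "\<exists>k::nat. F j x = \<eta> * real k" if "x \<in> P j" for x
    proof -
      have "x \<in> C j" "x \<in> unit_sphere" using that by (auto simp: P_def C_def)
      then show ?thesis using F(4)[OF j(1)] v(3)[OF j(1)] by simp
    qed
  qed (use F j P Ts in auto)
qed

section \<open>Passage from staircases to arbitrary radial functions\<close>

lemma star_body_map_measures:
  fixes Z :: "(real^'n) set \<Rightarrow> (real^'n) measure"
  assumes "star_body_map Z" "continuous_on unit_sphere f" "\<And>x. x \<in> unit_sphere \<Longrightarrow> 0 \<le> f x"
  shows "Z (star_body_of f) \<in> sphere_measures"
  using assms star_body_star_body_of[of f] by (auto simp: star_body_map_def)

lemma weak_star_continuous_at:
  fixes Z :: "(real^'n) set \<Rightarrow> (real^'n) measure" and g :: "real^'n \<Rightarrow> real"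
  assumes "weak_star_continuous Z" "continuous_on unit_sphere g"
    and f: "continuous_on unit_sphere f" "\<And>x. x \<in> unit_sphere \<Longrightarrow> 0 \<le> f x" and e: "0 < e"
  obtains d where "0 < d" "\<And>h. continuous_on unit_sphere h \<Longrightarrow> (\<And>x. x \<in> unit_sphere \<Longrightarrow> 0 \<le> h x) \<Longrightarrow>
      (\<And>x. x \<in> unit_sphere \<Longrightarrow> \<bar>h x - f x\<bar> \<le> d) \<Longrightarrow>
      \<bar>(\<integral>x. g x \<partial>Z (star_body_of h)) - (\<integral>x. g x \<partial>Z (star_body_of f))\<bar> < e"
proof -
  obtain d where d: "0 < d" "\<And>L. star_body L \<Longrightarrow> radial_dist L (star_body_of f) < d \<Longrightarrow>
      \<bar>(\<integral>x. g x \<partial>Z L) - (\<integral>x. g x \<partial>Z (star_body_of f))\<bar> < e"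
    using assms(1)[unfolded weak_star_continuous_def, rule_format, OF assms(2) star_body_star_body_of[OF f(2) f(1)] e]
    by blast
  show thesis
  proof (rule that[of "d / 2"])
    fix h :: "real^'n \<Rightarrow> real"
    assume h: "continuous_on unit_sphere h" "\<And>x. x \<in> unit_sphere \<Longrightarrow> 0 \<le> h x"
      "\<And>x. x \<in> unit_sphere \<Longrightarrow> \<bar>h x - f x\<bar> \<le> d / 2"
    have "radial_dist (star_body_of h) (star_body_of f) \<le> d / 2"
      by (rule radial_dist_star_body_of_le[OF f(2) h(2) h(3)])
    then show "\<bar>(\<integral>x. g x \<partial>Z (star_body_of h)) - (\<integral>x. g x \<partial>Z (star_body_of f))\<bar> < e"
      using d by (intro d(2) star_body_star_body_of[OF h(2) h(1)]) auto
  qed (use d in simp)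
qed

lemma uniformly_close_composition:
  fixes w :: "real \<Rightarrow> real"
  assumes w: "continuous_on {0..} w" and M: "0 \<le> M" and e: "0 < e"
  obtains d where "0 < d" "d \<le> 1"
    "\<And>s t. 0 \<le> s \<Longrightarrow> s \<le> M \<Longrightarrow> 0 \<le> t \<Longrightarrow> \<bar>t - s\<bar> \<le> d \<Longrightarrow> \<bar>w t - w s\<bar> \<le> e"
proof -
  \<comment> \<open>The extra unit keeps \<open>t\<close> in the compact interval once
    \<open>d \<le> 1\<close>.\<close>
  have "uniformly_continuous_on {0..M + 1} w"
    by (rule compact_uniformly_continuous[OF continuous_on_subset[OF w]]) auto
  then obtain d where d: "0 < d" "\<And>s t. s \<in> {0..M + 1} \<Longrightarrow> t \<in> {0..M + 1} \<Longrightarrow> dist t s < d \<Longrightarrow> dist (w t) (w s) < e"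
    using e unfolding uniformly_continuous_on_def by metis
  show thesis
  proof (rule that[of "min 1 (d / 2)"])
    fix s t assume "0 \<le> s" "s \<le> M" "0 \<le> t" "\<bar>t - s\<bar> \<le> min 1 (d / 2)"
    then have "dist (w t) (w s) < e" using d(1) by (intro d(2)) (auto simp: dist_real_def)
    then show "\<bar>w t - w s\<bar> \<le> e" by (simp add: dist_real_def)
  qed (use d in auto)
qed

text \<open>For every test function, three errors separate the two sides: weak* continuity from
  \<open>f\<close> to a staircase \<open>h\<close>, the transition zone of \<open>h\<close>, and the
  change of \<open>w\<close> from \<open>h\<close> back to \<open>f\<close>. Each is a fixed
  multiple of an arbitrary \<open>\<epsilon>\<close>.\<close>

theorem local_functional_representation:
  fixes Z :: "(real^'n) set \<Rightarrow> (real^'n) measure"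
  assumes Z: "star_body_map Z" "locally_determined Z" "weak_star_continuous Z"
    and \<mu>: "\<mu> \<in> sphere_measures"
    and w: "continuous_on {0..} w" "\<And>t. 0 \<le> t \<Longrightarrow> 0 \<le> w t"
    and const: "\<And>t. 0 \<le> t \<Longrightarrow> Z (star_body_of (\<lambda>_. t)) = scale_measure (ennreal (w t)) \<mu>"
    and f: "continuous_on unit_sphere f" "\<And>x. x \<in> unit_sphere \<Longrightarrow> 0 \<le> f x"
  shows "Z (star_body_of f) = density \<mu> (\<lambda>x. ennreal (w (f x)))"
proof -
  have wf: "continuous_on unit_sphere (\<lambda>x. w (h x))"
    if "continuous_on unit_sphere h" "\<And>x. x \<in> unit_sphere \<Longrightarrow> 0 \<le> h x" for h :: "real^'n \<Rightarrow> real"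
    by (rule continuous_on_compose2[OF w(1) that(1)]) (use that in auto)
  have dens: "density \<mu> (\<lambda>x. ennreal (w (h x))) \<in> sphere_measures"
    if "continuous_on unit_sphere h" "\<And>x. x \<in> unit_sphere \<Longrightarrow> 0 \<le> h x" for h :: "real^'n \<Rightarrow> real"
    by (rule sphere_measures_density[OF \<mu> wf[OF that]]) (use that w in auto)
  note \<zeta> = star_body_map_measures[OF Z(1)]
  obtain M where M: "0 < M" "\<And>x. x \<in> unit_sphere \<Longrightarrow> \<bar>f x\<bar> \<le> M"
    using sphere_continuous_bounded[OF f(1)] by blast
  have "compact (w ` {0..M + 1})"
    by (intro compact_continuous_image continuous_on_subset[OF w(1)]) auto
  then have "bounded (w ` {0..M + 1})" by (rule compact_imp_bounded)
  then obtain W where W: "0 < W" "\<And>t. 0 \<le> t \<Longrightarrow> t \<le> M + 1 \<Longrightarrow> \<bar>w t\<bar> \<le> W"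
    unfolding bounded_pos by auto
  define K where "K = measure (Z (star_body_of f)) unit_sphere + 1"
  show ?thesis
  proof (rule sphere_measure_eqI_integral[OF \<zeta>[OF f] dens[OF f]])
    fix g :: "real^'n \<Rightarrow> real" assume g: "continuous_on unit_sphere g"
    obtain B where B: "0 < B" "\<And>x. x \<in> unit_sphere \<Longrightarrow> \<bar>g x\<bar> \<le> B"
      using sphere_continuous_bounded[OF g] by blast
    define I J where "I = (\<integral>x. g x \<partial>Z (star_body_of f))" and "J = (\<integral>x. g x \<partial>density \<mu> (\<lambda>x. ennreal (w (f x))))"
    \<comment> \<open>One summand for each error: weak* continuity, the zone (of mass at most
      \<open>\<epsilon>\<close> for \<open>Z\<close> and \<open>W * \<epsilon>\<close> for the
      density), and the uniform closeness of \<open>w (h x)\<close> to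
      \<open>w (f x)\<close>.\<close>
    define R where "R = 1 + B * (1 + W) + B * measure \<mu> unit_sphere"
    have R: "0 < R" using B W by (auto simp: R_def intro!: add_pos_nonneg mult_nonneg_nonneg)
    have close: "\<bar>I - J\<bar> \<le> R * \<epsilon>" if \<epsilon>: "0 < \<epsilon>" for \<epsilon>
    proof -
      obtain d1 where d1: "0 < d1" "d1 \<le> 1"
          "\<And>s t. 0 \<le> s \<Longrightarrow> s \<le> M \<Longrightarrow> 0 \<le> t \<Longrightarrow> \<bar>t - s\<bar> \<le> d1 \<Longrightarrow> \<bar>w t - w s\<bar> \<le> \<epsilon>"
        using uniformly_close_composition[OF w(1) less_imp_le[OF M(1)] \<epsilon>] by blast
      obtain d2 where d2: "0 < d2" "\<And>h. continuous_on unit_sphere h \<Longrightarrow> (\<And>x. x \<in> unit_sphere \<Longrightarrow> 0 \<le> h x) \<Longrightarrow>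
          (\<And>x. x \<in> unit_sphere \<Longrightarrow> \<bar>h x - f x\<bar> \<le> d2) \<Longrightarrow> \<bar>(\<integral>x. g x \<partial>Z (star_body_of h)) - I\<bar> < \<epsilon>"
        using weak_star_continuous_at[OF Z(3) g f \<epsilon>] unfolding I_def by blast
      \<comment> \<open>Testing with the constant 1 controls total masses near \<open>f\<close>;
        this is the bound \<open>K\<close> that does not depend on the number of staircases.\<close>
      obtain d3 where d3: "0 < d3" "\<And>h. continuous_on unit_sphere h \<Longrightarrow> (\<And>x. x \<in> unit_sphere \<Longrightarrow> 0 \<le> h x) \<Longrightarrow>
          (\<And>x. x \<in> unit_sphere \<Longrightarrow> \<bar>h x - f x\<bar> \<le> d3) \<Longrightarrow>
          \<bar>(\<integral>x. 1 \<partial>Z (star_body_of h)) - (\<integral>x. 1 \<partial>Z (star_body_of f))\<bar> < (1::real)"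
        using weak_star_continuous_at[OF Z(3), of "\<lambda>_. 1", OF _ f] by (metis continuous_on_const zero_less_one)
      define \<eta> where "\<eta> = min d1 (min d2 d3)"
      have \<eta>: "0 < \<eta>" "\<eta> \<le> d1" "\<eta> \<le> d2" "\<eta> \<le> d3" using d1 d2 d3 by (auto simp: \<eta>_def)
      have K: "measure (Z (star_body_of h)) unit_sphere \<le> K"
        if h: "continuous_on unit_sphere h" "\<And>x. x \<in> unit_sphere \<Longrightarrow> 0 \<le> h x"
          "\<And>x. x \<in> unit_sphere \<Longrightarrow> \<bar>h x - f x\<bar> \<le> \<eta>" for h
      proof -
        have "\<bar>(\<integral>x. 1 \<partial>Z (star_body_of h)) - (\<integral>x. 1 \<partial>Z (star_body_of f))\<bar> < (1::real)"
          by (rule d3(2)[OF h(1,2)]) (use h(3) \<eta>(4) order_trans in blast)+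
        then show ?thesis
          using sphere_measuresD(3)[OF \<zeta>[OF f]] sphere_measuresD(3)[OF \<zeta>[OF h(1,2)]] by (simp add: K_def)
      qed
      have "\<exists>h T P. continuous_on unit_sphere h \<and> (\<forall>x\<in>unit_sphere. 0 \<le> h x) \<and>
        (\<forall>x\<in>unit_sphere. \<bar>h x - f x\<bar> \<le> \<eta>) \<and> openin (top_of_set unit_sphere) P \<and>
        T \<in> sets sphere_borel \<and> unit_sphere - T \<subseteq> P \<and> (\<forall>x\<in>P. \<exists>k::nat. h x = \<eta> * real k) \<and>
        measure (Z (star_body_of h)) T + measure \<mu> T \<le> \<epsilon>"
        by (rule small_transition_staircase[OF Z(1,2) \<mu> f \<eta>(1) \<epsilon>]) (assumption, fact K)
      then obtain h T P where hTP: "continuous_on unit_sphere h \<and> (\<forall>x\<in>unit_sphere. 0 \<le> h x) \<and>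
        (\<forall>x\<in>unit_sphere. \<bar>h x - f x\<bar> \<le> \<eta>) \<and> openin (top_of_set unit_sphere) P \<and>
        T \<in> sets sphere_borel \<and> unit_sphere - T \<subseteq> P \<and> (\<forall>x\<in>P. \<exists>k::nat. h x = \<eta> * real k) \<and>
        measure (Z (star_body_of h)) T + measure \<mu> T \<le> \<epsilon>"
        by (elim exE)
      have h: "continuous_on unit_sphere h" "\<And>x. x \<in> unit_sphere \<Longrightarrow> 0 \<le> h x"
          "\<And>x. x \<in> unit_sphere \<Longrightarrow> \<bar>h x - f x\<bar> \<le> \<eta>"
        and P: "openin (top_of_set unit_sphere) P" and T: "T \<in> sets sphere_borel" and PT: "unit_sphere - T \<subseteq> P"
        and step: "\<And>x. x \<in> P \<Longrightarrow> \<exists>k::nat. h x = \<eta> * real k"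
        and small: "measure (Z (star_body_of h)) T + measure \<mu> T \<le> \<epsilon>"
        using hTP by simp_all
      have hM: "h x \<le> M + 1" if "x \<in> unit_sphere" for x
        using h(3)[OF that] M(2)[OF that] \<eta>(2) d1(2) by linarith
      have 1: "\<bar>(\<integral>x. g x \<partial>Z (star_body_of h)) - I\<bar> \<le> \<epsilon>"
        by (rule less_imp_le, rule d2(2)[OF h(1,2)]) (use h(3) \<eta>(3) order_trans in blast)+
      have "\<bar>(\<integral>x. g x \<partial>Z (star_body_of h)) - (\<integral>x. g x \<partial>density \<mu> (\<lambda>x. ennreal (w (h x))))\<bar>
          \<le> B * (measure (Z (star_body_of h)) T + measure (density \<mu> (\<lambda>x. ennreal (w (h x)))) T)"
      proof (rule integral_diff_le_of_agree[OF \<zeta>[OF h(1,2)] dens[OF h(1,2)] T _ g B(2)])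
        fix A assume "A \<in> sets sphere_borel" "A \<subseteq> unit_sphere - T"
        then show "emeasure (Z (star_body_of h)) A = emeasure (density \<mu> (\<lambda>x. ennreal (w (h x)))) A"
          using PT by (intro staircase_representation[OF Z(1,2) \<mu> w const h(1,2) P \<eta>(1) step]) auto
      qed auto
      also have "measure (density \<mu> (\<lambda>x. ennreal (w (h x)))) T \<le> W * measure \<mu> T"
      proof -
        interpret finite_measure \<mu> using \<mu> sphere_measuresD by blast
        have "emeasure (density \<mu> (\<lambda>x. ennreal (w (h x)))) T = (\<integral>\<^sup>+x. ennreal (w (h x)) * indicator T x \<partial>\<mu>)"
          using T sphere_measuresD(2)[OF \<mu>] sphere_measurable_continuous[OF \<mu> wf[OF h(1,2)]]
          by (subst emeasure_density) auto
        also have "\<dots> \<le> (\<integral>\<^sup>+x. ennreal W * indicator T x \<partial>\<mu>)"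
        proof (rule nn_integral_mono)
          fix x assume "x \<in> space \<mu>"
          then have x: "x \<in> unit_sphere" by (simp add: sphere_measuresD(3)[OF \<mu>])
          have "w (h x) \<le> W" using W(2)[OF h(2)[OF x] hM[OF x]] by linarith
          then show "ennreal (w (h x)) * indicator T x \<le> ennreal W * indicator T x"
            by (intro mult_right_mono ennreal_leI) auto
        qed
        also have "\<dots> = ennreal (W * measure \<mu> T)"
          using T sphere_measuresD(2)[OF \<mu>] W(1)
          by (simp add: nn_integral_cmult_indicator emeasure_eq_measure ennreal_mult)
        finally show ?thesis
          using W(1) unfolding measure_def by (intro enn2real_leI) auto
      qed
      also have "B * (measure (Z (star_body_of h)) T + W * measure \<mu> T) \<le> B * ((1 + W) * \<epsilon>)"
      proof (rule mult_left_mono)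
        have "W * measure \<mu> T \<le> W * \<epsilon>" "measure (Z (star_body_of h)) T \<le> \<epsilon>"
          using small W(1) measure_nonneg[of \<mu> T] measure_nonneg[of "Z (star_body_of h)" T]
          by (auto intro!: mult_left_mono simp del: measure_nonneg)
        then show "measure (Z (star_body_of h)) T + W * measure \<mu> T \<le> (1 + W) * \<epsilon>"
          by (simp add: distrib_right)
      qed (use B in simp)
      finally have 2: "\<bar>(\<integral>x. g x \<partial>Z (star_body_of h)) - (\<integral>x. g x \<partial>density \<mu> (\<lambda>x. ennreal (w (h x))))\<bar>
          \<le> B * ((1 + W) * \<epsilon>)" using B by (simp add: mult_left_mono)
      have 3: "\<bar>(\<integral>x. g x \<partial>density \<mu> (\<lambda>x. ennreal (w (h x)))) - J\<bar> \<le> B * \<epsilon> * measure \<mu> unit_sphere"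
        unfolding J_def
      proof (rule density_integral_diff_le[OF \<mu> g B(2) wf[OF h(1,2)] _ wf[OF f]])
        show "\<bar>w (h x) - w (f x)\<bar> \<le> \<epsilon>" if "x \<in> unit_sphere" for x
          using h(2,3)[OF that] f(2)[OF that] M(2)[OF that] \<eta>(2) by (intro d1(3)) auto
      qed (use h f w in auto)
      from 1 2 3 show ?thesis by (simp add: R_def algebra_simps abs_le_iff)
    qed
    have "\<bar>I - J\<bar> \<le> 0 + e" if "0 < e" for e
      using close[of "e / R"] that R by simp
    then have "\<bar>I - J\<bar> \<le> 0" by (rule field_le_epsilon)
    then show "I = J" by simp
  qed
qed

section \<open>Rotation equivariance and homogeneity\<close>

definition sphere_area :: "(real^'n) measure" where
  "sphere_area = restrict_space (hausdorff_measure (CARD('n) - 1)) unit_sphere"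

lemma sets_sphere_area: "sets (sphere_area :: (real^'n) measure) = sets sphere_borel"
  unfolding sphere_area_def by (rule sets_restrict_space_cong) simp

lemma emeasure_sphere_area:
  assumes "A \<in> sets sphere_borel"
  shows "emeasure (sphere_area :: (real^'n) measure) A = hausdorff_outer (CARD('n) - 1) A"
proof -
  have A: "A \<subseteq> unit_sphere" "A \<in> sets borel"
    using assms by (auto simp: sets_restrict_space)
  then show ?thesis
    unfolding sphere_area_def by (simp add: emeasure_restrict_space emeasure_hausdorff_measure)
qed

lemma sphere_area_measures: "(sphere_area :: (real^'n) measure) \<in> sphere_measures"
proof -
  have "space (sphere_area :: (real^'n) measure) = unit_sphere"
    by (simp add: sphere_area_def space_restrict_space)
  moreover have "unit_sphere \<in> sets (sphere_borel :: (real^'n) measure)"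
    by (metis sets.top space_restrict_space space_borel Int_UNIV_right)
  ultimately have "emeasure (sphere_area :: (real^'n) measure) (space sphere_area) < top"
    using hausdorff_outer_sphere_finite[where 'n='n] by (simp add: emeasure_sphere_area)
  then show ?thesis by (auto simp: sphere_measures_def sets_sphere_area intro!: finite_measureI)
qed

lemma sphere_area_pos: "0 < measure (sphere_area :: (real^'n) measure) unit_sphere"
proof -
  have "unit_sphere \<in> sets (sphere_borel :: (real^'n) measure)"
    by (metis sets.top space_restrict_space space_borel Int_UNIV_right)
  then have "0 < emeasure (sphere_area :: (real^'n) measure) unit_sphere"
    using hausdorff_outer_sphere_pos[where 'n='n] by (simp add: emeasure_sphere_area)
  then show ?thesis
    using finite_measure.emeasure_eq_measure[OF sphere_measuresD(1)[OF sphere_area_measures]]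
    by (metis ennreal_less_zero_iff)
qed

lemma integral_sphere_area_orthogonal:
  fixes g :: "real^'n \<Rightarrow> real"
  assumes \<phi>: "orthogonal_transformation (\<phi> :: real^'n \<Rightarrow> real^'n)" and g: "continuous_on unit_sphere g"
  shows "(\<integral>x. g (\<phi> x) \<partial>sphere_area) = (\<integral>x. g x \<partial>sphere_area)"
proof -
  let ?\<sigma> = "sphere_area :: (real^'n) measure"
  note sp = sphere_measuresD(2,3)[OF sphere_area_measures]
  have iso: "dist (\<phi> x) (\<phi> y) = dist x y" "dist (inv \<phi> x) (inv \<phi> y) = dist x y" for x y
    using \<phi> orthogonal_inv(1)[OF \<phi>] by (auto simp: orthogonal_transformation_isometry)
  have "\<phi> \<in> borel \<rightarrow>\<^sub>M borel"
    by (rule borel_measurable_continuous_onI) (rule orthogonal_inv(6)[OF \<phi>])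
  then have m: "\<phi> \<in> ?\<sigma> \<rightarrow>\<^sub>M ?\<sigma>"
    using \<phi> by (subst measurable_cong_sets[OF sp(1) sp(1)])
      (auto intro!: measurable_restrict_space3 simp: orthogonal_transformation_norm)
  have "distr ?\<sigma> ?\<sigma> \<phi> = ?\<sigma>"
  proof (rule measure_eqI)
    fix A assume "A \<in> sets (distr ?\<sigma> ?\<sigma> \<phi>)"
    then have A: "A \<in> sets ?\<sigma>" by simp
    then have AU: "A \<subseteq> unit_sphere" using sets.sets_into_space sp(2) by blast
    have im: "\<phi> -` A \<inter> space ?\<sigma> = inv \<phi> ` A" "A = \<phi> ` (inv \<phi> ` A)"
      using AU orthogonal_inv[OF \<phi>] \<phi>
      by (auto simp: sp(2) image_iff orthogonal_transformation_norm) metis+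
    have pre: "\<phi> -` A \<inter> space ?\<sigma> \<in> sets sphere_borel"
      using measurable_sets[OF m A] by (simp add: sp(1))
    have "emeasure (distr ?\<sigma> ?\<sigma> \<phi>) A = hausdorff_outer (CARD('n) - 1) (inv \<phi> ` A)"
      using m A pre by (simp add: emeasure_distr emeasure_sphere_area im(1))
    also have "\<dots> = hausdorff_outer (CARD('n) - 1) A"
    proof (rule antisym)
      show "hausdorff_outer (CARD('n) - 1) (inv \<phi> ` A) \<le> hausdorff_outer (CARD('n) - 1) A"
        by (rule hausdorff_outer_isometry_le) (rule iso)
      have "hausdorff_outer (CARD('n) - 1) (\<phi> ` (inv \<phi> ` A)) \<le> hausdorff_outer (CARD('n) - 1) (inv \<phi> ` A)"
        by (rule hausdorff_outer_isometry_le) (rule iso)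
      then show "hausdorff_outer (CARD('n) - 1) A \<le> hausdorff_outer (CARD('n) - 1) (inv \<phi> ` A)"
        using im(2) by simp
    qed
    also have "\<dots> = emeasure ?\<sigma> A" using A by (simp add: emeasure_sphere_area sp(1))
    finally show "emeasure (distr ?\<sigma> ?\<sigma> \<phi>) A = emeasure ?\<sigma> A" .
  qed simp
  then have "(\<integral>x. g x \<partial>?\<sigma>) = (\<integral>x. g x \<partial>distr ?\<sigma> ?\<sigma> \<phi>)" by simp
  also have "\<dots> = (\<integral>x. g (\<phi> x) \<partial>?\<sigma>)"
    by (rule integral_distr[OF m sphere_measurable_continuous[OF sphere_area_measures g]])
  finally show ?thesis by simp
qed

lemma dual_area_measure_eq:
  "dual_area_measure q L = scale_measure (ennreal (1 / real CARD('n)))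
     (density sphere_area (\<lambda>s. ext_powr (radial (L :: (real^'n) set) s) q))"
  by (simp add: dual_area_measure_def sphere_area_def)

text \<open>The case distinction is needed because \<open>0 powr 0 = 0\<close>.\<close>

definition powr_weight :: "real \<Rightarrow> real \<Rightarrow> real" where
  "powr_weight q t = (if q = 0 then 1 else t powr q)"

lemma ext_powr_eq: "0 \<le> q \<Longrightarrow> 0 \<le> t \<Longrightarrow> ext_powr t q = ennreal (powr_weight q t)"
  by (auto simp: ext_powr_def powr_weight_def)

lemma powr_weight_nonneg: "0 \<le> powr_weight q t"
  by (simp add: powr_weight_def)

lemma continuous_on_powr_weight: "0 \<le> q \<Longrightarrow> continuous_on {0..} (powr_weight q)"
  unfolding powr_weight_def
  by (cases "q = 0") (auto intro!: continuous_on_powr' continuous_on_id continuous_on_const)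

lemma powr_weight_mult: "0 < l \<Longrightarrow> 0 \<le> t \<Longrightarrow> powr_weight q (l * t) = l powr q * powr_weight q t"
  by (simp add: powr_weight_def powr_mult)

text \<open>Along positive \<open>t\<close> the value \<open>t powr 0\<close> is 1, so for
  \<open>q = 0\<close> continuity at the zero body forces exactly the convention
  \<open>0^0 = 1\<close> built into \<open>powr_weight\<close>.\<close>

lemma tendsto_powr_weight_0:
  assumes "0 \<le> q"
  shows "((\<lambda>t. t powr q) \<longlongrightarrow> powr_weight q 0) (at_right 0)"
proof (cases "q = 0")
  case True
  have "((\<lambda>t::real. t powr q) \<longlongrightarrow> 1) (at_right 0)"
    by (rule tendsto_eventually) (auto simp: True eventually_at_right_field intro!: exI[of _ 1])
  then show ?thesis by (simp add: True powr_weight_def)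
next
  case False
  then have "continuous_on {0::real..} (\<lambda>t. t powr q)"
    using assms by (intro continuous_on_powr' continuous_intros) auto
  then have "((\<lambda>t. t powr q) \<longlongrightarrow> 0 powr q) (at 0 within {0..})"
    unfolding continuous_on_def by blast
  then have "((\<lambda>t. t powr q) \<longlongrightarrow> 0 powr q) (at_right 0)"
    by (rule tendsto_within_subset) auto
  then show ?thesis using False by (simp add: powr_weight_def)
qed

text \<open>A general weight \<open>W\<close> serves both nonnegative powers and
  \<open>W = 0\<close>, the only possibility for negative \<open>q\<close>. The valuation property
  is pointwise: maximum and minimum of two radial values are those values in some order.\<close>

lemma weighted_area_properties:
  fixes Z :: "(real^'n) set \<Rightarrow> (real^'n) measure"
  assumes W: "continuous_on {0..} W" "\<And>t. 0 \<le> t \<Longrightarrow> 0 \<le> W t"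
    and hom: "\<And>l t. 0 < l \<Longrightarrow> 0 \<le> t \<Longrightarrow> W (l * t) = l powr q * W t"
    and Z: "\<And>L. star_body L \<Longrightarrow> Z L = density sphere_area (\<lambda>s. ennreal (W (radial L s)))"
  shows "weak_star_continuous Z" "locally_determined Z" "rotation_equivariant Z"
    "homogeneous q Z" "valuation Z"
proof -
  let ?\<sigma> = "sphere_area :: (real^'n) measure"
  note \<sigma> = sphere_area_measures[where 'n='n]
  note sp = sphere_measuresD(2,3)[OF \<sigma>]
  have cW: "continuous_on unit_sphere (\<lambda>s. W (radial L s))" if "star_body L" for L :: "(real^'n) set"
    by (rule continuous_on_compose2[OF W(1) star_bodyD(3)[OF that]]) (use radial_nonneg[OF that] in auto)
  have Wn: "0 \<le> W (radial L s)" if "star_body L" "s \<in> unit_sphere" for L :: "(real^'n) set" and s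
    using W(2) radial_nonneg[OF that] by simp
  have mW: "(\<lambda>s. W (radial L s)) \<in> borel_measurable ?\<sigma>" if "star_body L" for L
    by (rule sphere_measurable_continuous[OF \<sigma> cW[OF that]])
  have em: "emeasure (Z L) A = (\<integral>\<^sup>+s. ennreal (W (radial L s)) * indicator A s \<partial>?\<sigma>)"
    if "star_body L" "A \<in> sets sphere_borel" for L A
    using that mW by (simp add: Z emeasure_density sp(1))
  show "weak_star_continuous Z"
    unfolding weak_star_continuous_def
  proof (intro allI impI)
    fix g :: "real^'n \<Rightarrow> real" and K :: "(real^'n) set" and e :: real
    assume g: "continuous_on unit_sphere g" and K: "star_body K" and e: "0 < e"
    obtain B where B: "0 < B" "\<And>x. x \<in> unit_sphere \<Longrightarrow> \<bar>g x\<bar> \<le> B"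
      using sphere_continuous_bounded[OF g] by blast
    obtain M where M: "0 < M" "\<And>x. x \<in> unit_sphere \<Longrightarrow> \<bar>radial K x\<bar> \<le> M"
      using sphere_continuous_bounded[OF star_bodyD(3)[OF K]] by blast
    define m where "m = measure ?\<sigma> unit_sphere"
    have m: "0 < m" unfolding m_def by (rule sphere_area_pos)
    \<comment> \<open>Chosen so that the final bound \<open>B * e' * m\<close> equals
      \<open>e / 2\<close>.\<close>
    define e' where "e' = e / (2 * B * m)"
    have e': "0 < e'" using e B m by (simp add: e'_def)
    obtain d where d: "0 < d" "d \<le> 1"
        "\<And>s t. 0 \<le> s \<Longrightarrow> s \<le> M \<Longrightarrow> 0 \<le> t \<Longrightarrow> \<bar>t - s\<bar> \<le> d \<Longrightarrow> \<bar>W t - W s\<bar> \<le> e'"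
      using uniformly_close_composition[OF W(1) less_imp_le[OF M(1)] e'] by blast
    show "\<exists>d>0. \<forall>L. star_body L \<and> radial_dist L K < d \<longrightarrow> \<bar>(\<integral>s. g s \<partial>Z L) - (\<integral>s. g s \<partial>Z K)\<bar> < e"
    proof (intro exI[of _ d] conjI allI impI d(1), elim conjE)
      fix L assume L: "star_body L" "radial_dist L K < d"
      have "\<bar>(\<integral>s. g s \<partial>density ?\<sigma> (\<lambda>s. ennreal (W (radial L s)))) - (\<integral>s. g s \<partial>density ?\<sigma> (\<lambda>s. ennreal (W (radial K s))))\<bar>
          \<le> B * e' * measure ?\<sigma> unit_sphere"
      proof (rule density_integral_diff_le[OF \<sigma> g B(2) cW[OF L(1)] Wn[OF L(1)] cW[OF K] Wn[OF K]])
        fix s :: "real^'n" assume s: "s \<in> unit_sphere"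
        show "\<bar>W (radial L s) - W (radial K s)\<bar> \<le> e'"
          using radial_diff_le_radial_dist[OF L(1) K s] L(2) M(2)[OF s] radial_nonneg[OF L(1) s] radial_nonneg[OF K s]
          by (intro d(3)) auto
      qed auto
      also have "\<dots> = e / 2" using B m by (simp add: e'_def m_def[symmetric])
      also have "\<dots> < e" using e by simp
      finally show "\<bar>(\<integral>s. g s \<partial>Z L) - (\<integral>s. g s \<partial>Z K)\<bar> < e" using Z[OF L(1)] Z[OF K] by simp
    qed
  qed
  show "locally_determined Z"
    unfolding locally_determined_def
  proof (intro allI impI)
    fix B and f1 f2 :: "real^'n \<Rightarrow> real"
    assume B: "openin (top_of_set unit_sphere) B" and f: "continuous_on unit_sphere f1" "\<forall>s\<in>unit_sphere. 0 \<le> f1 s"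
      "continuous_on unit_sphere f2" "\<forall>s\<in>unit_sphere. 0 \<le> f2 s" and eq: "\<forall>s\<in>B. f1 s = f2 s"
    have BU: "B \<subseteq> unit_sphere" using B by (rule openin_imp_subset)
    have Bs: "B \<in> sets sphere_borel" using openin_sphere_sets[OF \<sigma> B] by (simp add: sp(1))
    have L: "star_body (star_body_of f1)" "star_body (star_body_of f2)"
      using star_body_star_body_of[of f1] star_body_star_body_of[of f2] f by auto
    have "radial (star_body_of f1) s = radial (star_body_of f2) s" if "s \<in> B" for s
      using that BU f eq radial_star_body_of[of f1 s] radial_star_body_of[of f2 s] by auto
    then show "emeasure (Z (star_body_of f1)) B = emeasure (Z (star_body_of f2)) B"
      unfolding em[OF L(1) Bs] em[OF L(2) Bs] by (intro nn_integral_cong) (auto simp: indicator_def)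
  qed
  show "rotation_equivariant Z"
    unfolding rotation_equivariant_def
  proof (intro allI impI)
    fix L :: "(real^'n) set" and g :: "real^'n \<Rightarrow> real" and \<phi> :: "real^'n \<Rightarrow> real^'n"
    assume L: "star_body L" and g: "continuous_on unit_sphere g" and \<phi>: "orthogonal_transformation \<phi>"
    have d: "(\<integral>s. k s \<partial>Z M) = (\<integral>s. W (radial M s) * k s \<partial>?\<sigma>)"
      if "star_body M" "continuous_on unit_sphere k" for M and k :: "real^'n \<Rightarrow> real"
      using that Wn sphere_measurable_continuous[OF \<sigma>] mW
      by (simp add: Z, subst integral_real_density) (auto intro!: AE_I2 simp: sp(2))
    have gi: "continuous_on unit_sphere (g \<circ> inv \<phi>)"
      unfolding comp_def by (rule continuous_on_compose2[OF g orthogonal_inv(5)[OF \<phi>]])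
        (auto simp: orthogonal_inv[OF \<phi>])
    have "(\<integral>s. (g \<circ> inv \<phi>) s \<partial>Z (\<phi> ` L)) = (\<integral>s. W (radial L (inv \<phi> s)) * g (inv \<phi> s) \<partial>?\<sigma>)"
      unfolding d[OF star_body_orthogonal[OF \<phi> L] gi] by (simp add: radial_orthogonal[OF \<phi>])
    also have "\<dots> = (\<integral>s. W (radial L s) * g s \<partial>?\<sigma>)"
      using integral_sphere_area_orthogonal[OF orthogonal_inv(1)[OF \<phi>], of "\<lambda>s. W (radial L s) * g s"]
        cW[OF L] g by (simp add: continuous_on_mult)
    finally show "(\<integral>s. (g \<circ> inv \<phi>) s \<partial>Z (\<phi> ` L)) = (\<integral>s. g s \<partial>Z L)" by (simp add: d[OF L g])
  qed
  show "homogeneous q Z"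
    unfolding homogeneous_def
  proof (intro allI impI)
    fix L :: "(real^'n) set" and l :: real
    assume L: "star_body L" and l: "0 < l"
    show "Z ((*\<^sub>R) l ` L) = scale_measure (ennreal (l powr q)) (Z L)"
    proof (rule measure_eqI)
      show "sets (Z ((*\<^sub>R) l ` L)) = sets (scale_measure (ennreal (l powr q)) (Z L))"
        using Z[OF L] Z[OF star_body_scale[OF L l]] by simp
      fix A assume "A \<in> sets (Z ((*\<^sub>R) l ` L))"
      then have A: "A \<in> sets sphere_borel" using Z[OF star_body_scale[OF L l]] by (simp add: sp(1))
      have "emeasure (Z ((*\<^sub>R) l ` L)) A = (\<integral>\<^sup>+s. ennreal (l powr q) * (ennreal (W (radial L s)) * indicator A s) \<partial>?\<sigma>)"
        unfolding em[OF star_body_scale[OF L l] A]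
      proof (rule nn_integral_cong)
        fix s assume "s \<in> space ?\<sigma>"
        then have s: "s \<in> unit_sphere" by (simp add: sp(2))
        show "ennreal (W (radial ((*\<^sub>R) l ` L) s)) * indicator A s
            = ennreal (l powr q) * (ennreal (W (radial L s)) * indicator A s)"
          using Wn[OF L s] by (simp add: radial_scale[OF L l s] hom[OF l radial_nonneg[OF L s]] ennreal_mult mult.assoc)
      qed
      also have "\<dots> = ennreal (l powr q) * emeasure (Z L) A"
        unfolding em[OF L A] using A[folded sp(1)] mW[OF L] by (intro nn_integral_cmult) auto
      finally show "emeasure (Z ((*\<^sub>R) l ` L)) A = emeasure (scale_measure (ennreal (l powr q)) (Z L)) A" by simp
    qed
  qed
  show "valuation Z"
    unfolding valuation_def
  proof (intro allI impI ballI)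
    fix K L B :: "(real^'n) set"
    assume K: "star_body K" and L: "star_body L" and B: "B \<in> sets (sphere_borel :: (real^'n) measure)"
    note U = star_body_Un_Int(1)[OF K L] and I = star_body_Un_Int(2)[OF K L]
    have add: "emeasure (Z M) B + emeasure (Z N) B
        = (\<integral>\<^sup>+s. ennreal (W (radial M s)) * indicator B s + ennreal (W (radial N s)) * indicator B s \<partial>?\<sigma>)"
      if "star_body M" "star_body N" for M N
      unfolding em[OF that(1) B] em[OF that(2) B] using B[folded sp(1)] mW that
      by (intro nn_integral_add[symmetric]) auto
    show "emeasure (Z (K \<union> L)) B + emeasure (Z (K \<inter> L)) B = emeasure (Z K) B + emeasure (Z L) B"
      unfolding add[OF U I] add[OF K L]
    proof (rule nn_integral_cong)
      fix s assume "s \<in> space ?\<sigma>"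
      then have s: "s \<in> unit_sphere" by (simp add: sp(2))
      show "ennreal (W (radial (K \<union> L) s)) * indicator B s + ennreal (W (radial (K \<inter> L) s)) * indicator B s
          = ennreal (W (radial K s)) * indicator B s + ennreal (W (radial L s)) * indicator B s"
        unfolding radial_Un_Int[OF K L s] by (cases "radial K s \<le> radial L s") (auto simp: max_def min_def add.commute)
    qed
  qed
qed

lemma dual_area_measure_weighted:
  fixes L :: "(real^'n) set"
  assumes L: "star_body L" and q: "0 \<le> q" and c: "0 \<le> c"
  shows "scale_measure (ennreal c) (dual_area_measure q L)
    = density sphere_area (\<lambda>s. ennreal (c / real CARD('n) * powr_weight q (radial L s)))"
proof (rule measure_eqI)
  show "sets (scale_measure (ennreal c) (dual_area_measure q L))
      = sets (density sphere_area (\<lambda>s. ennreal (c / real CARD('n) * powr_weight q (radial L s))))"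
    by (simp add: dual_area_measure_eq)
  let ?\<sigma> = "sphere_area :: (real^'n) measure"
  note \<sigma> = sphere_area_measures[where 'n='n]
  note sp = sphere_measuresD(2,3)[OF \<sigma>]
  have "continuous_on unit_sphere (\<lambda>s. powr_weight q (radial L s))"
    by (rule continuous_on_compose2[OF continuous_on_powr_weight[OF q] star_bodyD(3)[OF L]])
      (use radial_nonneg[OF L] in auto)
  then have m: "(\<lambda>s. powr_weight q (radial L s)) \<in> borel_measurable ?\<sigma>"
    by (rule sphere_measurable_continuous[OF \<sigma>])
  have ext: "ext_powr (radial L s) q = ennreal (powr_weight q (radial L s))" if "s \<in> space ?\<sigma>" for s
    using that radial_nonneg[OF L] q by (intro ext_powr_eq) (auto simp: sp(2))
  have "density ?\<sigma> (\<lambda>s. ext_powr (radial L s) q) = density ?\<sigma> (\<lambda>s. ennreal (powr_weight q (radial L s)))"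
    using ext m by (intro density_cong) (auto intro!: AE_I2 simp: measurable_cong[OF ext])
  then have eq: "scale_measure (ennreal c) (dual_area_measure q L)
      = scale_measure (ennreal (c / real CARD('n))) (density ?\<sigma> (\<lambda>s. ennreal (powr_weight q (radial L s))))"
    using c by (simp add: dual_area_measure_eq ennreal_mult[symmetric])
  fix A assume "A \<in> sets (scale_measure (ennreal c) (dual_area_measure q L))"
  then have A: "A \<in> sets ?\<sigma>" by (simp add: dual_area_measure_eq)
  have "emeasure (scale_measure (ennreal c) (dual_area_measure q L)) A
      = ennreal (c / real CARD('n)) * (\<integral>\<^sup>+s. ennreal (powr_weight q (radial L s)) * indicator A s \<partial>?\<sigma>)"
    unfolding eq using A m by (simp add: emeasure_density)
  also have "\<dots> = (\<integral>\<^sup>+s. ennreal (c / real CARD('n)) * (ennreal (powr_weight q (radial L s)) * indicator A s) \<partial>?\<sigma>)"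
    using A m by (intro nn_integral_cmult[symmetric]) auto
  also have "\<dots> = (\<integral>\<^sup>+s. ennreal (c / real CARD('n) * powr_weight q (radial L s)) * indicator A s \<partial>?\<sigma>)"
    by (subst ennreal_mult) (use c in \<open>simp_all add: powr_weight_nonneg mult.assoc\<close>)
  also have "\<dots> = emeasure (density ?\<sigma> (\<lambda>s. ennreal (c / real CARD('n) * powr_weight q (radial L s)))) A"
    using A m by (simp add: emeasure_density)
  finally show "emeasure (scale_measure (ennreal c) (dual_area_measure q L)) A
      = emeasure (density ?\<sigma> (\<lambda>s. ennreal (c / real CARD('n) * powr_weight q (radial L s)))) A" .
qed

text \<open>For \<open>c = 0\<close> every \<open>q\<close> is covered, because
  \<open>0 * \<infinity> = 0\<close> turns even an infinite dual area measure into the zero measure.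
  For \<open>c > 0\<close>, finiteness of the values of \<open>Z\<close> excludes
  \<open>q < 0\<close>, and a continuous real weight remains.\<close>

lemma weighted_dual_area_properties:
  fixes Z :: "(real^'n) set \<Rightarrow> (real^'n) measure"
  assumes Zm: "star_body_map Z" and c: "0 \<le> c"
    and Z: "\<And>L. star_body L \<Longrightarrow> Z L = scale_measure (ennreal c) (dual_area_measure q L)"
  shows "weak_star_continuous Z \<and> locally_determined Z \<and> rotation_equivariant Z
            \<and> homogeneous q Z \<and> valuation Z"
proof -
  let ?\<sigma> = "sphere_area :: (real^'n) measure"
  note \<sigma> = sphere_area_measures[where 'n='n]
  note sp = sphere_measuresD(2,3)[OF \<sigma>]
  show ?thesis
  proof (cases "c = 0")
    case True
    have "Z L = density sphere_area (\<lambda>s. ennreal 0)" if "star_body L" for L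
      unfolding Z[OF that] by (rule measure_eqI) (simp_all add: True dual_area_measure_eq emeasure_density)
    then show ?thesis
      using weighted_area_properties[of "\<lambda>_. 0" q Z] by simp
  next
    case False
    have q: "0 \<le> q"
    proof (rule ccontr)
      assume "\<not> 0 \<le> q"
      \<comment> \<open>At radius 0 the convention \<open>0^q = \<infinity>\<close> makes the
        density infinite on the whole sphere, which has positive area.\<close>
      define L where "L = star_body_of (\<lambda>_ :: real^'n. 0)"
      have L: "star_body L" unfolding L_def by (rule star_body_star_body_of) auto
      have U: "unit_sphere \<in> sets ?\<sigma>" using sets.top[of ?\<sigma>] by (simp only: sp(2))
      have "ext_powr (radial L s) q = \<infinity>" if "s \<in> space ?\<sigma>" for s
        using that \<open>\<not> 0 \<le> q\<close> by (simp add: L_def radial_star_body_of sp(2) ext_powr_def)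
      then have "density ?\<sigma> (\<lambda>s. ext_powr (radial L s) q) = density ?\<sigma> (\<lambda>s. \<infinity>)"
        by (intro density_cong) (auto intro!: AE_I2 cong: measurable_cong)
      then have "emeasure (Z L) unit_sphere = ennreal c * (ennreal (1 / real CARD('n)) * (\<infinity> * emeasure ?\<sigma> unit_sphere))"
        using U by (simp add: Z[OF L] dual_area_measure_eq emeasure_density nn_integral_cmult_indicator mult.assoc)
      moreover have "emeasure ?\<sigma> unit_sphere \<noteq> 0"
        using sphere_area_pos[where 'n='n] by (auto simp: measure_def)
      ultimately have "emeasure (Z L) unit_sphere = \<infinity>"
        using c False by (simp add: ennreal_mult_top ennreal_top_mult ennreal_mult_eq_top_iff)
      moreover have "Z L \<in> sphere_measures" using Zm L by (simp add: star_body_map_def)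
      ultimately show False
        using finite_measure.emeasure_finite[OF sphere_measuresD(1)] by auto
    qed
    have W: "continuous_on {0..} (\<lambda>t. c / real CARD('n) * powr_weight q t)"
      by (intro continuous_intros continuous_on_powr_weight q)
    have "Z L = density sphere_area (\<lambda>s. ennreal (c / real CARD('n) * powr_weight q (radial L s)))"
      if "star_body L" for L
      unfolding Z[OF that] by (rule dual_area_measure_weighted[OF that q c])
    then show ?thesis
      using weighted_area_properties[OF W _ _, of q Z] c
      by (simp add: powr_weight_nonneg powr_weight_mult)
  qed
qed


text \<open>Everything reduces to the balls \<open>S t\<close>: positive radii come from
  homogeneity, radius 0 from weak* continuity, and the values on balls determine \<open>Z\<close> by
  the representation theorem.\<close>

lemma valuation_eq_weighted_dual_area:
  fixes Z :: "(real^'n) set \<Rightarrow> (real^'n) measure"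
  assumes Z: "star_body_map Z" "locally_determined Z" "weak_star_continuous Z"
    and rot: "rotation_equivariant Z" and hom: "homogeneous q Z"
  shows "\<exists>c\<ge>0. \<forall>L. star_body L \<longrightarrow> Z L = scale_measure (ennreal c) (dual_area_measure q L)"
proof -
  let ?\<sigma> = "sphere_area :: (real^'n) measure"
  note \<sigma> = sphere_area_measures[where 'n='n]
  define S where "S t = star_body_of (\<lambda>_ :: real^'n. t)" for t :: real
  define \<mu> where "\<mu> = Z (S 1)"
  have SS: "star_body (S t)" "Z (S t) \<in> sphere_measures" if "0 \<le> t" for t
    unfolding S_def using that star_body_map_measures[OF Z(1), of "\<lambda>_. t"]
    by (auto intro!: star_body_star_body_of)
  have rS: "radial (S t) s = t" if "0 \<le> t" "s \<in> unit_sphere" for t s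
    unfolding S_def by (rule radial_star_body_of) (use that in auto)
  have same: "Z K = Z L" if "star_body K" "star_body L" "\<And>s. s \<in> unit_sphere \<Longrightarrow> radial K s = radial L s" for K L
    using Z(1) that unfolding star_body_map_def by blast
  have \<mu>: "\<mu> \<in> sphere_measures" unfolding \<mu>_def by (rule SS) simp
  note sp = sphere_measuresD(2,3)[OF \<mu>]
  have inv\<mu>: "(\<integral>x. g (\<phi> x) \<partial>\<mu>) = (\<integral>x. g x \<partial>\<mu>)"
    if \<phi>: "orthogonal_transformation \<phi>" and g: "continuous_on unit_sphere g"
    for \<phi> :: "real^'n \<Rightarrow> real^'n" and g :: "real^'n \<Rightarrow> real"
  proof -
    note \<phi>' = orthogonal_inv(1)[OF \<phi>]
    have "inv (inv \<phi>) = \<phi>" using orthogonal_transformation_bij[OF \<phi>] by (rule inv_inv_eq)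
    \<comment> \<open>Equivariance is applied to \<open>inv \<phi>\<close>, so that the inverse in
      its definition cancels and \<open>g (\<phi> x)\<close> appears.\<close>
    moreover have "Z (inv \<phi> ` S 1) = Z (S 1)"
      by (rule same) (auto simp: star_body_orthogonal[OF \<phi>'] SS radial_orthogonal[OF \<phi>'] rS
          orthogonal_inv[OF \<phi>'])
    ultimately show ?thesis
      using rot[unfolded rotation_equivariant_def, rule_format, OF SS(1)[of 1] g \<phi>'] by (simp add: \<mu>_def comp_def)
  qed
  define c where "c = measure \<mu> unit_sphere / measure ?\<sigma> unit_sphere"
  have c: "0 \<le> c" by (simp add: c_def)
  have \<mu>\<sigma>: "\<mu> = scale_measure (ennreal c) ?\<sigma>"
    unfolding c_def by (rule rotation_invariant_measure_unique[OF \<mu> \<sigma> inv\<mu> integral_sphere_area_orthogonal sphere_area_pos])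
  have hom_t: "Z (S t) = scale_measure (ennreal (t powr q)) \<mu>" if t: "0 < t" for t
  proof -
    have "Z ((*\<^sub>R) t ` S 1) = scale_measure (ennreal (t powr q)) \<mu>"
      using hom SS(1)[of 1] t unfolding homogeneous_def \<mu>_def by simp
    moreover have "Z ((*\<^sub>R) t ` S 1) = Z (S t)"
      by (rule same) (use t in \<open>auto simp: star_body_scale SS radial_scale rS\<close>)
    ultimately show ?thesis by simp
  qed
  have int_scale: "(\<integral>x. g x \<partial>scale_measure (ennreal a) \<mu>) = a * (\<integral>x. g x \<partial>\<mu>)"
    if "0 \<le> a" "continuous_on unit_sphere g" for a and g :: "real^'n \<Rightarrow> real"
    using that sphere_measurable_continuous[OF \<mu> that(2)] by (simp add: scale_measure_eq_density integral_density)
  have scale: "scale_measure (ennreal a) \<mu> \<in> sphere_measures" for a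
    using \<mu> finite_measure.emeasure_finite[OF sphere_measuresD(1)[OF \<mu>], of "space \<mu>"]
    by (auto simp: sphere_measures_def space_scale_measure ennreal_mult_eq_top_iff intro!: finite_measureI)
  have lim: "((\<lambda>t. t powr q * (\<integral>x. g x \<partial>\<mu>)) \<longlongrightarrow> (\<integral>x. g x \<partial>Z (S 0))) (at_right 0)"
    if g: "continuous_on unit_sphere g" for g :: "real^'n \<Rightarrow> real"
  proof (rule tendstoI)
    fix e :: real assume e: "0 < e"
    obtain d where d: "0 < d" "\<And>h. continuous_on unit_sphere h \<Longrightarrow> (\<And>x. x \<in> unit_sphere \<Longrightarrow> 0 \<le> h x) \<Longrightarrow>
      (\<And>x. x \<in> unit_sphere \<Longrightarrow> \<bar>h x - 0\<bar> \<le> d) \<Longrightarrow>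
      \<bar>(\<integral>x. g x \<partial>Z (star_body_of h)) - (\<integral>x. g x \<partial>Z (S 0))\<bar> < e"
      using weak_star_continuous_at[OF Z(3) g, of "\<lambda>_. 0" e] e unfolding S_def by auto
    have "dist (t powr q * (\<integral>x. g x \<partial>\<mu>)) (\<integral>x. g x \<partial>Z (S 0)) < e" if t: "0 < t" "t < d" for t
    proof -
      have "\<bar>(\<integral>x. g x \<partial>Z (S t)) - (\<integral>x. g x \<partial>Z (S 0))\<bar> < e"
        unfolding S_def[of t] by (rule d(2)) (use t in auto)
      then show ?thesis using int_scale[OF _ g, of "t powr q"] by (simp add: hom_t[OF t(1)] dist_real_def)
    qed
    then show "\<forall>\<^sub>F t in at_right 0. dist (t powr q * (\<integral>x. g x \<partial>\<mu>)) (\<integral>x. g x \<partial>Z (S 0)) < e"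
      using d(1) unfolding eventually_at_right_field by (intro exI[of _ d]) auto
  qed
  have rep: "Z L = density \<mu> (\<lambda>s. ennreal (w (radial L s)))"
    if L: "star_body L" and w: "continuous_on {0..} w" "\<And>t. 0 \<le> t \<Longrightarrow> 0 \<le> w t"
      and const: "\<And>t. 0 \<le> t \<Longrightarrow> Z (S t) = scale_measure (ennreal (w t)) \<mu>" for w L
  proof -
    \<comment> \<open>\<open>L\<close> need not be closed, so it is exchanged for the closed body
      with the same radial function, on which \<open>Z\<close> takes the same value.\<close>
    have "Z L = Z (star_body_of (radial L))"
      using star_body_star_body_of[of "radial L"] radial_star_body_of[of "radial L"] radial_nonneg[OF L] star_bodyD(3)[OF L] L
      by (intro same) auto
    also have "\<dots> = density \<mu> (\<lambda>s. ennreal (w (radial L s)))"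
      by (rule local_functional_representation[OF Z \<mu> w const[unfolded S_def] star_bodyD(3)[OF L] radial_nonneg[OF L]])
    finally show ?thesis .
  qed
  show ?thesis
  proof (cases "0 \<le> q")
    case q: True
    have "Z (S 0) = scale_measure (ennreal (powr_weight q 0)) \<mu>"
    proof (rule sphere_measure_eqI_integral[OF SS(2) scale])
      fix g :: "real^'n \<Rightarrow> real" assume g: "continuous_on unit_sphere g"
      have "((\<lambda>t. t powr q * (\<integral>x. g x \<partial>\<mu>)) \<longlongrightarrow> powr_weight q 0 * (\<integral>x. g x \<partial>\<mu>)) (at_right 0)"
        by (intro tendsto_mult_right tendsto_powr_weight_0 q)
      then have "(\<integral>x. g x \<partial>Z (S 0)) = powr_weight q 0 * (\<integral>x. g x \<partial>\<mu>)"
        using tendsto_unique[OF trivial_limit_at_right_real lim[OF g]] by simp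
      then show "(\<integral>x. g x \<partial>Z (S 0)) = (\<integral>x. g x \<partial>scale_measure (ennreal (powr_weight q 0)) \<mu>)"
        by (simp add: int_scale[OF powr_weight_nonneg g])
    qed simp
    then have const: "Z (S t) = scale_measure (ennreal (powr_weight q t)) \<mu>" if "0 \<le> t" for t
      using hom_t[of t] that by (cases "t = 0") (auto simp: powr_weight_def)
    \<comment> \<open>The factor \<open>CARD('n)\<close> undoes the normalisation
      \<open>1 / n\<close> of the dual area measure.\<close>
    have "Z L = scale_measure (ennreal (real CARD('n) * c)) (dual_area_measure q L)" if L: "star_body L" for L
    proof -
      have "continuous_on unit_sphere (\<lambda>s. powr_weight q (radial L s))"
        by (rule continuous_on_compose2[OF continuous_on_powr_weight[OF q] star_bodyD(3)[OF L]])
          (use radial_nonneg[OF L] in auto)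
      then have m: "(\<lambda>s. powr_weight q (radial L s)) \<in> borel_measurable ?\<sigma>"
        by (rule sphere_measurable_continuous[OF \<sigma>])
      have "Z L = density \<mu> (\<lambda>s. ennreal (powr_weight q (radial L s)))"
        by (rule rep[OF L continuous_on_powr_weight[OF q] powr_weight_nonneg const])
      also have "\<dots> = density ?\<sigma> (\<lambda>s. ennreal c * ennreal (powr_weight q (radial L s)))"
        unfolding \<mu>\<sigma> scale_measure_eq_density using m by (intro density_density_eq) auto
      also have "\<dots> = scale_measure (ennreal (real CARD('n) * c)) (dual_area_measure q L)"
        by (subst dual_area_measure_weighted[OF L q])
          (use c in \<open>simp_all add: ennreal_mult powr_weight_nonneg del: of_nat_mult\<close>)
      finally show ?thesis .
    qed
    then show ?thesis using c by (intro exI[of _ "real CARD('n) * c"]) auto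
  next
    case q: False
    have U: "unit_sphere \<in> sets \<mu>" using sets.top[of \<mu>] by (simp only: sp(2))
    define m where "m = measure \<mu> unit_sphere"
    \<comment> \<open>The masses \<open>t powr q * m\<close> converge as \<open>t\<close> tends to
      0, while \<open>t powr (- q)\<close> tends to 0; yet their product is constantly
      \<open>m\<close>, so \<open>m = 0\<close>.\<close>
    have "((\<lambda>t. t powr (- q) * (t powr q * m)) \<longlongrightarrow> 0 * (\<integral>x. 1 \<partial>Z (S 0))) (at_right 0)"
      using tendsto_mult[OF tendsto_powr_weight_0[of "- q"] lim[of "\<lambda>_. 1"]] q
      by (simp add: powr_weight_def m_def sp)
    moreover have "\<forall>\<^sub>F t in at_right 0. t powr (- q) * (t powr q * m) = m"
      unfolding eventually_at_right_field
      by (intro exI[of _ 1]) (auto simp: powr_minus field_simps)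
    ultimately have "((\<lambda>_. m) \<longlongrightarrow> 0) (at_right (0::real))"
      by (simp add: tendsto_cong)
    then have "m = 0" by (simp add: tendsto_const_iff)
    then have "emeasure \<mu> unit_sphere = 0"
      using finite_measure.emeasure_eq_measure[OF sphere_measuresD(1)[OF \<mu>]] by (simp add: m_def)
    then have null: "emeasure \<mu> A = 0" for A
      using emeasure_mono[of A unit_sphere \<mu>] U sets.sets_into_space[of A \<mu>] sp(2)
      by (cases "A \<in> sets \<mu>") (auto simp: emeasure_notin_sets)
    have \<mu>0: "scale_measure a \<mu> = \<mu>" for a
      by (rule measure_eqI) (simp_all add: null)
    have i0: "(\<integral>x. g x \<partial>\<mu>) = 0" if "continuous_on unit_sphere g" for g :: "real^'n \<Rightarrow> real"
      using int_scale[OF _ that, of 0] by (simp only: \<mu>0 mult_zero_left order_refl)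
    have "Z (S 0) = \<mu>"
    proof (rule sphere_measure_eqI_integral[OF SS(2) \<mu>])
      fix g :: "real^'n \<Rightarrow> real" assume g: "continuous_on unit_sphere g"
      show "(\<integral>x. g x \<partial>Z (S 0)) = (\<integral>x. g x \<partial>\<mu>)"
        using lim[OF g] by (simp add: i0[OF g] tendsto_const_iff)
    qed simp
    \<comment> \<open>As \<open>\<mu>\<close> is null, any scaling of it is \<open>\<mu>\<close>
      itself; the weight 0 is chosen because it is continuous at 0, unlike a negative power.\<close>
    then have const: "Z (S t) = scale_measure (ennreal 0) \<mu>" if "0 \<le> t" for t
      using hom_t[of t] that unfolding \<mu>0 by (cases "t = 0") auto
    have "Z L = scale_measure (ennreal 0) (dual_area_measure q L)" if L: "star_body L" for L
    proof -
      have "Z L = density \<mu> (\<lambda>s. ennreal 0)"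
        by (rule rep[OF L continuous_on_const order_refl const])
      also have "\<dots> = scale_measure (ennreal 0) (dual_area_measure q L)"
        by (rule measure_eqI) (auto simp: emeasure_density dual_area_measure_eq sp sets_sphere_area)
      finally show ?thesis .
    qed
    then show ?thesis by blast
  qed
qed

theorem theorem1p3:
  fixes Z :: "(real^'n) set \<Rightarrow> (real^'n) measure" and q :: real
  assumes "star_body_map Z"
  shows "(weak_star_continuous Z \<and> locally_determined Z \<and> rotation_equivariant Z
            \<and> homogeneous q Z \<and> valuation Z)
     \<longleftrightarrow> (\<exists>c\<ge>0. \<forall>L. star_body L \<longrightarrow> Z L = scale_measure (ennreal c) (dual_area_measure q L))"
  using valuation_eq_weighted_dual_area[of Z q] weighted_dual_area_properties[of Z _ q] assms by meson

end
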